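(* There are at most $\omega_1$ many pairwise non-homeomorphic $t$-sets; that is, every family of pairwise non-homeomorphic $t$-sets $A\subseteq\mathbb R$ has cardinality at most $\omega_1$ (the first uncountable cardinal).
   Context: A copy of a set $A\subseteq\mathbb R$ is a set $Y\subseteq\mathbb R$ homeomorphic to $A$ (subspace topologies). A set $A\subseteq\mathbb R$ is a $t$-set (tame in $\mathbb R$) if for every copy $Y\subseteq\mathbb R$ of $A$ there exists a homeomorphism $f\colon\mathbb R\to\mathbb R$ such that $f[A]=Y$. *)

theory Defs
  imports "HOL-Analysis.Analysis"
begin

unbundle cardinal_syntax

definition t_set :: "real set \<Rightarrow> bool" where
  "t_set A \<longleftrightarrow> (\<forall>Y :: real set. A homeomorphic Y \<longrightarrow>
     (\<exists>f g :: real \<Rightarrow> real. homeomorphism UNIV UNIV f g \<and> f ` A = Y))"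

end

theory Submission
  imports Defs
begin

text \<open>A t-set is compact, since \<open>x \<mapsto> 1 / (p - x)\<close> and \<open>arctan\<close> provide unbounded and bounded copies.
  Rearranging clopen pieces shows that all points of a t-set that can be brought to an end of a copy
  lie in one orbit of its homeomorphism group (unless it has at most two components). Hence either
  nondegenerate intervals are dense and a back-and-forth argument leaves one homeomorphism type, or
  all these points have clopen neighbourhoods of one fixed kind (a point, an interval or a Cantor set)
  and the other points lie on intervals that are limits from both sides. Rearranging once more, the
  two sides of such an interval absorb the same clopen sets. Such sets are built up inductively from
  prime pieces, and any two prime pieces are comparable by clopen embedding; this replaces the
  Cantor--Bendixson rank. As a compact set has only countably many clopen subsets, the homeomorphism types
  of each kind carry a total relation with countable initial segments, so there are at most
  \<open>\<omega>\<^sub>1\<close> of them.\<close>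

section \<open>Clopen subsets of compact sets\<close>

text \<open>Any two copies of a t-set differ by a monotone map of the line. Order features of one
  copy are therefore forced on every other one up to reflection, and each use of the hypothesis
  builds two copies that differ in order. The obstacle is the reflection: the two copies are either
  given the same auxiliary point at one end, or chosen so that the second shows the feature in
  neither orientation (\<open>lopsided\<close>). The next obstacle is a set that holds two disjoint
  copies of itself, because the presence of copies on one side of an interval then cannot be tested
  by rearrangement; prime sets of this sort turn out to embed in a base piece
  (\<open>prime_set_dbl\<close>), and base pieces accumulate on both sides anyway. On prime sets
  \<open>embeds\<close> is a total preorder whose strict part is well-founded, which is all that an
  ordinal rank would supply. \<open>locally_in\<close> carries totality from prime neighbourhoods to
  whole t-sets.\<close>

definition topemb :: "real set \<Rightarrow> (real \<Rightarrow> real) \<Rightarrow> bool" where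
  "topemb X f \<longleftrightarrow> continuous_on X f \<and> inj_on f X"

text \<open>Relative clopenness in a compact set of reals, expressed by compactness of both parts.
  This form forces \<open>X\<close> to be compact and is symmetric in \<open>C\<close> and
  \<open>X - C\<close>.\<close>

definition clopen_in :: "real set \<Rightarrow> real set \<Rightarrow> bool" where
  "clopen_in X C \<longleftrightarrow> C \<subseteq> X \<and> compact C \<and> compact (X - C)"

definition embeds :: "real set \<Rightarrow> real set \<Rightarrow> bool" where
  "embeds C X \<longleftrightarrow> (\<exists>D. clopen_in X D \<and> C homeomorphic D)"

lemma homeomorphic_topemb: "compact X \<Longrightarrow> topemb X f \<Longrightarrow> X homeomorphic (f ` X)"
  unfolding topemb_def by (auto intro: homeomorphic_compact)

lemma homeomorphic_topembE:
  assumes "X homeomorphic Y" obtains f where "topemb X f" "f ` X = Y"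
  using assms unfolding homeomorphic_def homeomorphism_def topemb_def
  by (metis inj_on_inverseI)

lemma topemb_subset: "topemb X f \<Longrightarrow> Y \<subseteq> X \<Longrightarrow> topemb Y f"
  unfolding topemb_def by (meson continuous_on_subset inj_on_subset)

lemma topemb_compose: "topemb X f \<Longrightarrow> topemb (f ` X) g \<Longrightarrow> topemb X (\<lambda>x. g (f x))"
  unfolding topemb_def using continuous_on_compose comp_inj_on
  by (metis comp_def continuous_on_cong inj_on_cong)

lemma topemb_inverse:
  assumes "compact X" "topemb X f"
  obtains g where "topemb (f ` X) g" "\<And>x. x \<in> X \<Longrightarrow> g (f x) = x" "g ` f ` X = X"
proof -
  obtain g where g: "homeomorphism X (f ` X) f g"
    using homeomorphism_compact[of X f "f ` X"] assms unfolding topemb_def by blast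
  show ?thesis
  proof (rule that[of g])
    show "topemb (f ` X) g"
      using g unfolding homeomorphism_def topemb_def by (metis inj_on_inverseI)
  qed (use g in \<open>auto simp: homeomorphism_def\<close>)
qed

lemma compact_topemb_image: "compact X \<Longrightarrow> topemb X f \<Longrightarrow> compact (f ` X)"
  unfolding topemb_def by (simp add: compact_continuous_image)

lemma topemb_affine: "a \<noteq> 0 \<Longrightarrow> topemb X (\<lambda>x. a * x + b)"
  unfolding topemb_def by (auto intro!: continuous_intros inj_onI)

lemma homeomorphic_affine_image: "compact X \<Longrightarrow> a \<noteq> 0 \<Longrightarrow> X homeomorphic ((\<lambda>x. a * x + b) ` X)"
  for X :: "real set"
  by (rule homeomorphic_topemb) (auto intro: topemb_affine)

lemma clopen_in_self: "compact X \<Longrightarrow> clopen_in X X"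
  and clopen_in_empty: "compact X \<Longrightarrow> clopen_in X {}"
  unfolding clopen_in_def by auto

lemma clopen_in_subset: "clopen_in X C \<Longrightarrow> C \<subseteq> X"
  and clopen_in_compact: "clopen_in X C \<Longrightarrow> compact C"
  and clopen_in_compl: "clopen_in X C \<Longrightarrow> clopen_in X (X - C)"
  unfolding clopen_in_def by (auto simp: double_diff)

lemma clopen_in_compact_carrier: "clopen_in X C \<Longrightarrow> compact X"
  unfolding clopen_in_def by (metis Diff_partition compact_Un)

lemma clopen_in_Un: "clopen_in X C \<Longrightarrow> clopen_in X D \<Longrightarrow> clopen_in X (C \<union> D)"
  unfolding clopen_in_def by (auto simp: Diff_Un intro!: compact_Un compact_Int)

lemma clopen_in_Int: "clopen_in X C \<Longrightarrow> clopen_in X D \<Longrightarrow> clopen_in X (C \<inter> D)"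
  unfolding clopen_in_def by (auto simp: Diff_Int intro!: compact_Un compact_Int)

lemma clopen_in_Diff: "clopen_in X C \<Longrightarrow> clopen_in X D \<Longrightarrow> clopen_in X (C - D)"
  using clopen_in_Int[of X C "X - D"] clopen_in_compl[of X D] clopen_in_subset[of X C]
  by (metis Diff_Int_distrib Diff_empty Int_Diff inf.absorb1)

lemma clopen_in_trans:
  assumes "clopen_in X C" "clopen_in C D" shows "clopen_in X D"
proof -
  have "X - D = (X - C) \<union> (C - D)"
    using assms unfolding clopen_in_def by auto
  then show ?thesis using assms unfolding clopen_in_def by (auto intro: compact_Un)
qed

lemma clopen_in_restrict:
  assumes "clopen_in X D" "compact C" "C \<subseteq> X" shows "clopen_in C (C \<inter> D)"
proof -
  have "C - (C \<inter> D) = C \<inter> (X - D)" using assms by auto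
  then show ?thesis using assms unfolding clopen_in_def by (auto intro: compact_Int)
qed

lemma clopen_in_mono: "clopen_in X D \<Longrightarrow> compact C \<Longrightarrow> C \<subseteq> X \<Longrightarrow> D \<subseteq> C \<Longrightarrow> clopen_in C D"
  using clopen_in_restrict[of X D C] by (simp add: inf.absorb2)

lemma clopen_in_image:
  assumes "topemb X f" "clopen_in X C" shows "clopen_in (f ` X) (f ` C)"
proof -
  have "f ` X - f ` C = f ` (X - C)"
    using assms unfolding topemb_def clopen_in_def by (metis inj_on_image_set_diff Diff_subset)
  then show ?thesis
    using assms topemb_subset unfolding clopen_in_def
    by (metis Diff_subset compact_topemb_image image_mono)
qed

lemma clopen_in_vimage:
  assumes "compact X" "topemb X f" "clopen_in (f ` X) D"
  obtains C where "clopen_in X C" "f ` C = D"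
proof -
  obtain g where g: "topemb (f ` X) g" "\<And>x. x \<in> X \<Longrightarrow> g (f x) = x" "g ` f ` X = X"
    using topemb_inverse assms(1,2) by blast
  have "D \<subseteq> f ` X" using assms(3) clopen_in_subset by blast
  then have "f ` g ` D = D" using g(2) by force
  then show thesis using that[of "g ` D"] clopen_in_image[OF g(1) assms(3)] g(3) by simp
qed

text \<open>A point outside \<open>X\<close> separates what lies below it from what lies above it.
  Most concrete clopen sets of the development are cut out by such gaps.\<close>

lemma clopen_in_gap:
  assumes "compact X" "g \<notin> X" shows "clopen_in X (X \<inter> {g..})" "clopen_in X (X \<inter> {..g})"
proof -
  have eq: "X - (X \<inter> {g..}) = X \<inter> {..g}" "X - (X \<inter> {..g}) = X \<inter> {g..}"
    using assms(2) by (auto simp: not_le)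
  show "clopen_in X (X \<inter> {g..})" "clopen_in X (X \<inter> {..g})"
    unfolding clopen_in_def eq using assms(1) by (simp_all add: compact_Int_closed)
qed

lemma clopen_in_gap2:
  assumes "compact X" "g \<notin> X" "h \<notin> X" shows "clopen_in X (X \<inter> {g..h})"
proof -
  have "X \<inter> {g..h} = (X \<inter> {g..}) \<inter> (X \<inter> {..h})" by auto
  then show ?thesis using clopen_in_gap assms clopen_in_Int by metis
qed

lemma connected_clopen_in:
  assumes "clopen_in X C" "connected S" "S \<subseteq> X" "S \<inter> C \<noteq> {}" shows "S \<subseteq> C"
proof -
  have "closed C" "closed (X - C)" using assms(1) unfolding clopen_in_def by (auto intro: compact_imp_closed)
  then have "C \<inter> S = {} \<or> (X - C) \<inter> S = {}"
    using assms(1,3) clopen_in_subset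
    by (intro connected_closedD[OF assms(2)]) auto
  then show ?thesis using assms by blast
qed

lemma interval_clopen_in:
  fixes a b :: real
  assumes "clopen_in X C" "{a..b} \<subseteq> X" "{a..b} \<inter> C \<noteq> {}" shows "{a..b} \<subseteq> C"
  using connected_clopen_in[OF assms(1) _ assms(2,3)] by simp

lemma homeomorphic_Un:
  fixes S1 S2 T1 T2 :: "real set"
  assumes "compact S1" "compact S2" "S1 \<inter> S2 = {}" "T1 \<inter> T2 = {}"
    and "S1 homeomorphic T1" "S2 homeomorphic T2"
  shows "(S1 \<union> S2) homeomorphic (T1 \<union> T2)"
proof -
  obtain f where f: "topemb S1 f" "f ` S1 = T1" using assms(5) by (rule homeomorphic_topembE)
  obtain g where g: "topemb S2 g" "g ` S2 = T2" using assms(6) by (rule homeomorphic_topembE)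
  define h where "h x = (if x \<in> S1 then f x else g x)" for x
  have "continuous_on (S1 \<union> S2) h"
    unfolding h_def using f g assms compact_imp_closed unfolding topemb_def
    by (intro continuous_on_cases) auto
  moreover have "inj_on h (S1 \<union> S2)"
    using f g assms(3,4) unfolding topemb_def inj_on_def h_def
    by (auto; (metis disjoint_iff image_eqI))
  moreover have "h ` (S1 \<union> S2) = T1 \<union> T2"
    using f(2) g(2) assms(3) unfolding h_def by (auto simp: image_iff; fastforce)
  ultimately show ?thesis
    using homeomorphic_topemb[of "S1 \<union> S2" h] assms(1,2) unfolding topemb_def by auto
qed

lemma embedsI: "clopen_in X D \<Longrightarrow> C homeomorphic D \<Longrightarrow> embeds C X"
  unfolding embeds_def by blast

lemma embeds_homeomorphic: "compact X \<Longrightarrow> C homeomorphic X \<Longrightarrow> embeds C X"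
  by (meson clopen_in_self embedsI)

lemma embeds_clopen_in: "clopen_in X C \<Longrightarrow> embeds C X"
  by (meson embedsI homeomorphic_refl)

lemma embeds_trans:
  assumes "embeds C X" "embeds X Y" shows "embeds C Y"
proof -
  obtain D where D: "clopen_in X D" "C homeomorphic D" using assms unfolding embeds_def by blast
  obtain E where E: "clopen_in Y E" "X homeomorphic E" using assms unfolding embeds_def by blast
  obtain f where f: "topemb X f" "f ` X = E" using E(2) by (rule homeomorphic_topembE)
  have "D homeomorphic (f ` D)"
    using D(1) f(1) by (meson clopen_in_compact clopen_in_subset homeomorphic_topemb topemb_subset)
  moreover have "clopen_in Y (f ` D)"
    using clopen_in_image[OF f(1) D(1)] f(2) E(1) clopen_in_trans by blast
  ultimately show ?thesis using D(2) homeomorphic_trans embedsI by blast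
qed

text \<open>By compactness finitely many of the local neighbourhoods cover \<open>C\<close>. A
  property that passes to clopen subsets and disjoint unions can thus be checked locally.\<close>

lemma clopen_induct:
  assumes "compact C"
    and loc: "\<And>x. x \<in> C \<Longrightarrow> \<exists>U. clopen_in C U \<and> x \<in> U \<and> N U"
    and emp: "N {}"
    and sub: "\<And>U V. N U \<Longrightarrow> clopen_in U V \<Longrightarrow> N V"
    and un: "\<And>U V. N U \<Longrightarrow> N V \<Longrightarrow> compact U \<Longrightarrow> compact V \<Longrightarrow> U \<inter> V = {} \<Longrightarrow> N (U \<union> V)"
  shows "N C"
proof -
  obtain u where u: "\<And>x. x \<in> C \<Longrightarrow> clopen_in C (u x) \<and> x \<in> u x \<and> N (u x)" using loc by metis
  have op: "\<exists>T. open T \<and> u x = C \<inter> T" if "x \<in> C" for x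
  proof -
    have "closed (C - u x)" using u[OF that] by (auto simp: clopen_in_def intro: compact_imp_closed)
    then have "open (- (C - u x))" by (rule open_Compl)
    moreover have "u x = C \<inter> - (C - u x)" using u[OF that] clopen_in_subset by blast
    ultimately show ?thesis by blast
  qed
  then obtain t where t: "\<And>x. x \<in> C \<Longrightarrow> open (t x) \<and> u x = C \<inter> t x" by metis
  have "C \<subseteq> (\<Union>x\<in>C. t x)" using t u by blast
  then obtain F where F: "F \<subseteq> C" "finite F" "C \<subseteq> (\<Union>x\<in>F. t x)"
    using compactE_image[OF assms(1), of C t] t by metis
  have "clopen_in C (\<Union>x\<in>G. u x) \<and> N (\<Union>x\<in>G. u x)" if "finite G" "G \<subseteq> C" for G
    using that
  proof (induction G rule: finite_induct)
    case empty
    then show ?case using emp assms(1) by (simp add: clopen_in_empty)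
  next
    case (insert x G)
    let ?V = "\<Union>x\<in>G. u x"
    have IH: "clopen_in C ?V" "N ?V" and ux: "clopen_in C (u x)" "N (u x)"
      using insert u by auto
    \<comment> \<open>Only the new part of \<open>u x\<close> is added, since \<open>un\<close> is
      available for disjoint unions only.\<close>
    have d: "clopen_in C (u x - ?V)" using clopen_in_Diff ux(1) IH(1) by blast
    then have "clopen_in (u x) (u x - ?V)"
      using clopen_in_mono ux(1) by (metis Diff_subset clopen_in_compact clopen_in_subset)
    then have "N (u x - ?V)" using sub ux(2) by blast
    then have "N ((u x - ?V) \<union> ?V)" using un IH d clopen_in_compact by blast
    moreover have "(u x - ?V) \<union> ?V = (\<Union>x\<in>insert x G. u x)" by auto
    ultimately show ?case using clopen_in_Un[OF ux(1) IH(1)] by simp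
  qed
  moreover have "(\<Union>x\<in>F. u x) = C"
  proof -
    have "(\<Union>x\<in>F. u x) = (\<Union>x\<in>F. C \<inter> t x)" using F(1) t by (intro SUP_cong) auto
    then show ?thesis using F(3) by auto
  qed
  ultimately show ?thesis using F by metis
qed

section \<open>Accumulation of clopen copies at a point, and zero-dimensional points\<close>

definition near :: "real set \<Rightarrow> real \<Rightarrow> real set \<Rightarrow> bool" where
  "near X a C \<longleftrightarrow> (\<forall>e>0. \<exists>D. clopen_in X D \<and> D \<subseteq> ball a e - {a} \<and> C homeomorphic D)"

text \<open>For compact \<open>X\<close> this says that no nondegenerate interval of
  \<open>X\<close> contains \<open>a\<close> (\<open>zd_no_interval\<close>,
  \<open>not_zd_interval\<close>), that is, the component of \<open>a\<close> is a single
  point.\<close>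

definition zd :: "real set \<Rightarrow> real \<Rightarrow> bool" where
  "zd X a \<longleftrightarrow> a \<in> X \<and> (\<forall>e>0. \<exists>U. clopen_in X U \<and> a \<in> U \<and> U \<subseteq> ball a e)"

lemma near_embeds:
  assumes "near X a C" "embeds B C" shows "near X a B"
  unfolding near_def
proof (intro allI impI)
  fix e :: real assume "e > 0"
  then obtain D where D: "clopen_in X D" "D \<subseteq> ball a e - {a}" "C homeomorphic D"
    using assms(1) unfolding near_def by blast
  then have "embeds B D" using assms(2) by (meson clopen_in_compact embeds_homeomorphic embeds_trans)
  then obtain E where "clopen_in D E" "B homeomorphic E" unfolding embeds_def by blast
  then show "\<exists>D. clopen_in X D \<and> D \<subseteq> ball a e - {a} \<and> B homeomorphic D"
    using D clopen_in_trans clopen_in_subset by (meson order_trans)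
qed

lemma near_empty: "compact X \<Longrightarrow> near X a {}"
  unfolding near_def by (auto intro!: exI[of _ "{}"] clopen_in_empty)

text \<open>\<open>a\<close> has positive distance from \<open>K\<close>, so a smaller ball
  suffices. Copies already used form a compact set avoiding \<open>a\<close>, hence one can go on
  choosing disjoint copies.\<close>

lemma near_apart:
  assumes "near X a C" "compact K" "a \<notin> K" "e > 0"
  obtains D where "clopen_in X D" "D \<subseteq> ball a e - {a}" "C homeomorphic D" "D \<inter> K = {}"
proof -
  have "open (- K)" "a \<in> - K" using assms(2,3) compact_imp_closed by auto
  then obtain d where d: "d > 0" "ball a d \<subseteq> - K" by (meson openE)
  then have "min d e > 0" using assms(4) by simp
  then obtain D where D: "clopen_in X D" "D \<subseteq> ball a (min d e) - {a}" "C homeomorphic D"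
    using assms(1) unfolding near_def by blast
  moreover have "ball a (min d e) \<subseteq> ball a d" "ball a (min d e) \<subseteq> ball a e" by auto
  ultimately show ?thesis using that[of D] d by blast
qed

lemma near_Un:
  assumes "near X a C" "near X a D" "compact C" "compact D" "C \<inter> D = {}"
  shows "near X a (C \<union> D)"
  unfolding near_def
proof (intro allI impI)
  fix e :: real assume "e > 0"
  then obtain C' where C': "clopen_in X C'" "C' \<subseteq> ball a e - {a}" "C homeomorphic C'"
    using assms(1) unfolding near_def by blast
  then obtain D' where D': "clopen_in X D'" "D' \<subseteq> ball a e - {a}" "D homeomorphic D'" "D' \<inter> C' = {}"
    using near_apart[OF assms(2) clopen_in_compact[OF C'(1)] _ \<open>e > 0\<close>] by blast
  have "(C \<union> D) homeomorphic (C' \<union> D')" using homeomorphic_Un assms C' D' by (metis Int_commute)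
  then show "\<exists>E. clopen_in X E \<and> E \<subseteq> ball a e - {a} \<and> (C \<union> D) homeomorphic E"
    using clopen_in_Un[OF C'(1) D'(1)] C' D' by blast
qed

text \<open>\<open>clopen_induct\<close> for the property \<open>near X a\<close>.\<close>

lemma near_clopen:
  assumes "compact X" "compact C"
    and "\<And>x. x \<in> C \<Longrightarrow> \<exists>Q. clopen_in C (C \<inter> Q) \<and> x \<in> Q \<and> near X a (C \<inter> Q)"
  shows "near X a C"
proof (rule clopen_induct[of C "near X a"])
  show "\<exists>U. clopen_in C U \<and> x \<in> U \<and> near X a U" if "x \<in> C" for x
    using assms(3)[OF that] that by blast
  show "near X a V" if "near X a U" "clopen_in U V" for U V
    using that near_embeds embeds_clopen_in by blast
qed (use assms near_empty near_Un in auto)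

text \<open>Accumulation at \<open>a\<close> is a local matter: copies inside the ball of radius
  \<open>e\<close> already lie in \<open>Y\<close>.\<close>

lemma near_mono:
  assumes "near X a C" "compact Y" "clopen_in Y (Y \<inter> X)" "e > 0" "X \<inter> ball a e \<subseteq> Y" 
    and "compact X"
  shows "near Y a C"
  unfolding near_def
proof (intro allI impI)
  fix d :: real assume "d > 0"
  then have "min d e > 0" using assms by simp
  then obtain D where D: "clopen_in X D" "D \<subseteq> ball a (min d e) - {a}" "C homeomorphic D"
    using assms(1) unfolding near_def by blast
  then have "D \<subseteq> Y" using assms(5) clopen_in_subset by fastforce
  then have "clopen_in (Y \<inter> X) D"
    using clopen_in_mono[OF D(1), of "Y \<inter> X"] clopen_in_subset[OF D(1)] clopen_in_compact[OF assms(3)] by auto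
  then have "clopen_in Y D" using clopen_in_trans assms(3) by blast
  moreover have "D \<subseteq> ball a d - {a}" using D(2) by auto
  ultimately show "\<exists>D. clopen_in Y D \<and> D \<subseteq> ball a d - {a} \<and> C homeomorphic D"
    using D(3) by blast
qed

lemma zd_subset:
  assumes "zd X a" "compact Y" "Y \<subseteq> X" "a \<in> Y" shows "zd Y a"
  unfolding zd_def
proof (intro conjI allI impI)
  fix e :: real assume "e > 0"
  then obtain U where U: "clopen_in X U" "a \<in> U" "U \<subseteq> ball a e" using assms(1) unfolding zd_def by blast
  then show "\<exists>U. clopen_in Y U \<and> a \<in> U \<and> U \<subseteq> ball a e"
    using clopen_in_restrict[OF U(1) assms(2,3)] assms(4) by blast
qed (use assms in auto)

lemma zd_clopen:
  assumes "clopen_in X U" "zd U a" shows "zd X a"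
  using assms unfolding zd_def by (meson clopen_in_subset clopen_in_trans subsetD)

lemma zd_image:
  assumes "compact X" "topemb X f" "zd X a" shows "zd (f ` X) (f a)"
  unfolding zd_def
proof (intro conjI allI impI)
  show "f a \<in> f ` X" using assms unfolding zd_def by blast
  fix e :: real assume "e > 0"
  moreover have "continuous_on X f" "a \<in> X" using assms unfolding topemb_def zd_def by auto
  ultimately obtain d where d: "d > 0" "\<And>x. x \<in> X \<Longrightarrow> dist x a < d \<Longrightarrow> dist (f x) (f a) < e"
    unfolding continuous_on_iff by blast
  then obtain U where U: "clopen_in X U" "a \<in> U" "U \<subseteq> ball a d" using assms(3) unfolding zd_def by blast
  have "f x \<in> ball (f a) e" if "x \<in> U" for x
  proof -
    have "x \<in> X" "x \<in> ball a d" using that U(3) clopen_in_subset[OF U(1)] by auto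
    then show ?thesis using d(2)[of x] by (simp add: dist_commute)
  qed
  then show "\<exists>V. clopen_in (f ` X) V \<and> f a \<in> V \<and> V \<subseteq> ball (f a) e"
    using clopen_in_image[OF assms(2) U(1)] U(2) by blast
qed

lemma clopen_in_ball:
  assumes "clopen_in X E" "x \<in> E"
  obtains d where "d > 0" "X \<inter> ball x d \<subseteq> E"
proof -
  have "compact (X - E)" using assms(1) unfolding clopen_in_def by blast
  then have "open (- (X - E))" by (intro open_Compl compact_imp_closed)
  moreover have "x \<in> - (X - E)" using assms(2) by blast
  ultimately obtain d where "d > 0" "ball x d \<subseteq> - (X - E)" by (meson openE)
  then show ?thesis using that by blast
qed

lemma clopen_in_continuous_within:
  fixes f :: "real \<Rightarrow> real"
  assumes "clopen_in X E" "x \<in> E" "continuous_on E f" "e > 0"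
  obtains d where "d > 0" "\<And>y. y \<in> X \<Longrightarrow> dist y x < d \<Longrightarrow> dist (f y) (f x) < e"
proof -
  obtain d1 where d1: "d1 > 0" "X \<inter> ball x d1 \<subseteq> E" using clopen_in_ball assms(1,2) by blast
  obtain d2 where d2: "d2 > 0" "\<And>y. y \<in> E \<Longrightarrow> dist y x < d2 \<Longrightarrow> dist (f y) (f x) < e"
    using assms(2-4) unfolding continuous_on_iff by blast
  show ?thesis
  proof (rule that[of "min d1 d2"])
    fix y assume y: "y \<in> X" "dist y x < min d1 d2"
    then have "y \<in> X \<inter> ball x d1" by (auto simp: dist_commute)
    then show "dist (f y) (f x) < e" using d1 d2 y by auto
  qed (use d1 d2 in auto)
qed

section \<open>Clopen neighbourhoods shrinking to a point\<close>

definition level :: "(nat \<Rightarrow> real set) \<Rightarrow> real \<Rightarrow> nat" where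
  "level U x = (LEAST n. x \<notin> U (Suc n))"

lemma level_unique:
  assumes "\<And>n. U (Suc n) \<subseteq> U n" "x \<in> U n - U (Suc n)" shows "level U x = n"
  unfolding level_def
proof (rule Least_equality)
  show "x \<notin> U (Suc n)" using assms by blast
  fix m assume m: "x \<notin> U (Suc m)"
  show "n \<le> m"
  proof (rule ccontr)
    assume "\<not> n \<le> m"
    then have "Suc m \<le> n" by simp
    then have "U n \<subseteq> U (Suc m)" using lift_Suc_antimono_le[of U] assms(1) by blast
    then show False using m assms by blast
  qed
qed

lemma level_mem:
  assumes "x \<in> U 0" "x \<notin> U n" shows "x \<in> U (level U x) - U (Suc (level U x))"
proof -
  have "n \<noteq> 0" using assms by metis
  then obtain k where "n = Suc k" by (meson not0_implies_Suc)
  then have k: "x \<notin> U (Suc k)" using assms by simp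
  then have 1: "x \<notin> U (Suc (level U x))" unfolding level_def by (rule LeastI)
  have "x \<in> U (level U x)"
  proof (cases "level U x")
    case (Suc j)
    then have "j < level U x" by simp
    then have "x \<in> U (Suc j)" unfolding level_def using not_less_Least by blast
    then show ?thesis using Suc by simp
  qed (use assms in simp)
  then show ?thesis using 1 by simp
qed

text \<open>The index shift leaves \<open>U 0 = X\<close> free in size and keeps the radii well
  defined. The annuli \<open>U n - U (Suc n)\<close> partition \<open>X\<close> without
  \<open>p\<close>, and \<open>level\<close> finds the annulus of a point; \<open>p\<close> itself
  belongs to none.\<close>

definition shrinks :: "real set \<Rightarrow> real \<Rightarrow> (nat \<Rightarrow> real set) \<Rightarrow> bool" where
  "shrinks X p U \<longleftrightarrow> U 0 = X \<and> (\<forall>n. clopen_in X (U n) \<and> p \<in> U n \<and> U (Suc n) \<subseteq> U n \<and>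
     U (Suc n) \<subseteq> ball p (1 / Suc n))"

lemma shrinks_level:
  assumes "shrinks X p U" "x \<in> X" "x \<noteq> p" shows "x \<in> U (level U x) - U (Suc (level U x))"
proof -
  have "dist p x > 0" using assms by simp
  then obtain n where "1 / Suc n < dist p x" using nat_approx_posE by blast
  then have "x \<notin> ball p (1 / Suc n)" by simp
  then have "x \<notin> U (Suc n)" using assms(1) unfolding shrinks_def by blast
  then show ?thesis using level_mem[of x U "Suc n"] assms unfolding shrinks_def by simp
qed

lemma shrinks_level_unique:
  assumes "shrinks X p U" "x \<in> U n - U (Suc n)" shows "level U x = n"
  using level_unique[of U x n] assms unfolding shrinks_def by blast

lemma zd_shrinks:
  assumes "compact X" "zd X p" shows "\<exists>U. shrinks X p U"
proof -
  let ?P = "\<lambda>(n::nat) U. clopen_in X U \<and> p \<in> U \<and> (n = 0 \<longrightarrow> U = X)"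
  let ?Q = "\<lambda>(n::nat) U V. V \<subseteq> U \<and> V \<subseteq> ball p (1 / Suc n)"
  have "\<exists>f. \<forall>n. ?P n (f n) \<and> ?Q n (f n) (f (Suc n))"
  proof (rule dependent_nat_choice)
    show "\<exists>U. ?P 0 U" using assms clopen_in_self unfolding zd_def by blast
    fix U n assume U: "?P n U"
    have "(1::real) / Suc n > 0" by simp
    then obtain V where "clopen_in X V" "p \<in> V" "V \<subseteq> ball p (1 / Suc n)"
      using assms(2) unfolding zd_def by blast
    then show "\<exists>V. ?P (Suc n) V \<and> ?Q n U V" using U clopen_in_Int[of X U V]
      by (intro exI[of _ "U \<inter> V"]) auto
  qed
  then show ?thesis unfolding shrinks_def by blast
qed

text \<open>Annuli are clopen, so away from \<open>p\<close> continuity is tested inside a single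
  annulus, and only the limit at \<open>p\<close> has to be supplied.\<close>

lemma continuous_on_shrinks:
  fixes f :: "real \<Rightarrow> real"
  assumes U: "shrinks X p U" and c: "\<And>n. continuous_on (U n - U (Suc n)) f"
    and lim: "\<And>e. e > 0 \<Longrightarrow> \<exists>n. \<forall>x\<in>U n. dist (f x) (f p) < e"
  shows "continuous_on X f"
  unfolding continuous_on_iff
proof (intro ballI allI impI)
  fix x e :: real assume x: "x \<in> X" and e: "e > 0"
  show "\<exists>d>0. \<forall>y\<in>X. dist y x < d \<longrightarrow> dist (f y) (f x) < e"
  proof (cases "x = p")
    case True
    obtain n where n: "\<forall>x\<in>U n. dist (f x) (f p) < e" using lim e by blast
    have "clopen_in X (U n)" "p \<in> U n" using U unfolding shrinks_def by auto
    then obtain d where "d > 0" "X \<inter> ball p d \<subseteq> U n" by (rule clopen_in_ball)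
    then show ?thesis using n True by (intro exI[of _ d]) (auto simp: dist_commute)
  next
    case False
    let ?n = "level U x"
    have "clopen_in X (U ?n - U (Suc ?n))" using U clopen_in_Diff unfolding shrinks_def by blast
    then show ?thesis
      using clopen_in_continuous_within[OF _ shrinks_level[OF U x False] c e] by metis
  qed
qed

text \<open>The annuli around \<open>p\<close> are squeezed into disjoint intervals descending to
  \<open>0\<close>, the image of \<open>p\<close>. So a zero-dimensional point can become the least
  point of a copy.\<close>

lemma zd_realizable:
  assumes "compact X" "zd X p"
  obtains f where "topemb X f" "\<And>x. x \<in> X \<Longrightarrow> f p \<le> f x"
proof -
  obtain U where U: "shrinks X p U" using zd_shrinks assms by blast
  have pX: "p \<in> X" using assms(2) unfolding zd_def by blast
  obtain M where M: "\<And>x. x \<in> X \<Longrightarrow> \<bar>x\<bar> \<le> M" 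
    using compact_imp_bounded[OF assms(1)] unfolding bounded_real by blast
  \<comment> \<open>Rescales \<open>X\<close> into \<open>[0, 1)\<close>; the \<open>+ 1\<close>
    keeps the denominator positive when \<open>M = 0\<close> and the values strictly below
    \<open>1\<close>.\<close>
  define g where "g x = (x + M) / (2 * M + 1)" for x
  have M0: "M \<ge> 0" using M[OF pX] by linarith
  have g: "0 \<le> g x" "g x < 1" if "x \<in> X" for x
    using M[OF that] M0 unfolding g_def by (auto simp: field_simps)
  have g_inj: "x = y" if "g x = g y" for x y using that M0 unfolding g_def by (auto simp: field_simps)
  \<comment> \<open>Level \<open>n\<close> lands in \<open>[1 / 4 ^ n, 2 / 4 ^ n)\<close>, and these
    ranges are disjoint because \<open>2 < 4\<close>. The level of \<open>p\<close> is meaningless,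
    so its value is set separately.\<close>
  define f where "f x = (if x = p then 0 else (1 + g x) / 4 ^ level U x)" for x
  have fp: "f p = 0" by (simp add: f_def)
  have f_eq: "f x = (1 + g x) / 4 ^ n" if "x \<in> U n - U (Suc n)" for x n
    using that shrinks_level_unique[OF U that] U unfolding f_def shrinks_def by auto
  have bd: "1 / 4 ^ level U x \<le> f x" "f x < 2 / 4 ^ level U x" if "x \<in> X" "x \<noteq> p" for x
    using that g[OF that(1)] unfolding f_def by (auto simp: divide_right_mono divide_strict_right_mono)
  have "continuous_on X f"
  proof (rule continuous_on_shrinks[OF U])
    fix n
    have "continuous_on (U n - U (Suc n)) (\<lambda>x. (1 + g x) / 4 ^ n)"
      unfolding g_def using M0 by (intro continuous_intros) auto
    then show "continuous_on (U n - U (Suc n)) f"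
      by (rule continuous_on_eq) (simp add: f_eq)
  next
    fix e :: real assume "e > 0"
    then obtain n where n: "(1/4) ^ n < e / 2" using real_arch_pow_inv[of "e/2" "1/4"] by auto
    have "dist (f x) (f p) < e" if "x \<in> U n" for x
    proof (cases "x = p")
      case False
      have x: "x \<in> X" using that U clopen_in_subset unfolding shrinks_def by blast
      have "n \<le> level U x"
      proof (rule ccontr)
        assume "\<not> n \<le> level U x"
        then have "Suc (level U x) \<le> n" by simp
        then have "U n \<subseteq> U (Suc (level U x))"
          using lift_Suc_antimono_le[of U] U unfolding shrinks_def by blast
        then show False using that shrinks_level[OF U x False] by blast
      qed
      then have "(1/4::real) ^ level U x \<le> (1/4) ^ n" by (intro power_decreasing) auto
      then have "f x < e" using bd(2)[OF x False] n by (simp add: power_one_over)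
      moreover have "f x \<ge> 0" using bd(1)[OF x False] by (meson divide_nonneg_nonneg order_trans zero_le_numeral zero_le_one zero_le_power)
      ultimately show ?thesis using fp by simp
    qed (use \<open>e > 0\<close> in simp)
    then show "\<exists>n. \<forall>x\<in>U n. dist (f x) (f p) < e" by blast
  qed
  moreover have pos: "f x > 0" if "x \<in> X" "x \<noteq> p" for x
    using bd(1)[OF that] by (smt (verit) divide_pos_pos zero_less_power)
  have lt: "f y < f x" if "x \<in> X" "x \<noteq> p" "y \<in> X" "y \<noteq> p" "level U x < level U y" for x y
  proof -
    have "(4::real) * 4 ^ level U x \<le> 4 ^ level U y"
      using that(5) power_increasing[of "Suc (level U x)" "level U y" "4::real"] by simp
    then have "2 / 4 ^ level U y \<le> 2 / ((4::real) * 4 ^ level U x)" by (intro divide_left_mono) auto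
    also have "\<dots> < 1 / 4 ^ level U x" by (simp add: field_simps)
    finally show ?thesis using bd(1)[OF that(1,2)] bd(2)[OF that(3,4)] by linarith
  qed
  have "inj_on f X"
  proof (rule inj_onI)
    fix x y assume xy: "x \<in> X" "y \<in> X" "f x = f y"
    show "x = y"
    proof (cases "x = p \<or> y = p")
      case True
      then show ?thesis using pos xy fp by (metis less_irrefl)
    next
      case False
      then have "level U x = level U y" using lt xy by (metis less_irrefl linorder_neqE_nat)
      then have "g x = g y" using xy(3) False unfolding f_def by simp
      then show ?thesis by (rule g_inj)
    qed
  qed
  ultimately show ?thesis
    using that[of f] pos fp unfolding topemb_def by (metis less_imp_le order_refl)
qed

text \<open>Back and forth: the clopen pieces of \<open>X - {a}\<close> and \<open>Y - {b}\<close> are matched alternately, each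
  new image being chosen inside the neighbourhood that is still free.\<close>

lemma germ_unique:
  assumes X: "compact X" "zd X a" and Y: "compact Y" "zd Y b"
    and XY: "\<And>C. clopen_in X C \<Longrightarrow> a \<notin> C \<Longrightarrow> near Y b C"
    and YX: "\<And>C. clopen_in Y C \<Longrightarrow> b \<notin> C \<Longrightarrow> near X a C"
  obtains f where "topemb X f" "f ` X = Y" "f a = b"
proof -
  \<comment> \<open>A state consists of the neighbourhoods of \<open>a\<close> and \<open>b\<close>
    that are still unmatched; the clause for \<open>n = 0\<close> starts with the whole
    sets.\<close>
  let ?P = "\<lambda>(n::nat) (M, N). clopen_in X M \<and> a \<in> M \<and> clopen_in Y N \<and> b \<in> N \<and> (n = 0 \<longrightarrow> M = X \<and> N = Y)"
  let ?Q = "\<lambda>(n::nat) (M, N) (M', N'). M' \<subseteq> M \<and> N' \<subseteq> N \<and> M' \<subseteq> ball a (1 / Suc n) \<and> N' \<subseteq> ball b (1 / Suc n)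
     \<and> (M - M') homeomorphic (N - N')"
  have "\<exists>F. \<forall>n. ?P n (F n) \<and> ?Q n (F n) (F (Suc n))"
  proof (rule dependent_nat_choice)
    show "\<exists>x. ?P 0 x"
      using X Y clopen_in_self unfolding zd_def by (intro exI[of _ "(X, Y)"]) auto
    fix MN n assume "?P n MN"
    then obtain M N where MN: "MN = (M, N)" and M: "clopen_in X M" "a \<in> M" and N: "clopen_in Y N" "b \<in> N"
      by (cases MN) auto
    have "(1::real) / Suc n > 0" by simp
    then obtain U V where U: "clopen_in X U" "a \<in> U" "U \<subseteq> ball a (1 / Suc n)"
      and V: "clopen_in Y V" "b \<in> V" "V \<subseteq> ball b (1 / Suc n)"
      using X(2) Y(2) unfolding zd_def by meson
    have C1: "clopen_in X (M - U)" "a \<notin> M - U" using clopen_in_Diff M U by auto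
    have "compact (Y - N)" "b \<notin> Y - N" using N unfolding clopen_in_def by auto
    then obtain D1 where D1: "clopen_in Y D1" "D1 \<subseteq> ball b 1 - {b}" "(M - U) homeomorphic D1"
        "D1 \<inter> (Y - N) = {}"
      using near_apart[OF XY[OF C1] _ _ zero_less_one] by metis
    have D1N: "D1 \<subseteq> N" using D1 clopen_in_subset by blast
    \<comment> \<open>The part of \<open>N\<close> that is neither used as an image nor inside
      \<open>V\<close> is sent back into \<open>M \<inter> U\<close>. After both moves the unmatched
      remainders lie in \<open>U\<close> and \<open>V\<close>, hence in small balls.\<close>
    have C2: "clopen_in Y (N - D1 - V)" "b \<notin> N - D1 - V" using clopen_in_Diff N V D1 by auto
    have MU: "clopen_in X (M \<inter> U)" using clopen_in_Int M U by blast
    then have "compact (X - M \<inter> U)" "a \<notin> X - M \<inter> U" using M U unfolding clopen_in_def by auto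
    then obtain D2 where D2: "clopen_in X D2" "D2 \<subseteq> ball a 1 - {a}" "(N - D1 - V) homeomorphic D2"
        "D2 \<inter> (X - M \<inter> U) = {}"
      using near_apart[OF YX[OF C2] _ _ zero_less_one] by metis
    have D2M: "D2 \<subseteq> M \<inter> U" using D2 clopen_in_subset by blast
    have "((M - U) \<union> D2) homeomorphic (D1 \<union> (N - D1 - V))"
    proof (rule homeomorphic_Un)
      show "compact (M - U)" "compact D2" using C1(1) D2(1) clopen_in_compact by auto
      show "D2 homeomorphic (N - D1 - V)" using D2(3) homeomorphic_sym by blast
    qed (use D1(3) D2M in auto)
    moreover have "(M - U) \<union> D2 = M - (M \<inter> U - D2)" "D1 \<union> (N - D1 - V) = N - ((N - D1) \<inter> V)"
      using D1N D2M by auto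
    ultimately have "(M - (M \<inter> U - D2)) homeomorphic (N - ((N - D1) \<inter> V))" by simp
    moreover have "clopen_in X (M \<inter> U - D2)" "clopen_in Y ((N - D1) \<inter> V)"
      using MU D1 D2 N V clopen_in_Diff clopen_in_Int by auto
    ultimately show "\<exists>y. ?P (Suc n) y \<and> ?Q n MN y"
      using MN M(2) U(2,3) N(2) V(2,3) D1(2) D2(2)
      by (intro exI[of _ "(M \<inter> U - D2, (N - D1) \<inter> V)"]) auto
  qed
  then obtain F where F: "\<forall>n. ?P n (F n) \<and> ?Q n (F n) (F (Suc n))" by (rule exE)
  define M where "M n = fst (F n)" for n
  define N where "N n = snd (F n)" for n
  have P: "clopen_in X (M n) \<and> a \<in> M n \<and> clopen_in Y (N n) \<and> b \<in> N n \<and> (n = 0 \<longrightarrow> M n = X \<and> N n = Y)"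
    and Q: "M (Suc n) \<subseteq> M n \<and> N (Suc n) \<subseteq> N n \<and> M (Suc n) \<subseteq> ball a (1 / Suc n) \<and>
      N (Suc n) \<subseteq> ball b (1 / Suc n) \<and> (M n - M (Suc n)) homeomorphic (N n - N (Suc n))" for n
    using spec[OF F, of n] unfolding M_def N_def case_prod_beta by blast+
  have sM: "shrinks X a M" and sN: "shrinks Y b N"
    using P Q unfolding shrinks_def by simp_all
  have "(M n - M (Suc n)) homeomorphic (N n - N (Suc n))" for n
    using Q by blast
  then have "\<exists>h. topemb (M n - M (Suc n)) h \<and> h ` (M n - M (Suc n)) = N n - N (Suc n)" for n
    using homeomorphic_topembE by metis
  then obtain h where h: "\<And>n. topemb (M n - M (Suc n)) (h n)"
    "\<And>n. h n ` (M n - M (Suc n)) = N n - N (Suc n)" by metis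
  define f where "f x = (if x = a then b else h (level M x) x)" for x
  have f_eq: "f x = h n x" if "x \<in> M n - M (Suc n)" for x n
    using that shrinks_level_unique[OF sM that] sM unfolding f_def shrinks_def by auto
  have f_lev: "f x \<in> N n - N (Suc n)" if "x \<in> M n - M (Suc n)" for x n
    using f_eq[OF that] h(2)[of n] that by auto
  have MX: "M n \<subseteq> X" for n using sM clopen_in_subset unfolding shrinks_def by auto
  have f_in: "f x \<in> N n" if "x \<in> M n" for x n
  proof (cases "x = a")
    case True
    then show ?thesis using sN unfolding f_def shrinks_def by simp
  next
    case False
    have lev: "x \<in> M (level M x) - M (Suc (level M x))" using shrinks_level[OF sM] False that MX by blast
    have "n \<le> level M x"
    proof (rule ccontr)
      assume "\<not> n \<le> level M x"
      then have "M n \<subseteq> M (Suc (level M x))"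
        using lift_Suc_antimono_le[of M "Suc (level M x)" n] sM unfolding shrinks_def by auto
      then show False using that lev by blast
    qed
    then have "N (level M x) \<subseteq> N n" using lift_Suc_antimono_le[of N] sN unfolding shrinks_def by blast
    then show ?thesis using f_lev[OF lev] by blast
  qed
  have "continuous_on X f"
  proof (rule continuous_on_shrinks[OF sM])
    show "continuous_on (M n - M (Suc n)) f" for n
      by (rule continuous_on_eq[of _ "h n"]) (use h(1)[of n] f_eq in \<open>auto simp: topemb_def\<close>)
    fix e :: real assume "e > 0"
    then obtain n where "1 / Suc n < e" using nat_approx_posE by blast
    moreover have "N (Suc n) \<subseteq> ball b (1 / Suc n)" using sN unfolding shrinks_def by blast
    ultimately have "N (Suc n) \<subseteq> ball b e" by (meson less_imp_le order_trans subset_ball)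
    then have "dist (f x) b < e" if "x \<in> M (Suc n)" for x
      using f_in[OF that] by (auto simp: dist_commute)
    moreover have "f a = b" unfolding f_def by simp
    ultimately show "\<exists>n. \<forall>x\<in>M n. dist (f x) (f a) < e" by metis
  qed
  moreover have "inj_on f X"
  proof (rule inj_onI)
    fix x y assume xy: "x \<in> X" "y \<in> X" "f x = f y"
    have nb: "f z \<noteq> b" if "z \<in> X" "z \<noteq> a" for z
      using f_lev[OF shrinks_level[OF sM that]] sN unfolding shrinks_def by blast
    show "x = y"
    proof (cases "x = a \<or> y = a")
      case True
      then show ?thesis using nb xy unfolding f_def by metis
    next
      case False
      then have lx: "x \<in> M (level M x) - M (Suc (level M x))" and ly: "y \<in> M (level M y) - M (Suc (level M y))"
        using shrinks_level[OF sM] xy by blast+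
      have "level M x = level M y"
        using shrinks_level_unique[OF sN f_lev[OF lx]] shrinks_level_unique[OF sN f_lev[OF ly]] xy by simp
      then show ?thesis
        using lx ly xy(3) f_eq h(1)[of "level M y"] unfolding topemb_def inj_on_def by metis
    qed
  qed
  moreover have "f ` X = Y"
  proof
    show "f ` X \<subseteq> Y" using f_in[of _ 0] sM sN unfolding shrinks_def by auto
    show "Y \<subseteq> f ` X"
    proof
      fix y assume y: "y \<in> Y"
      show "y \<in> f ` X"
      proof (cases "y = b")
        case True
        then show ?thesis using X(2) unfolding f_def zd_def by auto
      next
        case False
        let ?n = "level N y"
        have "y \<in> h ?n ` (M ?n - M (Suc ?n))" using shrinks_level[OF sN y False] h(2) by blast
        then show ?thesis using f_eq MX by fastforce
      qed
    qed
  qed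
  ultimately show ?thesis using that[of f] unfolding topemb_def f_def by auto
qed

section \<open>Compact sets built around intervals\<close>

text \<open>Zero-dimensionality of the outer halves at the end points makes \<open>{a..b}\<close> a
  maximal interval of \<open>P\<close> and provides gaps of \<open>P\<close> arbitrarily close to it
  on both sides.\<close>

definition sided :: "real set \<Rightarrow> real \<Rightarrow> real \<Rightarrow> bool" where
  "sided P a b \<longleftrightarrow> compact P \<and> a < b \<and> {a..b} \<subseteq> P \<and> zd (P \<inter> {..a}) a \<and> zd (P \<inter> {b..}) b"

definition near2 :: "real set \<Rightarrow> real \<Rightarrow> real \<Rightarrow> real set \<Rightarrow> bool" where
  "near2 P a b C \<longleftrightarrow> near (P \<inter> {..a}) a C \<and> near (P \<inter> {b..}) b C"

text \<open>The pieces off the interval recur arbitrarily close to both of its ends. Owing to this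
  self-similarity the set is determined by the family of pieces that it absorbs
  (\<open>absorbing_homeomorphic\<close>).\<close>

definition absorbing :: "real set \<Rightarrow> real \<Rightarrow> real \<Rightarrow> bool" where
  "absorbing P a b \<longleftrightarrow> sided P a b \<and>
     (\<forall>x\<in>P - {a..b}. \<exists>Q. clopen_in P Q \<and> x \<in> Q \<and> Q \<inter> {a..b} = {} \<and> near2 P a b Q)"

lemma sided_compact: "sided P a b \<Longrightarrow> compact P"
  and sided_compact_left: "sided P a b \<Longrightarrow> compact (P \<inter> {..a})"
  and sided_compact_right: "sided P a b \<Longrightarrow> compact (P \<inter> {b..})"
  unfolding sided_def by (auto intro: compact_Int_closed)

text \<open>The halves of \<open>P\<close> below and above \<open>a\<close> share only the point
  \<open>a\<close>, so a piece avoiding \<open>a\<close> stays away from the other half.\<close>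

lemma clopen_in_left:
  assumes "compact P" "clopen_in (P \<inter> {..a}) C" "a \<notin> C" shows "clopen_in P C"
proof -
  have "C \<subseteq> {..a}" using assms(2) clopen_in_subset by blast
  then have "P - C = (P \<inter> {..a} - C) \<union> P \<inter> {a..}" using assms(3) by force
  then show ?thesis
    using assms unfolding clopen_in_def by (auto intro: compact_Un compact_Int_closed)
qed

lemma clopen_in_right:
  assumes "compact P" "clopen_in (P \<inter> {b..}) C" "b \<notin> C" shows "clopen_in P C"
proof -
  have "C \<subseteq> {b..}" using assms(2) clopen_in_subset by blast
  then have "P - C = (P \<inter> {b..} - C) \<union> P \<inter> {..b}" using assms(3) by force
  then show ?thesis
    using assms unfolding clopen_in_def by (auto intro: compact_Un compact_Int_closed)
qed

lemma near_left_embeds: 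
  assumes "compact P" "near (P \<inter> {..a}) a C" shows "embeds C P"
proof -
  obtain D where D: "clopen_in (P \<inter> {..a}) D" "D \<subseteq> ball a 1 - {a}" "C homeomorphic D"
    using assms(2) zero_less_one unfolding near_def by blast
  then have "clopen_in P D" using clopen_in_left[OF assms(1) D(1)] by blast
  then show ?thesis using D embedsI by blast
qed

lemma near2_embeds: "sided P a b \<Longrightarrow> near2 P a b C \<Longrightarrow> embeds C P"
  unfolding near2_def sided_def using near_left_embeds by blast

lemma near2_mono: "near2 P a b C \<Longrightarrow> embeds B C \<Longrightarrow> near2 P a b B"
  unfolding near2_def using near_embeds by blast

lemma near2_clopen:
  assumes "clopen_in P P'" "{a..b} \<subseteq> P'" "near2 P a b C" "a < b"
  shows "near2 P' a b C"
proof -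
  have P': "compact P'" "P' \<subseteq> P" using assms(1) clopen_in_compact clopen_in_subset by auto
  have "a \<in> P'" "b \<in> P'" using assms(2,4) by auto
  then obtain d e where d: "d > 0" "P \<inter> ball a d \<subseteq> P'" and e: "e > 0" "P \<inter> ball b e \<subseteq> P'"
    using clopen_in_ball[OF assms(1)] by metis
  have *: "near (P' \<inter> S) x C"
    if "near (P \<inter> S) x C" "closed S" "r > 0" "P \<inter> ball x r \<subseteq> P'" for S x r
  proof (rule near_mono[OF that(1)])
    show "compact (P' \<inter> S)" "compact (P \<inter> S)"
      using P' that(2) clopen_in_compact_carrier[OF assms(1)] by (auto intro: compact_Int_closed)
    then show "clopen_in (P' \<inter> S) (P' \<inter> S \<inter> (P \<inter> S))"
      using clopen_in_self[of "P' \<inter> S"] P'(2) by (metis Int_absorb2 Int_mono order_refl)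
    show "P \<inter> S \<inter> ball x r \<subseteq> P' \<inter> S" using that(4) by auto
  qed (use that in auto)
  show ?thesis using assms(3) * d e unfolding near2_def by (meson closed_atMost closed_atLeast)
qed

lemma sided_clopen:
  assumes "clopen_in P P'" "{a..b} \<subseteq> P'" "sided P a b" shows "sided P' a b"
proof -
  have P': "compact P'" "P' \<subseteq> P" using assms(1) clopen_in_compact clopen_in_subset by auto
  have ab: "a \<in> P'" "b \<in> P'" using assms(2,3) unfolding sided_def by auto
  have z: "zd (P \<inter> {..a}) a" "zd (P \<inter> {b..}) b" using assms(3) unfolding sided_def by auto
  have "compact (P' \<inter> {..a})" "compact (P' \<inter> {b..})" using P'(1) by (auto intro: compact_Int_closed)
  then have "zd (P' \<inter> {..a}) a" "zd (P' \<inter> {b..}) b"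
    using zd_subset[OF z(1), of "P' \<inter> {..a}"] zd_subset[OF z(2), of "P' \<inter> {b..}"] P'(2) ab by blast+
  then show ?thesis using assms P' unfolding sided_def by simp
qed

text \<open>\<open>near_clopen\<close> on both sides at once, for pieces taken from a possibly
  different set \<open>P\<close>.\<close>

lemma near2_cover:
  assumes s: "sided Q c d" and C: "clopen_in P C"
    and ex: "\<And>x. x \<in> C \<Longrightarrow> \<exists>V. clopen_in P V \<and> x \<in> V \<and> near2 Q c d V"
  shows "near2 Q c d C"
proof -
  have "\<exists>V. clopen_in C (C \<inter> V) \<and> x \<in> V \<and> near2 Q c d (C \<inter> V)" if "x \<in> C" for x
  proof -
    obtain V where V: "clopen_in P V" "x \<in> V" "near2 Q c d V" using ex \<open>x \<in> C\<close> by blast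
    have "clopen_in C (C \<inter> V)" "clopen_in V (V \<inter> C)"
      using clopen_in_restrict V(1) C clopen_in_compact clopen_in_subset by metis+
    then show ?thesis using V near2_mono embeds_clopen_in by (metis Int_commute)
  qed
  then show ?thesis
    unfolding near2_def
    using near_clopen[OF sided_compact_left[OF s] clopen_in_compact[OF C]]
      near_clopen[OF sided_compact_right[OF s] clopen_in_compact[OF C]] by meson
qed

lemma absorbing_near2:
  assumes "absorbing P a b" "clopen_in P C" "C \<inter> {a..b} = {}" shows "near2 P a b C"
proof (rule near2_cover[OF _ assms(2)])
  show "sided P a b" using assms(1) unfolding absorbing_def by blast
  fix x assume "x \<in> C"
  then have "x \<in> P - {a..b}" using assms(2,3) clopen_in_subset by blast
  then show "\<exists>V. clopen_in P V \<and> x \<in> V \<and> near2 P a b V"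
    using assms(1) unfolding absorbing_def by blast
qed

text \<open>\<open>germ_unique\<close> matches the left halves and the right halves separately, the
  intervals are matched affinely, and the three maps agree at the end points.\<close>

lemma absorbing_homeomorphic:
  assumes P: "absorbing P a b" and Q: "absorbing Q c d"
    and PQ: "\<And>C. clopen_in P C \<Longrightarrow> C \<inter> {a..b} = {} \<Longrightarrow> near2 Q c d C"
    and QP: "\<And>C. clopen_in Q C \<Longrightarrow> C \<inter> {c..d} = {} \<Longrightarrow> near2 P a b C"
  shows "P homeomorphic Q"
proof -
  have sP: "sided P a b" and sQ: "sided Q c d" using P Q unfolding absorbing_def by auto
  have ab: "a < b" "{a..b} \<subseteq> P" and cd: "c < d" "{c..d} \<subseteq> Q" using sP sQ unfolding sided_def by auto
  have left: "clopen_in X C \<and> C \<inter> {x..y} = {}" 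
    if "compact X" "clopen_in (X \<inter> {..x}) C" "x \<notin> C" for X C and x y :: real
    using clopen_in_left[OF that] clopen_in_subset[OF that(2)] that(3) by force
  have right: "clopen_in X C \<and> C \<inter> {x..y} = {}" 
    if "compact X" "clopen_in (X \<inter> {y..}) C" "y \<notin> C" for X C and x y :: real
    using clopen_in_right[OF that] clopen_in_subset[OF that(2)] that(3) by force
  have "near (Q \<inter> {..c}) c C" if "clopen_in (P \<inter> {..a}) C" "a \<notin> C" for C
    using left[OF sided_compact[OF sP] that] PQ unfolding near2_def by blast
  moreover have "near (P \<inter> {..a}) a C" if "clopen_in (Q \<inter> {..c}) C" "c \<notin> C" for C
    using left[OF sided_compact[OF sQ] that] QP unfolding near2_def by blast
  moreover have "zd (P \<inter> {..a}) a" "zd (Q \<inter> {..c}) c" using sP sQ unfolding sided_def by auto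
  ultimately obtain f where f: "topemb (P \<inter> {..a}) f" "f ` (P \<inter> {..a}) = Q \<inter> {..c}" "f a = c"
    using germ_unique[OF sided_compact_left[OF sP] _ sided_compact_left[OF sQ]] by metis
  have "near (Q \<inter> {d..}) d C" if "clopen_in (P \<inter> {b..}) C" "b \<notin> C" for C
    using right[OF sided_compact[OF sP] that] PQ unfolding near2_def by blast
  moreover have "near (P \<inter> {b..}) b C" if "clopen_in (Q \<inter> {d..}) C" "d \<notin> C" for C
    using right[OF sided_compact[OF sQ] that] QP unfolding near2_def by blast
  moreover have "zd (P \<inter> {b..}) b" "zd (Q \<inter> {d..}) d" using sP sQ unfolding sided_def by auto
  ultimately obtain g where g: "topemb (P \<inter> {b..}) g" "g ` (P \<inter> {b..}) = Q \<inter> {d..}" "g b = d"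
    using germ_unique[OF sided_compact_right[OF sP] _ sided_compact_right[OF sQ]] by metis
  define m where "m x = c + (x - a) * ((d - c) / (b - a))" for x
  have m: "m a = c" "m b = d" using ab unfolding m_def by auto
  have mc: "continuous_on S m" for S unfolding m_def by (intro continuous_intros)
  have mm: "m x < m y" if "x < y" for x y using that ab cd unfolding m_def by (simp add: divide_strict_right_mono)
  have mimg: "m ` {a..b} = {c..d}"
  proof
    show "m ` {a..b} \<subseteq> {c..d}"
      using mm m by (auto simp: le_less) 
    show "{c..d} \<subseteq> m ` {a..b}" using IVT'[of m a _ b] m ab mc by (force simp: image_iff)
  qed
  \<comment> \<open>Two closed pieces are pasted at a time, hence the two stages; they agree since
    \<open>f a = c = m a\<close> and \<open>g b = d = m b\<close>.\<close>
  define k where "k x = (if x \<le> b then m x else g x)" for x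
  define h where "h x = (if x \<le> a then f x else k x)" for x
  have "continuous_on ({a..b} \<union> (P \<inter> {b..})) k"
    unfolding k_def using mc g m sided_compact_right[OF sP] unfolding topemb_def
    by (intro continuous_on_cases) (auto intro: compact_imp_closed)
  then have "continuous_on ((P \<inter> {..a}) \<union> ({a..b} \<union> (P \<inter> {b..}))) h"
    unfolding h_def using f m ab sided_compact_left[OF sP] sided_compact_right[OF sP] unfolding topemb_def
    by (intro continuous_on_cases) (auto intro: compact_imp_closed simp: k_def)
  moreover have aP: "a \<in> P" "b \<in> P" using ab by auto
  moreover have P_eq: "(P \<inter> {..a}) \<union> ({a..b} \<union> (P \<inter> {b..})) = P" using ab by auto
  ultimately have "continuous_on P h" by simp
  moreover have fl: "h x < c" "h x = f x" if "x \<in> P" "x < a" for x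
  proof -
    have "f x \<noteq> f a" using inj_onD[of f "P \<inter> {..a}" x a] f(1) that aP unfolding topemb_def by auto
    moreover have "f x \<in> Q \<inter> {..c}" using f(2) that by auto
    ultimately show "h x < c" "h x = f x" using f(3) that unfolding h_def by auto
  qed
  have gl: "h x > d" "h x = g x" if "x \<in> P" "x > b" for x
  proof -
    have "g x \<noteq> g b" using inj_onD[of g "P \<inter> {b..}" x b] g(1) that aP unfolding topemb_def by auto
    moreover have "g x \<in> Q \<inter> {d..}" using g(2) that by auto
    ultimately show "h x > d" "h x = g x" using g(3) that ab unfolding h_def k_def by auto
  qed
  have ml: "h x = m x" "c \<le> h x" "h x \<le> d" if "a \<le> x" "x \<le> b" for x
  proof -
    show 1: "h x = m x" using that f(3) m unfolding h_def k_def by auto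
    have "m x \<in> {c..d}" using mimg that by auto
    then show "c \<le> h x" "h x \<le> d" using 1 by auto
  qed
  have "inj_on h P"
  proof (rule inj_onI)
    fix x y assume xy: "x \<in> P" "y \<in> P" "h x = h y"
    consider "x < a" | "a \<le> x" "x \<le> b" | "x > b" by linarith
    then show "x = y"
    proof cases
      case 1
      then have "y < a" using fl(1)[OF xy(1) 1] xy ml gl(1) cd by (metis less_le_not_le linorder_not_le order_trans)
      then show ?thesis using fl 1 xy f(1) unfolding topemb_def inj_on_def by (metis IntI atMost_iff less_imp_le)
    next
      case 2
      then have "a \<le> y" "y \<le> b" using fl(1)[OF xy(2)] gl(1)[OF xy(2)] ml(2,3)[of x] xy(3) by force+
      then show ?thesis using ml(1) 2 xy(3) mm by (metis less_irrefl linorder_neqE)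
    next
      case 3
      then have "y > b" using gl(1)[OF xy(1) 3] xy ml fl(1) cd by (metis less_le_not_le linorder_not_le order_trans less_imp_le)
      then show ?thesis using gl 3 xy g(1) unfolding topemb_def inj_on_def by (metis IntI atLeast_iff less_imp_le)
    qed
  qed
  moreover have "h ` P = Q"
  proof
    show "h ` P \<subseteq> Q"
    proof
      fix y assume "y \<in> h ` P"
      then obtain x where x: "x \<in> P" "y = h x" by blast
      consider "x < a" | "a \<le> x" "x \<le> b" | "x > b" by linarith
      then show "y \<in> Q"
      proof cases
        case 1
        then show ?thesis using fl[OF x(1) 1] f(2) x by auto
      next
        case 2
        then show ?thesis using ml(2,3)[OF 2] cd x by auto
      next
        case 3
        then show ?thesis using gl[OF x(1) 3] g(2) x by auto
      qed
    qed
    show "Q \<subseteq> h ` P"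
    proof
      fix y assume y: "y \<in> Q"
      consider "y < c" | "y \<in> {c..d}" | "y > d" by fastforce
      then show "y \<in> h ` P"
      proof cases
        case 1
        then have "y \<in> f ` (P \<inter> {..a})" using f(2) y by auto
        then show ?thesis unfolding h_def by force
      next
        case 2
        then obtain x where "x \<in> {a..b}" "y = m x" using mimg by blast
        then show ?thesis using ml(1) ab by (metis atLeastAtMost_iff image_eqI subsetD)
      next
        case 3
        then have "y \<in> g ` (P \<inter> {b..})" using g(2) y by auto
        then obtain x where x: "x \<in> P" "x \<ge> b" "y = g x" by auto
        then have "x > b" using g(3) 3 by (metis less_irrefl order_le_less)
        then show ?thesis using gl x by (metis image_eqI)
      qed
    qed
  qed
  ultimately show ?thesis
    using homeomorphic_topemb[OF sided_compact[OF sP], of h] unfolding topemb_def by metis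
qed

lemma absorbing_clopen:
  assumes "absorbing P a b" "clopen_in P P'" "{a..b} \<subseteq> P'" shows "absorbing P' a b"
  unfolding absorbing_def
proof (intro conjI ballI)
  have s: "sided P a b" using assms(1) unfolding absorbing_def by blast
  then show "sided P' a b" using sided_clopen assms by blast
  fix x assume x: "x \<in> P' - {a..b}"
  then obtain Q where Q: "clopen_in P Q" "x \<in> Q" "Q \<inter> {a..b} = {}" "near2 P a b Q"
    using assms clopen_in_subset[OF assms(2)] unfolding absorbing_def by blast
  have "clopen_in P' (P' \<inter> Q)" "clopen_in P (P' \<inter> Q)"
    using clopen_in_restrict[OF Q(1)] clopen_in_Int assms(2) Q(1) clopen_in_compact clopen_in_subset by auto
  moreover have "near2 P' a b (P' \<inter> Q)"
    using absorbing_near2[OF assms(1) calculation(2)] Q(3) near2_clopen[OF assms(2,3)] s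
    unfolding sided_def by blast
  ultimately show "\<exists>Q. clopen_in P' Q \<and> x \<in> Q \<and> Q \<inter> {a..b} = {} \<and> near2 P' a b Q"
    using x Q by blast
qed

text \<open>Whatever is removed from \<open>P\<close> is absorbed at both ends of the interval, and
  accumulation there is local, so \<open>P\<close> and \<open>P'\<close> absorb the same
  pieces.\<close>

lemma absorbing_clopen_homeomorphic:
  assumes "absorbing P a b" "clopen_in P P'" "{a..b} \<subseteq> P'" shows "P homeomorphic P'"
proof (rule absorbing_homeomorphic[OF assms(1) absorbing_clopen[OF assms]])
  have ab: "a < b" using assms(1) unfolding absorbing_def sided_def by blast
  show "near2 P' a b C" if "clopen_in P C" "C \<inter> {a..b} = {}" for C
    using absorbing_near2[OF assms(1) that] near2_clopen[OF assms(2,3)] ab by blast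
  show "near2 P a b C" if "clopen_in P' C" "C \<inter> {a..b} = {}" for C
    using absorbing_near2[OF assms(1)] that assms(2) clopen_in_trans by blast
qed

text \<open>A clopen copy of \<open>C\<close> in \<open>Q\<close> either misses the interval and is
  absorbed, or by connectedness contains all of it and is then a copy of \<open>Q\<close>. This
  dichotomy drives the comparison of prime sets.\<close>

lemma absorbing_embeds_cases:
  assumes "absorbing Q c d" "embeds C Q" "compact C" shows "embeds Q C \<or> near2 Q c d C"
proof -
  have cd: "{c..d} \<subseteq> Q" using assms(1) unfolding absorbing_def sided_def by blast
  obtain D where D: "clopen_in Q D" "C homeomorphic D" using assms(2) unfolding embeds_def by blast
  show ?thesis
  proof (cases "D \<inter> {c..d} = {}")
    case True
    then have "near2 Q c d D" using absorbing_near2 assms(1) D by blast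
    then show ?thesis using D near2_mono embeds_homeomorphic clopen_in_compact by blast
  next
    case False
    then have "{c..d} \<subseteq> D" using interval_clopen_in[OF D(1) cd] by blast
    then have "Q homeomorphic D" using absorbing_clopen_homeomorphic assms(1) D by blast
    then have "Q homeomorphic C" using D(2) homeomorphic_sym homeomorphic_trans by blast
    then show ?thesis using embeds_homeomorphic assms(3) by blast
  qed
qed

section \<open>Prime sets and their comparison by clopen embedding\<close>

definition dbl :: "real set \<Rightarrow> bool" where
  "dbl P \<longleftrightarrow> (\<exists>D1 D2. clopen_in P D1 \<and> clopen_in P D2 \<and> D1 \<inter> D2 = {} \<and> embeds P D1 \<and> embeds P D2)"

text \<open>A clopen copy of \<open>P\<close> in \<open>Q\<close> carries the two disjoint subsets
  along, and each of them still contains a copy of \<open>Q\<close>.\<close>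

lemma dbl_embeds:
  assumes "dbl P" "embeds P Q" "embeds Q P" shows "dbl Q"
proof -
  obtain D1 D2 where D: "clopen_in P D1" "clopen_in P D2" "D1 \<inter> D2 = {}" "embeds P D1" "embeds P D2"
    using assms(1) unfolding dbl_def by blast
  obtain F where F: "clopen_in Q F" "P homeomorphic F" using assms(2) unfolding embeds_def by blast
  obtain f where f: "topemb P f" "f ` P = F" using F(2) by (rule homeomorphic_topembE)
  have "clopen_in Q (f ` D) \<and> embeds Q (f ` D)" if "clopen_in P D" "embeds P D" for D
  proof
    show "clopen_in Q (f ` D)" using clopen_in_image[OF f(1) that(1)] f(2) F(1) clopen_in_trans by blast
    have "D homeomorphic (f ` D)"
      using that(1) f(1) by (meson clopen_in_compact clopen_in_subset homeomorphic_topemb topemb_subset)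
    then have "embeds D (f ` D)"
      using \<open>clopen_in Q (f ` D)\<close> clopen_in_compact embeds_homeomorphic by blast
    then show "embeds Q (f ` D)" using assms(3) that(2) embeds_trans by blast
  qed
  moreover have "f ` D1 \<inter> f ` D2 = {}"
    using f(1) D(1-3) clopen_in_subset unfolding topemb_def
    by (metis image_empty inj_on_image_Int)
  ultimately show ?thesis using D unfolding dbl_def by meson
qed

text \<open>Points, nondegenerate intervals and Cantor sets are treated uniformly: what matters is a
  single homeomorphism type that is stable under nonempty clopen subsets.\<close>

locale base_class =
  fixes BB :: "real set \<Rightarrow> bool"
  assumes BB_compact: "BB P \<Longrightarrow> compact P"
    and BB_nonempty: "BB P \<Longrightarrow> P \<noteq> {}"
    and BB_clopen: "BB P \<Longrightarrow> clopen_in P C \<Longrightarrow> C \<noteq> {} \<Longrightarrow> BB C"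
    and BB_unique: "BB P \<Longrightarrow> BB Q \<Longrightarrow> P homeomorphic Q"
begin

text \<open>A new prime set is an interval whose two sides absorb simpler prime sets. Induction over
  this definition takes the place of induction on a rank, and the clause
  \<open>near2 P a b B\<close> makes the base piece the least element for
  \<open>embeds\<close>.\<close>

inductive prime_set :: "real set \<Rightarrow> bool" where
  base: "BB P \<Longrightarrow> prime_set P"
| step: "sided P a b \<Longrightarrow> BB B \<Longrightarrow> near2 P a b B \<Longrightarrow>
    (\<And>x. x \<in> P \<Longrightarrow> x \<notin> {a..b} \<Longrightarrow>
       \<exists>Q. clopen_in P Q \<and> x \<in> Q \<and> Q \<inter> {a..b} = {} \<and> prime_set Q \<and> near2 P a b Q) \<Longrightarrow>
    prime_set P"

lemma prime_set_compact: "prime_set P \<Longrightarrow> compact P"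
  by (induction rule: prime_set.induct) (auto simp: BB_compact sided_def)

lemma BB_embeds:
  assumes "BB B" "prime_set Q" shows "embeds B Q"
  using assms(2)
proof cases
  case base
  then show ?thesis using assms BB_unique BB_compact embeds_homeomorphic by blast
next
  case (step a b B')
  then show ?thesis
    using near2_embeds assms BB_unique BB_compact embeds_homeomorphic embeds_trans by blast
qed

text \<open>Double induction. If neither set embeds in the other, each simpler piece of
  \<open>P\<close> is comparable with \<open>Q\<close> and cannot contain a copy of
  \<open>Q\<close>, so it embeds in \<open>Q\<close> and is absorbed there by
  \<open>absorbing_embeds_cases\<close>. The same holds with the roles exchanged, and then
  \<open>absorbing_homeomorphic\<close> gives a contradiction.\<close>

lemma prime_set_total: "prime_set P \<Longrightarrow> prime_set Q \<Longrightarrow> embeds P Q \<or> embeds Q P"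
proof (induction P arbitrary: Q rule: prime_set.induct)
  case (base P)
  then show ?case using BB_embeds by blast
next
  case (step P a b B)
  have aP: "absorbing P a b" unfolding absorbing_def using step.hyps(1) step.IH by blast
  from step.prems show ?case
  proof (induction Q rule: prime_set.induct)
    case (base Q)
    moreover have "prime_set P" using step by (intro prime_set.step[of P a b B]) blast+
    ultimately show ?case using BB_embeds by blast
  next
    case Q: (step Q c d B')
    have aQ: "absorbing Q c d" unfolding absorbing_def using Q.hyps(1) Q.IH by blast
    show ?case
    proof (rule ccontr)
      assume no: "\<not> (embeds P Q \<or> embeds Q P)"
      have Qp: "prime_set Q" using Q by (intro prime_set.step[of Q c d B']) blast+
      have PQ: "near2 Q c d C" if C: "clopen_in P C" "C \<inter> {a..b} = {}" for C
      proof (rule near2_cover[OF Q.hyps(1) C(1)])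
        fix x assume "x \<in> C"
        then have "x \<in> P" "x \<notin> {a..b}" using C clopen_in_subset by blast+
        then obtain V where V: "clopen_in P V" "x \<in> V" "prime_set V" "\<And>Q. prime_set Q \<Longrightarrow> embeds V Q \<or> embeds Q V"
          using step.IH by blast
        have "\<not> embeds Q V" using V(1) no embeds_clopen_in embeds_trans by blast
        then have "near2 Q c d V"
          using absorbing_embeds_cases[OF aQ] V(3,4) Qp prime_set_compact by blast
        then show "\<exists>V. clopen_in P V \<and> x \<in> V \<and> near2 Q c d V" using V by blast
      qed
      have QP: "near2 P a b C" if C: "clopen_in Q C" "C \<inter> {c..d} = {}" for C
      proof (rule near2_cover[OF step.hyps(1) C(1)])
        fix x assume "x \<in> C"
        then have "x \<in> Q" "x \<notin> {c..d}" using C clopen_in_subset by blast+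
        then obtain V where V: "clopen_in Q V" "x \<in> V" "prime_set V" "embeds P V \<or> embeds V P"
          using Q.IH by blast
        have "\<not> embeds P V" using V(1) no embeds_clopen_in embeds_trans by blast
        then have "near2 P a b V"
          using absorbing_embeds_cases[OF aP] V(3,4) prime_set_compact by blast
        then show "\<exists>V. clopen_in Q V \<and> x \<in> V \<and> near2 P a b V" using V by blast
      qed
      have "P homeomorphic Q" using absorbing_homeomorphic[OF aP aQ PQ QP] .
      then show False using no embeds_homeomorphic Qp prime_set_compact by blast
    qed
  qed
qed

text \<open>A clopen neighbourhood of an end point swallows the whole interval and is then
  homeomorphic to the full set; in a base piece any point will do.\<close>

lemma prime_set_center:
  assumes "prime_set C" obtains z where "z \<in> C" "\<And>U. clopen_in C U \<Longrightarrow> z \<in> U \<Longrightarrow> embeds C U"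
  using assms
proof cases
  case base
  then obtain z where "z \<in> C" using BB_nonempty by blast
  moreover have "embeds C U" if "clopen_in C U" "z \<in> U" for U
    using that base BB_clopen BB_unique clopen_in_compact embeds_homeomorphic by blast
  ultimately show ?thesis using that by blast
next
  case (step a b B)
  then have ab: "absorbing C a b" "a < b" "{a..b} \<subseteq> C" unfolding absorbing_def sided_def by blast+
  have "embeds C U" if "clopen_in C U" "a \<in> U" for U
  proof -
    have "a \<in> {a..b} \<inter> U" using that(2) ab(2) by simp
    then have "{a..b} \<subseteq> U" using interval_clopen_in[OF that(1) ab(3)] by blast
    then show ?thesis
      using absorbing_clopen_homeomorphic[OF ab(1) that(1)] embeds_homeomorphic clopen_in_compact that(1) by blast
  qed
  moreover have "a \<in> C" using ab(2,3) by auto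
  ultimately show ?thesis using that[of a] by blast
qed

text \<open>The center of \<open>C\<close> is carried into one of the pieces, and every clopen
  neighbourhood of the center already contains a copy of \<open>C\<close>. So a prime set covered by
  many pieces embeds in a single one.\<close>

lemma prime_set_embeds_piece:
  assumes "prime_set C" "C homeomorphic D" "clopen_in P D"
    and "\<And>y. y \<in> D \<Longrightarrow> \<exists>Q. clopen_in P Q \<and> y \<in> Q \<and> S Q"
  obtains Q where "clopen_in P Q" "S Q" "embeds C Q"
proof -
  obtain f where f: "topemb C f" "f ` C = D" using assms(2) by (rule homeomorphic_topembE)
  obtain z where z: "z \<in> C" "\<And>U. clopen_in C U \<Longrightarrow> z \<in> U \<Longrightarrow> embeds C U" 
    using prime_set_center assms(1) by blast
  obtain Q where Q: "clopen_in P Q" "f z \<in> Q" "S Q" using assms(4)[of "f z"] z f by blast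
  have "clopen_in D (D \<inter> Q)" "clopen_in Q (Q \<inter> D)"
    using clopen_in_restrict Q(1) assms(3) clopen_in_compact clopen_in_subset by metis+
  then obtain U where U: "clopen_in C U" "f ` U = D \<inter> Q"
    using clopen_in_vimage[OF prime_set_compact[OF assms(1)] f(1), of "D \<inter> Q"] f(2) by metis
  have "z \<in> U"
  proof -
    have "f z \<in> f ` U" using U(2) Q(2) z(1) f(2) by blast
    then show ?thesis
      using f(1) z(1) clopen_in_subset[OF U(1)] unfolding topemb_def by (metis inj_on_image_mem_iff)
  qed
  then have "embeds C U" using z(2) U(1) by blast
  moreover have "embeds U (D \<inter> Q)"
    using U f(1) homeomorphic_topemb[of U f] clopen_in_compact[OF U(1)] topemb_subset[OF f(1) clopen_in_subset[OF U(1)]]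
      embeds_homeomorphic clopen_in_compact[OF \<open>clopen_in D (D \<inter> Q)\<close>] by metis
  moreover have "embeds (D \<inter> Q) Q" using \<open>clopen_in Q (Q \<inter> D)\<close> embeds_clopen_in by (metis Int_commute)
  ultimately have "embeds C Q" using embeds_trans by blast
  then show ?thesis using that Q by blast
qed

definition strictly :: "real set \<Rightarrow> real set \<Rightarrow> bool" where
  "strictly C P \<longleftrightarrow> prime_set C \<and> embeds C P \<and> \<not> embeds P C"

text \<open>Mutually embeddable sets have the same predecessors under \<open>strictly\<close>, so
  accessibility descends along \<open>embeds\<close> and not only along its strict part.\<close>

lemma accp_strictly_embeds:
  assumes "Wellfounded.accp strictly Q" "prime_set C" "embeds C Q"
  shows "Wellfounded.accp strictly C"
proof (cases "embeds Q C")
  case True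
  show ?thesis
  proof (rule accpI)
    fix D assume "strictly D C"
    then have "strictly D Q" using assms(3) True embeds_trans unfolding strictly_def by blast
    then show "Wellfounded.accp strictly D" using assms(1) accp_downward by metis
  qed
next
  case False
  then have "strictly C Q" using assms unfolding strictly_def by blast
  then show ?thesis using assms(1) accp_downward by metis
qed

text \<open>A copy of a strictly smaller \<open>C\<close> misses the interval of \<open>P\<close>,
  so it is covered by simpler pieces. By its center \<open>C\<close> embeds in one of these, which
  is accessible by induction.\<close>

lemma prime_set_accp: "prime_set P \<Longrightarrow> Wellfounded.accp strictly P"
proof (induction rule: prime_set.induct)
  case (base P)
  show ?case by (rule accpI) (use base BB_embeds in \<open>auto simp: strictly_def\<close>)
next
  case (step P a b B)
  have aP: "absorbing P a b" unfolding absorbing_def using step.hyps(1) step.IH by blast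
  then have ab: "{a..b} \<subseteq> P" unfolding absorbing_def sided_def by blast
  show ?case
  proof (rule accpI)
    fix C assume C: "strictly C P"
    then obtain D where D: "clopen_in P D" "C homeomorphic D" unfolding strictly_def embeds_def by blast
    have "D \<inter> {a..b} = {}"
    proof (rule ccontr)
      assume "D \<inter> {a..b} \<noteq> {}"
      then have "{a..b} \<subseteq> D" using interval_clopen_in[OF D(1) ab] by blast
      then have "P homeomorphic C"
        using absorbing_clopen_homeomorphic[OF aP D(1)] D(2) homeomorphic_sym homeomorphic_trans by blast
      then show False using C embeds_homeomorphic prime_set_compact unfolding strictly_def by blast
    qed
    then have *: "\<exists>Q. clopen_in P Q \<and> y \<in> Q \<and> Wellfounded.accp strictly Q" if "y \<in> D" for y
      using step.IH[of y] that clopen_in_subset[OF D(1)] by blast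
    have "prime_set C" using C unfolding strictly_def by blast
    from prime_set_embeds_piece[OF this D(2,1) *]
    obtain Q where "Wellfounded.accp strictly Q" "embeds C Q" .
    then show "Wellfounded.accp strictly C" using accp_strictly_embeds C unfolding strictly_def by blast
  qed
qed

text \<open>\<open>P\<close> embeds in a clopen part off the interval and thus in a simpler piece
  \<open>Q\<close>. Then \<open>P\<close> and \<open>Q\<close> embed in each other, \<open>Q\<close>
  inherits \<open>dbl\<close>, and the induction descends to a base piece.\<close>

lemma prime_set_dbl: "prime_set P \<Longrightarrow> dbl P \<Longrightarrow> BB B \<Longrightarrow> embeds P B"
proof (induction rule: prime_set.induct)
  case (base P)
  then show ?case using BB_unique BB_compact embeds_homeomorphic by blast
next
  case (step P a b B')
  have P: "prime_set P" using step by (intro prime_set.step[of P a b B']) blast+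
  have ab: "{a..b} \<subseteq> P" using step.hyps(1) unfolding sided_def by blast
  \<comment> \<open>A clopen set meeting the interval contains it, so of two disjoint ones at least
    one misses it.\<close>
  obtain D where D: "clopen_in P D" "embeds P D" "D \<inter> {a..b} = {}"
    using step.prems(1) interval_clopen_in[OF _ ab] unfolding dbl_def by (metis Int_commute disjoint_iff subsetD)
  obtain E where E: "clopen_in D E" "P homeomorphic E" using D(2) unfolding embeds_def by blast
  have "clopen_in P E" using E(1) D(1) clopen_in_trans by blast
  moreover have "E \<inter> {a..b} = {}" using E(1) D(3) clopen_in_subset by blast
  ultimately have *: "\<exists>Q. clopen_in P Q \<and> y \<in> Q \<and> (dbl Q \<longrightarrow> embeds Q B)" if "y \<in> E" for y
    using step.IH[of y] that clopen_in_subset[of P E] step.prems(2) by blast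
  from prime_set_embeds_piece[OF P E(2) \<open>clopen_in P E\<close> *]
  obtain Q where Q: "clopen_in P Q" "dbl Q \<longrightarrow> embeds Q B" "embeds P Q" .
  then have "dbl Q" using dbl_embeds step.prems(1) embeds_clopen_in by blast
  then show ?case using Q embeds_trans by blast
qed

text \<open>A clopen set containing the interval satisfies the clause \<open>step\<close> again;
  away from the interval the simpler pieces are refined by induction.\<close>

lemma prime_set_small:
  "prime_set P \<Longrightarrow> clopen_in P V \<Longrightarrow> x \<in> V \<Longrightarrow> \<exists>Q. clopen_in P Q \<and> x \<in> Q \<and> Q \<subseteq> V \<and> prime_set Q"
proof (induction arbitrary: V x rule: prime_set.induct)
  case (base P)
  then have "BB V" using BB_clopen by blast
  then show ?case using base prime_set.base by blast
next
  case (step P a b B)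
  have ab: "{a..b} \<subseteq> P" "a < b" using step.hyps(1) unfolding sided_def by auto
  have IH: "\<exists>Q. clopen_in P Q \<and> y \<in> Q \<and> Q \<subseteq> V \<and> Q \<inter> {a..b} = {} \<and> prime_set Q \<and> near2 P a b Q"
    if y: "y \<in> V" "y \<notin> {a..b}" for y
  proof -
    have "y \<in> P" using y step.prems(1) clopen_in_subset by blast
    from step.IH[OF this y(2)]
    obtain Q where Q: "clopen_in P Q" "y \<in> Q" "Q \<inter> {a..b} = {}" "near2 P a b Q"
      and small: "\<forall>V. clopen_in Q V \<longrightarrow> (\<forall>x. x \<in> V \<longrightarrow> (\<exists>Q'. clopen_in Q Q' \<and> x \<in> Q' \<and> Q' \<subseteq> V \<and> prime_set Q'))"
      by (elim exE conjE) (rule that; assumption)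
    have "clopen_in Q (Q \<inter> V)"
      by (rule clopen_in_restrict[OF step.prems(1) clopen_in_compact[OF Q(1)] clopen_in_subset[OF Q(1)]])
    then obtain Q' where Q': "clopen_in Q Q'" "y \<in> Q'" "Q' \<subseteq> Q \<inter> V" "prime_set Q'"
      using small[rule_format, of "Q \<inter> V" y] Q(2) y(1) by blast
    then have "near2 P a b Q'" "clopen_in P Q'"
      using Q near2_mono embeds_clopen_in clopen_in_trans by blast+
    then show ?thesis using Q Q' by blast
  qed
  show ?case
  proof (cases "x \<in> {a..b}")
    case True
    then have abV: "{a..b} \<subseteq> V" using interval_clopen_in[OF step.prems(1) ab(1)] step.prems(2) by blast
    have "prime_set V"
    proof (rule prime_set.step)
      show "sided V a b" using sided_clopen step.prems(1) abV step.hyps(1) by blast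
      show "BB B" "near2 V a b B" using step.hyps near2_clopen[OF step.prems(1) abV] ab by auto
      fix y assume "y \<in> V" "y \<notin> {a..b}"
      then obtain Q where Q: "clopen_in P Q" "y \<in> Q" "Q \<subseteq> V" "Q \<inter> {a..b} = {}" "prime_set Q" "near2 P a b Q"
        using IH by blast
      moreover have "clopen_in V Q" "near2 V a b Q"
        using clopen_in_mono[OF Q(1) clopen_in_compact[OF step.prems(1)] clopen_in_subset[OF step.prems(1)] Q(3)]
          near2_clopen[OF step.prems(1) abV Q(6) ab(2)] by blast+
      ultimately show "\<exists>Q. clopen_in V Q \<and> y \<in> Q \<and> Q \<inter> {a..b} = {} \<and> prime_set Q \<and> near2 V a b Q"
        by blast
    qed
    then show ?thesis using step.prems by blast
  next
    case False
    then show ?thesis using IH step.prems(2) by blast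
  qed
qed

end

section \<open>Copies of t-sets\<close>

lemma inj_continuous_strict_mono:
  fixes f :: "real \<Rightarrow> real"
  assumes c: "continuous_on UNIV f" and i: "inj f" and "f 0 < f 1"
  shows "strict_mono f"
proof (rule strict_monoI)
  fix x y :: real assume xy: "x < y"
  have tri: "(f u < f v \<and> f v < f w) \<or> (f w < f v \<and> f v < f u)" if "u < v" "v < w" for u v w
    using continuous_inj_imp_mono[OF that, of f] continuous_on_subset[OF c] inj_on_subset[OF i] by auto
  \<comment> \<open>\<open>a\<close> and \<open>b\<close> enclose both \<open>0, 1\<close> and
    \<open>x, y\<close>, so the direction can be carried from the first pair to the second.\<close>
  define a where "a = min x 0 - 1"
  define b where "b = max y 1 + 1"
  have ab: "a < x" "a < 0" "b > y" "b > 1" unfolding a_def b_def by auto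
  have 1: "f 1 < f b" using tri[of 0 1 b] assms(3) ab by linarith
  have "f a < f 0" using tri[of a 0 1] ab assms(3) by linarith
  then have "f a < f b" using 1 assms(3) by linarith
  then have "f x < f b" using tri[of a x b] ab xy by linarith
  then show "f x < f y" using tri[of x y b] ab xy by linarith
qed

text \<open>A homeomorphism of the line is monotone; a decreasing one becomes increasing after a
  reflection, at the price of replacing \<open>Z\<close> by its mirror image. Apart from
  \<open>t_set_homeomorphic\<close>, all uses of the t-set property pass through this
  statement.\<close>

lemma t_set_copies:
  fixes Y Z :: "real set"
  assumes "t_set A" "A homeomorphic Y" "A homeomorphic Z"
  obtains f where "strict_mono f" "continuous_on UNIV f" "f ` Y = Z \<or> f ` Y = uminus ` Z"
proof -
  obtain f1 g1 where 1: "homeomorphism UNIV UNIV f1 g1" "f1 ` A = Y"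
    using assms(1,2) unfolding t_set_def by blast
  obtain f2 g2 where 2: "homeomorphism UNIV UNIV f2 g2" "f2 ` A = Z"
    using assms(1,3) unfolding t_set_def by blast
  define f where "f x = f2 (g1 x)" for x
  have "continuous_on UNIV f"
    unfolding f_def using 1(1) 2(1) unfolding homeomorphism_def by (metis continuous_on_compose2 subset_UNIV)
  moreover have i: "inj f" unfolding f_def using 1(1) 2(1) unfolding homeomorphism_def inj_def by (metis UNIV_I)
  moreover have "g1 ` Y = A" using 1 unfolding homeomorphism_def by (force simp: image_iff)
  then have fY: "f ` Y = Z" unfolding f_def using 2(2) by (metis image_image)
  moreover have "f 0 \<noteq> f 1" using i unfolding inj_def by (metis zero_neq_one)
  moreover have "continuous_on UNIV (\<lambda>x. - f x)" "inj (\<lambda>x. - f x)"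
    using calculation by (auto intro: continuous_intros simp: inj_def)
  moreover have "(\<lambda>x. - f x) ` Y = uminus ` Z" using fY by auto
  ultimately show ?thesis
    using that[of f] that[of "\<lambda>x. - f x"] inj_continuous_strict_mono[of f]
      inj_continuous_strict_mono[of "\<lambda>x. - f x"]
    by (metis linorder_neqE neg_less_iff_less)
qed

lemma t_set_homeomorphic:
  fixes B :: "real set"
  assumes "t_set A" "A homeomorphic B" shows "t_set B"
  unfolding t_set_def
proof (intro allI impI)
  fix Y :: "real set" assume "B homeomorphic Y"
  then have "A homeomorphic Y" using assms(2) homeomorphic_trans by blast
  then obtain f g where 2: "homeomorphism UNIV UNIV f g" "f ` A = Y" using assms(1) unfolding t_set_def by blast
  obtain f' g' where 1: "homeomorphism UNIV UNIV f' g'" "f' ` A = B" using assms unfolding t_set_def by blast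
  have "homeomorphism UNIV UNIV (f \<circ> g') (f' \<circ> g)"
    using homeomorphism_compose[of UNIV UNIV g' f' UNIV f g] 1(1) 2(1) homeomorphism_sym by metis
  moreover have "g' ` B = A" using 1 unfolding homeomorphism_def by (force simp: image_iff)
  then have "(f \<circ> g') ` B = Y" using 2(2) by (metis image_comp)
  ultimately show "\<exists>f g. homeomorphism UNIV UNIV f g \<and> f ` B = Y" by blast
qed

text \<open>The arctangent gives a copy inside \<open>{-pi..pi}\<close>. A map continuous on the
  whole line sends this interval to a compact set, which contains \<open>Z\<close> up to
  sign.\<close>

lemma t_set_copy_bounded:
  fixes Z :: "real set"
  assumes "t_set A" "A homeomorphic Z" shows "bounded Z"
proof -
  have "homeomorphism A (arctan ` A) arctan tan"
    unfolding homeomorphism_def 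
    by (auto simp: tan_arctan image_image intro!: continuous_intros)
  then have "A homeomorphic (arctan ` A)" unfolding homeomorphic_def by blast
  then obtain f where f: "continuous_on UNIV f" "f ` arctan ` A = Z \<or> f ` arctan ` A = uminus ` Z"
    using t_set_copies[OF assms(1) _ assms(2)] by metis
  have "- pi \<le> arctan x \<and> arctan x \<le> pi" for x
    using arctan_lbound[of x] arctan_ubound[of x] pi_gt_zero by linarith
  then have "arctan ` A \<subseteq> {-pi..pi}" by auto
  moreover have "compact (f ` {-pi..pi})"
    using f(1) by (intro compact_continuous_image) (auto intro: continuous_on_subset)
  ultimately have "bounded (f ` arctan ` A)" by (meson bounded_subset compact_imp_bounded image_mono)
  then show ?thesis using f(2) by (auto simp: bounded_uminus)
qed

lemma t_set_compact:
  assumes "t_set A" shows "compact A"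
proof -
  have "p \<in> A" if p: "p \<in> closure A" for p
  proof (rule ccontr)
    assume "p \<notin> A"
    define f where "f x = 1 / (p - x)" for x
    have "homeomorphism A (f ` A) f (\<lambda>y. p - 1 / y)"
      unfolding homeomorphism_def f_def using \<open>p \<notin> A\<close>
      by (auto simp: image_image intro!: continuous_intros image_eqI)
    then have "bounded (f ` A)" using t_set_copy_bounded assms unfolding homeomorphic_def by blast
    then obtain B where B: "\<And>x. x \<in> A \<Longrightarrow> \<bar>f x\<bar> \<le> B" unfolding bounded_real by blast
    have "A \<noteq> {}" using p by auto
    then have "B \<ge> 0" using B by (meson abs_ge_zero all_not_in_conv order_trans)
    then obtain x where x: "x \<in> A" "dist x p < 1 / (B + 1)"
      using p unfolding closure_approachable by (metis add_nonneg_pos divide_pos_pos zero_less_one)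
    have "\<bar>p - x\<bar> > 0" using x \<open>p \<notin> A\<close> by auto
    moreover have "\<bar>p - x\<bar> < 1 / (B + 1)" using x(2) by (simp add: dist_real_def abs_minus_commute)
    ultimately have "B + 1 < \<bar>f x\<bar>" using \<open>B \<ge> 0\<close> unfolding f_def by (simp add: field_simps)
    then show False using B[OF x(1)] by simp
  qed
  then have "closed A" using closure_subset_eq by blast
  moreover have "bounded A" using t_set_copy_bounded assms homeomorphic_refl by blast
  ultimately show ?thesis by (simp add: compact_eq_bounded_closed)
qed

lemma topemb_uminus: "topemb X f \<Longrightarrow> topemb X (\<lambda>x. - f x)"
  unfolding topemb_def by (auto intro: continuous_intros simp: inj_on_def)

lemma topemb_id: "topemb X (\<lambda>x. x)"
  unfolding topemb_def by (auto simp: inj_on_def)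

text \<open>The image of \<open>V\<close> is translated above the image of \<open>U\<close>, which
  stays in place. Rearrangements of clopen pieces are assembled from such joins.\<close>

lemma topemb_join:
  assumes "compact U" "compact V" "U \<inter> V = {}" "topemb U f" "topemb V g"
  obtains h t where "topemb (U \<union> V) h" "\<And>x. x \<in> U \<Longrightarrow> h x = f x" "\<And>x. x \<in> V \<Longrightarrow> h x = g x + t"
    "\<And>x y. x \<in> U \<Longrightarrow> y \<in> V \<Longrightarrow> h x < h y"
proof -
  have "bounded (f ` U)" "bounded (g ` V)" using assms compact_topemb_image compact_imp_bounded by auto
  then obtain M N where MN: "\<forall>y\<in>f ` U. \<bar>y\<bar> \<le> M" "\<forall>y\<in>g ` V. \<bar>y\<bar> \<le> N"
    unfolding bounded_real by metis
  then have M: "\<bar>f x\<bar> \<le> M" if "x \<in> U" for x using that by blast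
  have N: "\<bar>g x\<bar> \<le> N" if "x \<in> V" for x using MN(2) that by blast
  \<comment> \<open>Just enough to move \<open>[-N, N]\<close> strictly above
    \<open>[-M, M]\<close>.\<close>
  define t where "t = M + N + 1"
  define h where "h x = (if x \<in> U then f x else g x + t)" for x
  have hU: "h x = f x" if "x \<in> U" for x using that unfolding h_def by simp
  have hV: "h x = g x + t" if "x \<in> V" for x using that assms(3) unfolding h_def by auto
  have lt: "h x < h y" if "x \<in> U" "y \<in> V" for x y
    using hU hV that M[of x] N[of y] unfolding t_def by auto
  have "continuous_on (U \<union> V) h"
    unfolding h_def using assms unfolding topemb_def
    by (intro continuous_on_cases) (auto intro!: compact_imp_closed continuous_intros)
  moreover have "inj_on h (U \<union> V)"
  proof (rule inj_onI)
    fix x y assume "x \<in> U \<union> V" "y \<in> U \<union> V" "h x = h y"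
    then consider "x \<in> U" "y \<in> U" | "x \<in> V" "y \<in> V" using lt by (metis UnE less_irrefl)
    then show "x = y"
      using assms(4,5) \<open>h x = h y\<close> hU hV unfolding topemb_def inj_on_def by cases auto
  qed
  ultimately show ?thesis using that[of h t] hU hV lt unfolding topemb_def by blast
qed

text \<open>Two ways to become an end of a copy: annuli around \<open>p\<close> are squeezed to one
  side of it (\<open>zd_realizable\<close>), or \<open>p\<close> already ends a clopen piece, which
  can be moved outward.\<close>

definition extreme :: "real set \<Rightarrow> real \<Rightarrow> bool" where
  "extreme A p \<longleftrightarrow> zd A p \<or> (\<exists>C. clopen_in A C \<and> p \<in> C \<and> ((\<forall>x\<in>C. p \<le> x) \<or> (\<forall>x\<in>C. x \<le> p)))"

lemma extreme_realizable:
  assumes "extreme A p" "clopen_in A U" "p \<in> U"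
  obtains f where "topemb U f" "\<And>x. x \<in> U \<Longrightarrow> f p \<le> f x"
proof -
  have U: "compact U" "U \<subseteq> A" using assms(2) clopen_in_compact clopen_in_subset by auto
  show ?thesis
  proof (cases "zd A p")
    case True
    then show ?thesis using zd_realizable[OF U(1) zd_subset[OF True U assms(3)]] that by blast
  next
    case False
    then obtain C where C: "clopen_in A C" "p \<in> C" "(\<forall>x\<in>C. p \<le> x) \<or> (\<forall>x\<in>C. x \<le> p)"
      using assms(1) unfolding extreme_def by blast
    obtain k where k: "topemb (U \<inter> C) k" "\<And>x. x \<in> U \<inter> C \<Longrightarrow> k p \<le> k x"
      using C(3)
    proof
      assume "\<forall>x\<in>C. p \<le> x"
      then show ?thesis using that[of "\<lambda>x. x"] topemb_id by auto
    next
      assume "\<forall>x\<in>C. x \<le> p"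
      then show ?thesis using that[of "\<lambda>x. - x"] topemb_uminus[OF topemb_id] by auto
    qed
    have UC: "compact (U \<inter> C)" "compact (U - C)"
      using clopen_in_Int[OF assms(2) C(1)] clopen_in_Diff[OF assms(2) C(1)] clopen_in_compact by auto
    have "(U \<inter> C) \<inter> (U - C) = {}" by auto
    from topemb_join[OF UC this k(1) topemb_id]
    obtain h t where h: "topemb ((U \<inter> C) \<union> (U - C)) h" "\<And>x. x \<in> U \<inter> C \<Longrightarrow> h x = k x"
      "\<And>x y. x \<in> U \<inter> C \<Longrightarrow> y \<in> U - C \<Longrightarrow> h x < h y" by metis
    have "(U \<inter> C) \<union> (U - C) = U" by auto
    then have "topemb U h" using h(1) by simp
    moreover have "h p \<le> h x" if "x \<in> U" for x
    proof (cases "x \<in> C")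
      case True
      then show ?thesis using h(2)[of p] h(2)[of x] k(2)[of x] that C(2) assms(3) by simp
    next
      case False
      then show ?thesis using h(3)[of p x] that C(2) assms(3) by simp
    qed
    ultimately show ?thesis using that by blast
  qed
qed

text \<open>\<open>U\<close> is arranged with \<open>p\<close> lowest; the rest is arranged with
  \<open>q\<close> lowest, then reflected and placed above.\<close>

lemma extreme_pair:
  assumes "extreme A p" "extreme A q" "clopen_in A U" "p \<in> U" "q \<notin> U" "q \<in> A"
  obtains f where "topemb A f" "\<And>x. x \<in> A \<Longrightarrow> f p \<le> f x" "\<And>x. x \<in> A \<Longrightarrow> f x \<le> f q"
proof -
  have V: "clopen_in A (A - U)" "q \<in> A - U" using clopen_in_compl assms by auto
  obtain f where f: "topemb U f" "\<And>x. x \<in> U \<Longrightarrow> f p \<le> f x" using extreme_realizable assms(1,3,4) by metis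
  obtain g where g: "topemb (A - U) g" "\<And>x. x \<in> A - U \<Longrightarrow> g q \<le> g x" using extreme_realizable assms(2) V by metis
  have "U \<inter> (A - U) = {}" by auto
  from topemb_join[OF clopen_in_compact[OF assms(3)] clopen_in_compact[OF V(1)] this f(1) topemb_uminus[OF g(1)]]
  obtain h t where h: "topemb (U \<union> (A - U)) h" "\<And>x. x \<in> U \<Longrightarrow> h x = f x"
    "\<And>x. x \<in> A - U \<Longrightarrow> h x = - g x + t" "\<And>x y. x \<in> U \<Longrightarrow> y \<in> A - U \<Longrightarrow> h x < h y" by metis
  have "U \<union> (A - U) = A" using clopen_in_subset[OF assms(3)] by auto
  then have "topemb A h" using h(1) by simp
  moreover have "h p \<le> h x \<and> h x \<le> h q" if "x \<in> A" for x
    using that h(2)[of x] h(2)[of p] h(3)[of x] h(3)[of q] h(4)[of p x] h(4)[of x q] f(2)[of x] g(2)[of x]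
      assms(4) V(2) by (cases "x \<in> U") auto
  ultimately show ?thesis using that by blast
qed

text \<open>An increasing map between the two copies sends top to top, so \<open>q\<close> to
  \<open>r\<close>. A decreasing one sends \<open>q\<close> to \<open>p\<close> and \<open>p\<close>
  to \<open>r\<close>, so its square works. This is why both copies have the same lowest point
  \<open>p\<close>.\<close>

lemma t_set_orbit_pair:
  assumes A: "t_set A"
    and f: "topemb A f" "\<And>x. x \<in> A \<Longrightarrow> f p \<le> f x" "\<And>x. x \<in> A \<Longrightarrow> f x \<le> f q"
    and g: "topemb A g" "\<And>x. x \<in> A \<Longrightarrow> g p \<le> g x" "\<And>x. x \<in> A \<Longrightarrow> g x \<le> g r"
    and pqr: "p \<in> A" "q \<in> A" "r \<in> A"
  obtains h where "topemb A h" "h ` A = A" "h q = r"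
proof -
  have cA: "compact A" using A t_set_compact by blast
  have "A homeomorphic (f ` A)" "A homeomorphic (g ` A)" using cA f(1) g(1) homeomorphic_topemb by auto
  then obtain F where F: "strict_mono F" "continuous_on UNIV F" "F ` f ` A = g ` A \<or> F ` f ` A = uminus ` g ` A"
    using t_set_copies[OF A] by metis
  obtain k where k: "topemb (g ` A) k" "\<And>x. x \<in> A \<Longrightarrow> k (g x) = x" "k ` g ` A = A"
    using topemb_inverse[OF cA g(1)] by blast
  have Fm: "F x \<le> F y \<longleftrightarrow> x \<le> y" for x y using F(1) by (simp add: strict_mono_less_eq)
  have tF: "topemb X F" for X
    using F continuous_on_subset unfolding topemb_def by (metis strict_mono_imp_inj_on inj_on_subset subset_UNIV)
  show ?thesis
    using F(3)
  proof
    assume E: "F ` f ` A = g ` A"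
    define h where "h x = k (F (f x))" for x
    have "topemb A (\<lambda>x. F (f x))" using topemb_compose[OF f(1) tF] .
    then have "topemb A h" unfolding h_def using topemb_compose[of A "\<lambda>x. F (f x)" k] k(1) E by (simp add: image_image)
    moreover have "h ` A = A" unfolding h_def using E k(3) by (metis image_image)
    moreover have "h q = r"
    proof -
      have "F (f q) \<in> g ` A" "g r \<in> F ` f ` A" using E pqr by auto
      then obtain u v where "u \<in> A" "F (f q) = g u" "v \<in> A" "g r = F (f v)" by blast
      then have "F (f q) \<le> g r" "g r \<le> F (f q)" using f(3)[of v] g(3)[of u] Fm[of "f v" "f q"] by linarith+
      then show ?thesis unfolding h_def using k(2) pqr by simp
    qed
    ultimately show ?thesis using that by blast
  next
    assume E: "F ` f ` A = uminus ` g ` A"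
    then have E': "(\<lambda>x. - F (f x)) ` A = g ` A" by (force simp: image_image image_iff)
    define h where "h x = k (- F (f x))" for x
    have "topemb A (\<lambda>x. - F (f x))" using topemb_uminus[OF topemb_compose[OF f(1) tF]] .
    then have th: "topemb A h" unfolding h_def using topemb_compose[of A "\<lambda>x. - F (f x)" k] k(1) E' by simp
    have hA: "h ` A = A" unfolding h_def using E' k(3) by (metis image_image)
    have "h q = p"
    proof -
      have "- F (f q) \<in> g ` A" "g p \<in> (\<lambda>x. - F (f x)) ` A" using E' pqr by auto
      then obtain u v where "u \<in> A" "- F (f q) = g u" "v \<in> A" "g p = - F (f v)" by blast
      then have "g p \<le> - F (f q)" "- F (f q) \<le> g p" using f(3)[of v] g(2)[of u] Fm[of "f v" "f q"] by linarith+
      then have "- F (f q) = g p" by linarith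
      then show ?thesis unfolding h_def using k(2)[OF pqr(1)] by simp
    qed
    moreover have "h p = r"
    proof -
      have "- F (f p) \<in> g ` A" "g r \<in> (\<lambda>x. - F (f x)) ` A" using E' pqr by auto
      then obtain u v where "u \<in> A" "- F (f p) = g u" "v \<in> A" "g r = - F (f v)" by blast
      then have "- F (f p) \<le> g r" "g r \<le> - F (f p)"
        using f(2)[of v] g(3)[of u] Fm[of "f p" "f v"] by linarith+
      then have "- F (f p) = g r" by linarith
      then show ?thesis unfolding h_def using k(2)[OF pqr(3)] by simp
    qed
    ultimately show ?thesis
      using that[of "\<lambda>x. h (h x)"] topemb_compose[of A h h] th hA by (metis image_image)
  qed
qed

text \<open>Leaves room for a third extreme point besides \<open>q\<close> and \<open>r\<close>. If
  it fails, two points meet all nonempty clopen sets, and \<open>A\<close> has at most two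
  components.\<close>

definition wide :: "real set \<Rightarrow> bool" where
  "wide A \<longleftrightarrow> (\<forall>q\<in>A. \<forall>r\<in>A. \<exists>C. clopen_in A C \<and> C \<noteq> {} \<and> q \<notin> C \<and> r \<notin> C)"

text \<open>All points that can be moved to an end of a copy of a t-set are topologically alike: an
  auxiliary point \<open>p\<close> is put at one end, and a homeomorphism of the line exchanges at most the ends.\<close>

lemma extreme_orbit:
  assumes "t_set A" "wide A" "extreme A q" "extreme A r" "q \<in> A" "r \<in> A"
  obtains h where "topemb A h" "h ` A = A" "h q = r"
proof -
  obtain C where C: "clopen_in A C" "C \<noteq> {}" "q \<notin> C" "r \<notin> C" using assms unfolding wide_def by blast
  obtain p where p: "p \<in> C" "\<forall>x\<in>C. p \<le> x" 
    using compact_attains_inf[OF clopen_in_compact[OF C(1)] C(2)] by blast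
  have ep: "extreme A p" "p \<in> A"
    using C(1) p clopen_in_subset[OF C(1)] unfolding extreme_def by blast+
  obtain f where f: "topemb A f" "\<And>x. x \<in> A \<Longrightarrow> f p \<le> f x" "\<And>x. x \<in> A \<Longrightarrow> f x \<le> f q"
    using extreme_pair[OF ep(1) assms(3) C(1) p(1) C(3) assms(5)] by blast
  obtain g where g: "topemb A g" "\<And>x. x \<in> A \<Longrightarrow> g p \<le> g x" "\<And>x. x \<in> A \<Longrightarrow> g x \<le> g r"
    using extreme_pair[OF ep(1) assms(4) C(1) p(1) C(4) assms(6)] by blast
  show ?thesis using t_set_orbit_pair[OF assms(1) f g ep(2) assms(5,6)] that by blast
qed

section \<open>Both sides of an interval look alike\<close>

lemma near_image:
  assumes "compact X" "topemb X F" "near X a C" "a \<in> X" shows "near (F ` X) (F a) C"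
  unfolding near_def
proof (intro allI impI)
  fix e :: real assume "e > 0"
  moreover have "continuous_on X F" using assms unfolding topemb_def by auto
  ultimately obtain d where d: "d > 0" "\<And>x. x \<in> X \<Longrightarrow> dist x a < d \<Longrightarrow> dist (F x) (F a) < e"
    using assms(4) unfolding continuous_on_iff by blast
  then obtain D where D: "clopen_in X D" "D \<subseteq> ball a d - {a}" "C homeomorphic D"
    using assms(3) unfolding near_def by blast
  have DX: "D \<subseteq> X" using clopen_in_subset D(1) by blast
  have "F x \<in> ball (F a) e - {F a}" if "x \<in> D" for x
  proof -
    have x: "x \<in> X" "x \<in> ball a d" "x \<noteq> a" using that DX D(2) by auto
    then have "F x \<noteq> F a" using assms(2,4) unfolding topemb_def inj_on_def by blast
    then show ?thesis using d(2)[of x] x by (simp add: dist_commute)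
  qed
  then have "F ` D \<subseteq> ball (F a) e - {F a}" by (rule image_subsetI)
  moreover have "C homeomorphic (F ` D)"
    using homeomorphic_topemb[OF clopen_in_compact[OF D(1)] topemb_subset[OF assms(2) DX]]
    by (rule homeomorphic_trans[OF D(3)])
  ultimately show "\<exists>D. clopen_in (F ` X) D \<and> D \<subseteq> ball (F a) e - {F a} \<and> C homeomorphic D"
    using clopen_in_image[OF assms(2) D(1)] by blast
qed

text \<open>Otherwise \<open>{a - e / 2..a}\<close> would lie in \<open>A\<close>, and every clopen
  neighbourhood of \<open>a\<close> would have to contain it.\<close>

lemma zd_gap_left:
  assumes "zd (A \<inter> {..a}) a" "e > 0" obtains g where "a - e < g" "g < a" "g \<notin> A"
proof (rule ccontr)
  assume "\<not> thesis"
  then have sub: "{a - e / 2..a} \<subseteq> A \<inter> {..a}"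
    using that assms unfolding zd_def by (force simp: le_less)
  obtain U where U: "clopen_in (A \<inter> {..a}) U" "a \<in> U" "U \<subseteq> ball a (e / 2)"
    using assms unfolding zd_def by (meson half_gt_zero)
  have "a \<in> {a - e / 2..a} \<inter> U" using U(2) assms(2) by simp
  then have "{a - e / 2..a} \<subseteq> U" using interval_clopen_in[OF U(1) sub] by blast
  moreover have "a - e / 2 \<in> {a - e / 2..a}" using assms(2) by simp
  ultimately have "a - e / 2 \<in> ball a (e / 2)" using U(3) by blast
  then show False using assms(2) by (simp add: dist_real_def)
qed

text \<open>An asymmetry visible in the order of a copy. It survives increasing maps of the line
  (\<open>lopsided_image\<close>), while a reflection may destroy it.\<close>

definition lopsided :: "real set \<Rightarrow> real set \<Rightarrow> bool" where
  "lopsided C Y \<longleftrightarrow> (\<exists>a b. a < b \<and> {a..b} \<subseteq> Y \<and> near (Y \<inter> {b..}) b C \<and>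
     (\<forall>D. clopen_in Y D \<and> D \<subseteq> {..<a} \<longrightarrow> \<not> C homeomorphic D))"

lemma lopsided_image:
  assumes "lopsided C Y" "compact Y" "strict_mono F" "continuous_on UNIV F" shows "lopsided C (F ` Y)"
proof -
  obtain a b where ab: "a < b" "{a..b} \<subseteq> Y" "near (Y \<inter> {b..}) b C"
    "\<And>D. clopen_in Y D \<Longrightarrow> D \<subseteq> {..<a} \<Longrightarrow> \<not> C homeomorphic D"
    using assms(1) unfolding lopsided_def by blast
  have tF: "topemb X F" for X
    using assms continuous_on_subset unfolding topemb_def by (metis strict_mono_imp_inj_on inj_on_subset subset_UNIV)
  have Fm: "F x \<le> F y \<longleftrightarrow> x \<le> y" "F x < F y \<longleftrightarrow> x < y" for x y
    using assms(3) by (simp_all add: strict_mono_less_eq strict_mono_less)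
  have "{F a..F b} \<subseteq> F ` {a..b}"
    using IVT'[of F a _ b] ab(1) continuous_on_subset[OF assms(4)] by (force simp: image_iff)
  then have "{F a..F b} \<subseteq> F ` Y" using ab(2) by blast
  moreover have "F a < F b" using Fm ab by simp
  moreover have "near (F ` Y \<inter> {F b..}) (F b) C"
  proof -
    have "F ` (Y \<inter> {b..}) = F ` Y \<inter> {F b..}" using Fm by auto
    moreover have "compact (Y \<inter> {b..})" "b \<in> Y \<inter> {b..}" using assms(2) ab(1,2) by (auto intro: compact_Int_closed)
    ultimately show ?thesis using near_image[OF _ tF ab(3)] by metis
  qed
  moreover have "\<not> C homeomorphic D" if D: "clopen_in (F ` Y) D" "D \<subseteq> {..<F a}" for D
  proof
    assume CD: "C homeomorphic D"
    obtain E where E: "clopen_in Y E" "F ` E = D" using clopen_in_vimage[OF assms(2) tF D(1)] by blast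
    have "E homeomorphic D"
      using homeomorphic_topemb[OF clopen_in_compact[OF E(1)] tF] E(2) by simp
    then have "C homeomorphic E" using CD homeomorphic_sym homeomorphic_trans by blast
    moreover have "E \<subseteq> {..<a}" using E(2) D(2) Fm by auto
    ultimately show False using ab(4) E(1) by blast
  qed
  ultimately show ?thesis unfolding lopsided_def by blast
qed

text \<open>The lowest piece \<open>Y1\<close> is a copy of \<open>C\<close>, so it cannot lie left
  of the interval. It then contains the interval and with it disjoint copies of \<open>C\<close>
  near \<open>b\<close>, which would give \<open>dbl\<close>.\<close>

lemma not_lopsided:
  fixes C :: "real set"
  assumes "clopen_in Y Y1" "\<And>x y. x \<in> Y1 \<Longrightarrow> y \<in> Y - Y1 \<Longrightarrow> x < y" "C homeomorphic Y1" "\<not> dbl C" "compact C"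
  shows "\<not> lopsided C Y"
proof
  assume "lopsided C Y"
  then obtain a b where ab: "a < b" "{a..b} \<subseteq> Y" "near (Y \<inter> {b..}) b C"
    "\<And>D. clopen_in Y D \<Longrightarrow> D \<subseteq> {..<a} \<Longrightarrow> \<not> C homeomorphic D"
    unfolding lopsided_def by blast
  have Y: "compact Y" using assms(1) clopen_in_compact_carrier by blast
  have "\<not> Y1 \<subseteq> {..<a}" using ab(4) assms(1,3) by blast
  then obtain x where x: "x \<in> Y1" "a \<le> x" by (meson lessThan_iff linorder_not_le subsetI)
  have "a \<in> Y" using ab(1,2) by auto
  then have "a \<in> Y1" using assms(2)[of x a] x by fastforce
  then have "a \<in> {a..b} \<inter> Y1" using ab(1) by simp
  then have "{a..b} \<subseteq> Y1" using interval_clopen_in[OF assms(1) ab(2)] by blast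
  then have "b \<notin> Y - Y1" using ab(1) by auto
  have cK: "compact (Y - Y1)" using assms(1) unfolding clopen_in_def by blast
  obtain D1 where D1: "clopen_in (Y \<inter> {b..}) D1" "D1 \<subseteq> ball b 1 - {b}" "C homeomorphic D1" "D1 \<inter> (Y - Y1) = {}"
    using near_apart[OF ab(3) cK \<open>b \<notin> Y - Y1\<close> zero_less_one] by blast
  have "compact ((Y - Y1) \<union> D1)" "b \<notin> (Y - Y1) \<union> D1"
    using cK clopen_in_compact[OF D1(1)] D1(2) \<open>b \<notin> Y - Y1\<close> by auto
  then obtain D2 where D2: "clopen_in (Y \<inter> {b..}) D2" "D2 \<subseteq> ball b 1 - {b}" "C homeomorphic D2"
      "D2 \<inter> ((Y - Y1) \<union> D1) = {}"
    using near_apart[OF ab(3) _ _ zero_less_one] by metis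
  have sub: "clopen_in Y1 D" if "clopen_in (Y \<inter> {b..}) D" "D \<subseteq> ball b 1 - {b}" "D \<inter> (Y - Y1) = {}" for D
  proof -
    have "clopen_in Y D" using clopen_in_right[OF Y that(1)] that(2) by blast
    moreover have "D \<subseteq> Y1" using clopen_in_subset[OF that(1)] that(3) by blast
    ultimately show ?thesis using clopen_in_mono[of Y D Y1] assms(1) clopen_in_compact clopen_in_subset by blast
  qed
  have D: "clopen_in Y1 D1" "clopen_in Y1 D2" using sub D1 D2 by blast+
  have "Y1 homeomorphic D1" "Y1 homeomorphic D2"
    using assms(3) D1(3) D2(3) homeomorphic_sym homeomorphic_trans by blast+
  then have "dbl Y1"
    unfolding dbl_def using D D2(4) embeds_homeomorphic[OF clopen_in_compact[OF D(1)]]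
      embeds_homeomorphic[OF clopen_in_compact[OF D(2)]] by blast
  moreover have "embeds Y1 C" "embeds C Y1"
    using embeds_homeomorphic assms(3,5) homeomorphic_sym clopen_in_compact[OF assms(1)] by blast+
  ultimately show False using dbl_embeds assms(4) by blast
qed

text \<open>Otherwise two incompatible copies exist. In \<open>Y\<close> everything left of a gap
  close to \<open>a\<close> is moved to the far right, so that no copy of \<open>C\<close> remains
  left of \<open>a\<close>. In \<open>Z\<close> a copy of \<open>C\<close> sits at each end, so
  neither \<open>Z\<close> nor its mirror image is \<open>lopsided\<close>.\<close>

lemma t_set_near_left:
  assumes A: "t_set A" and s: "sided A a b" and nr: "near (A \<inter> {b..}) b C" and nd: "\<not> dbl C" and cC: "compact C"
  shows "near (A \<inter> {..a}) a C"
proof (rule ccontr)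
  assume "\<not> near (A \<inter> {..a}) a C"
  then obtain e where e: "e > 0" 
      "\<And>D. clopen_in (A \<inter> {..a}) D \<Longrightarrow> D \<subseteq> ball a e - {a} \<Longrightarrow> \<not> C homeomorphic D"
    unfolding near_def by blast
  have cA: "compact A" and ab: "a < b" "{a..b} \<subseteq> A" and z: "zd (A \<inter> {..a}) a"
    using s unfolding sided_def by auto
  obtain g where g: "a - e < g" "g < a" "g \<notin> A" using zd_gap_left[OF z e(1)] by blast
  define U where "U = A \<inter> {g..}"
  define V where "V = A \<inter> {..g}"
  have UV: "clopen_in A U" "clopen_in A V" "U \<inter> V = {}" "U \<union> V = A"
    unfolding U_def V_def using clopen_in_gap[OF cA g(3)] g(3) by (auto simp: order_antisym)
  \<comment> \<open>\<open>U\<close> stays where it is and \<open>V\<close>, the part below the gap,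
    is placed above it.\<close>
  from topemb_join[OF clopen_in_compact[OF UV(1)] clopen_in_compact[OF UV(2)] UV(3) topemb_id topemb_id]
  obtain h where h: "topemb A h" "\<And>x. x \<in> U \<Longrightarrow> h x = x" "\<And>x y. x \<in> U \<Longrightarrow> y \<in> V \<Longrightarrow> h x < h y"
    unfolding UV(4) by metis
  define Y where "Y = h ` A"
  have hU: "h ` U = U" using h(2) by force
  have cY: "compact Y" unfolding Y_def using compact_topemb_image cA h(1) by blast
  have UY: "clopen_in Y U" unfolding Y_def using clopen_in_image[OF h(1) UV(1)] hU by simp
  have YU: "x < y" if xy: "x \<in> U" "y \<in> Y - U" for x y
  proof -
    obtain w where w: "w \<in> A" "y = h w" using xy(2) unfolding Y_def by blast
    then have "w \<in> V" using xy(2) UV(4) h(2)[of w] by (metis DiffD2 UnE)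
    then show ?thesis using h(2)[OF xy(1)] h(3)[OF xy(1)] w by simp
  qed
  have abU: "{a..b} \<subseteq> U" using ab(2) g(2) unfolding U_def by auto
  have "lopsided C Y"
    unfolding lopsided_def
  proof (rule exI[of _ a], rule exI[of _ b], intro conjI allI impI)
    show "a < b" "{a..b} \<subseteq> Y" using ab abU clopen_in_subset[OF UY] by auto
    have eq: "A \<inter> {b..} = U \<inter> {b..}" unfolding U_def using ab g by auto
    show "near (Y \<inter> {b..}) b C"
    proof (rule near_mono[OF nr _ _ zero_less_one])
      show "compact (Y \<inter> {b..})" "compact (A \<inter> {b..})" using cY cA by (auto intro: compact_Int_closed)
      have "Y \<inter> {b..} \<inter> (A \<inter> {b..}) = (Y \<inter> {b..}) \<inter> U" unfolding eq by auto
      then show "clopen_in (Y \<inter> {b..}) (Y \<inter> {b..} \<inter> (A \<inter> {b..}))"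
        using clopen_in_restrict[OF UY \<open>compact (Y \<inter> {b..})\<close>] by simp
      show "A \<inter> {b..} \<inter> ball b 1 \<subseteq> Y \<inter> {b..}" unfolding eq using clopen_in_subset[OF UY] by auto
    qed
    fix D assume D: "clopen_in Y D \<and> D \<subseteq> {..<a}"
    have aU: "a \<in> U" using abU ab(1) by auto
    have DU: "D \<subseteq> U"
    proof
      fix x assume "x \<in> D"
      then have "x \<in> Y" "x < a" using D clopen_in_subset by auto
      then show "x \<in> U" using YU[OF aU, of x] by fastforce
    qed
    then have "clopen_in U D" using clopen_in_mono D clopen_in_compact[OF UY] clopen_in_subset[OF UY] by blast
    then have "clopen_in A D" using clopen_in_trans UV(1) by blast
    moreover have "compact (A \<inter> {..a})" using cA by (auto intro: compact_Int_closed)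
    moreover have "D \<subseteq> A \<inter> {..a}" using D DU UV(4) by auto
    ultimately have "clopen_in (A \<inter> {..a}) D" using clopen_in_mono by blast
    moreover have "D \<subseteq> ball a e - {a}"
    proof
      fix x assume "x \<in> D"
      then have "x < a" "g \<le> x" using D DU unfolding U_def by auto
      then show "x \<in> ball a e - {a}" using g by (auto simp: dist_real_def)
    qed
    ultimately show "\<not> C homeomorphic D" using e(2) by blast
  qed
  \<comment> \<open>Two disjoint copies of \<open>C\<close> are taken from the right side of
    \<open>b\<close>, one for each end of \<open>Z\<close>.\<close>
  obtain D1 where D1: "clopen_in (A \<inter> {b..}) D1" "D1 \<subseteq> ball b 1 - {b}" "C homeomorphic D1"
    using nr zero_less_one unfolding near_def by blast
  have "b \<notin> D1" using D1(2) by blast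
  then obtain D2 where D2: "clopen_in (A \<inter> {b..}) D2" "D2 \<subseteq> ball b 1 - {b}" "C homeomorphic D2" "D2 \<inter> D1 = {}"
    using near_apart[OF nr clopen_in_compact[OF D1(1)] _ zero_less_one] by blast
  have D: "clopen_in A D1" "clopen_in A D2" using clopen_in_right[OF cA] D1 D2 by blast+
  define R where "R = A - (D1 \<union> D2)"
  have R: "clopen_in A R" unfolding R_def using D clopen_in_Un clopen_in_compl by blast
  have "D1 \<inter> R = {}" unfolding R_def by blast
  from topemb_join[OF clopen_in_compact[OF D(1)] clopen_in_compact[OF R] this topemb_id topemb_id]
  obtain k where k: "topemb (D1 \<union> R) k" "\<And>x y. x \<in> D1 \<Longrightarrow> y \<in> R \<Longrightarrow> k x < k y" by metis
  have "compact (D1 \<union> R)" "(D1 \<union> R) \<inter> D2 = {}"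
    using clopen_in_compact D R D2(4) unfolding R_def by auto
  from topemb_join[OF this(1) clopen_in_compact[OF D(2)] this(2) k(1) topemb_id]
  obtain l where l: "topemb ((D1 \<union> R) \<union> D2) l" "\<And>x. x \<in> D1 \<union> R \<Longrightarrow> l x = k x"
    "\<And>x y. x \<in> D1 \<union> R \<Longrightarrow> y \<in> D2 \<Longrightarrow> l x < l y" by metis
  have A_eq: "(D1 \<union> R) \<union> D2 = A" unfolding R_def using D clopen_in_subset by blast
  then have lA: "topemb A l" using l(1) by simp
  define Z where "Z = l ` A"
  have cl: "clopen_in Z (l ` D)" if "clopen_in A D" for D unfolding Z_def using clopen_in_image[OF lA that] .
  have hom: "C homeomorphic (l ` D)" if "C homeomorphic D" "clopen_in A D" for D
    using that homeomorphic_topemb[OF clopen_in_compact topemb_subset[OF lA clopen_in_subset]] homeomorphic_trans by blast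
  have "\<not> lopsided C Z"
  proof (rule not_lopsided[OF cl[OF D(1)] _ hom[OF D1(3) D(1)] nd cC])
    fix x y assume "x \<in> l ` D1" "y \<in> Z - l ` D1"
    then obtain u v where "u \<in> D1" "x = l u" "v \<in> R \<union> D2" "y = l v" using A_eq unfolding Z_def by blast
    then show "x < y" using l(2)[of u] l(2)[of v] l(3)[of u v] k(2)[of u v] by auto
  qed
  moreover have "\<not> lopsided C (uminus ` Z)"
  proof (rule not_lopsided[OF _ _ _ nd cC])
    have tu: "topemb X uminus" for X :: "real set" using topemb_uminus[OF topemb_id] by simp
    show "clopen_in (uminus ` Z) (uminus ` l ` D2)" using clopen_in_image[OF tu cl[OF D(2)]] .
    show "C homeomorphic (uminus ` l ` D2)"
      using hom[OF D2(3) D(2)] homeomorphic_topemb[OF clopen_in_compact[OF cl[OF D(2)]] tu] homeomorphic_trans by blast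
    fix x y assume "x \<in> uminus ` l ` D2" "y \<in> uminus ` Z - uminus ` l ` D2"
    then obtain u v where "u \<in> D2" "x = - l u" "v \<in> D1 \<union> R" "y = - l v" using A_eq unfolding Z_def by blast
    then show "x < y" using l(3)[of v u] by auto
  qed
  moreover have "A homeomorphic Y" "A homeomorphic Z"
    unfolding Y_def Z_def using homeomorphic_topemb cA h(1) lA by auto
  then obtain F where "strict_mono F" "continuous_on UNIV F" "F ` Y = Z \<or> F ` Y = uminus ` Z"
    using t_set_copies[OF A] by metis
  ultimately show False using lopsided_image[OF \<open>lopsided C Y\<close> cY] by metis
qed

text \<open>Reflection exchanges the two sides of the interval.\<close>

lemma t_set_near_right:
  assumes A: "t_set A" and s: "sided A a b" and nl: "near (A \<inter> {..a}) a C" and nd: "\<not> dbl C" and cC: "compact C"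
  shows "near (A \<inter> {b..}) b C"
proof -
  have tu: "topemb X uminus" for X :: "real set" using topemb_uminus[OF topemb_id] by simp
  have cA: "compact A" and ab: "a < b" "{a..b} \<subseteq> A" "a \<in> A" "b \<in> A"
    and z: "zd (A \<inter> {..a}) a" "zd (A \<inter> {b..}) b"
    using s unfolding sided_def by auto
  have cl: "compact (A \<inter> {..a})" "compact (A \<inter> {b..})" using cA by (auto intro: compact_Int_closed)
  let ?B = "uminus ` A"
  have eq: "uminus ` (A \<inter> {..a}) = ?B \<inter> {-a..}" "uminus ` (A \<inter> {b..}) = ?B \<inter> {..-b}" by auto
  have "A homeomorphic ?B" using homeomorphic_topemb[OF cA tu] .
  then have "t_set ?B" using A t_set_homeomorphic by blast
  moreover have "sided ?B (-b) (-a)"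
    unfolding sided_def
  proof (intro conjI)
    show "compact ?B" using compact_topemb_image[OF cA tu] .
    show "-b < -a" using ab by simp
    show "{-b..-a} \<subseteq> ?B" using ab(2) image_mono[OF ab(2), of uminus] by simp
    show "zd (?B \<inter> {..-b}) (-b)" "zd (?B \<inter> {-a..}) (-a)"
      using zd_image[OF cl(2) tu z(2)] zd_image[OF cl(1) tu z(1)] eq by simp_all
  qed
  moreover have "near (?B \<inter> {-a..}) (-a) C" using near_image[OF cl(1) tu nl] ab eq by simp
  ultimately have n: "near (?B \<inter> {..-b}) (-b) C" using t_set_near_left nd cC by blast
  have "uminus ` (?B \<inter> {..-b}) = A \<inter> {b..}" unfolding eq(2)[symmetric] by (auto simp: image_image)
  moreover have "compact (?B \<inter> {..-b})" using compact_topemb_image[OF cl(2) tu] eq(2) by simp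
  ultimately show ?thesis using near_image[OF _ tu n] ab by simp
qed

section \<open>Decomposition into prime sets\<close>

text \<open>Baire category: without isolated points the sets \<open>K - {y}\<close> would be
  countably many dense open subsets of \<open>K\<close> with empty intersection.\<close>

lemma countable_closed_isolated:
  fixes K :: "real set"
  assumes "closed K" "countable K" "K \<noteq> {}"
  obtains y e where "y \<in> K" "e > 0" "K \<inter> ball y e = {y}"
proof (rule ccontr)
  assume "\<not> thesis"
  then have no: "\<And>y e. y \<in> K \<Longrightarrow> e > 0 \<Longrightarrow> K \<inter> ball y e \<noteq> {y}" using that by blast
  let ?G = "(\<lambda>y. K - {y}) ` K"
  have "K \<subseteq> closure (\<Inter> ?G)"
  proof (rule Baire[OF assms(1)])
    show "countable ?G" using assms(2) by blast
    fix T assume "T \<in> ?G"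
    then obtain y where y: "y \<in> K" "T = K - {y}" by blast
    have "openin (top_of_set K) T" unfolding y(2) by (simp add: openin_delete)
    moreover have "z \<in> closure T" if "z \<in> K" for z
    proof (cases "z = y")
      case True
      have "\<exists>w\<in>T. dist w y < e" if "e > 0" for e
      proof -
        have "y \<in> K \<inter> ball y e" "K \<inter> ball y e \<noteq> {y}" using no[OF y(1) that] y(1) that by auto
        then obtain w where "w \<in> K" "w \<in> ball y e" "w \<noteq> y" by blast
        then show ?thesis unfolding y(2) by (auto simp: dist_commute)
      qed
      then show ?thesis using True by (simp add: closure_approachable)
    next
      case False
      then have "z \<in> T" using that y(2) by blast
      then show ?thesis by (rule closure_subset[THEN subsetD])
    qed
    ultimately show "openin (top_of_set K) T \<and> K \<subseteq> closure T" by blast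
  qed
  moreover have "\<Inter> ?G = {}" using assms(3) by auto
  ultimately show False using assms(3) by simp
qed

text \<open>Collapsing the intervals of \<open>N\<close> to points leaves a compact image, countable
  because every interval contains a rational. An isolated point of the image has a clopen fibre, and
  this fibre is one interval.\<close>

lemma isolated_interval:
  fixes N :: "real set"
  assumes N: "compact N" "N \<noteq> {}"
    and int: "\<And>x. x \<in> N \<Longrightarrow> \<exists>a b. a < b \<and> x \<in> {a..b} \<and> {a..b} \<subseteq> N"
  obtains a b where "a < b" "clopen_in N {a..b}"
proof -
  obtain m where m: "\<And>x. x \<in> N \<Longrightarrow> m \<le> x" using compact_attains_inf[OF N] by blast
  have mN[measurable]: "N \<in> sets lborel" using N(1) by (simp add: borel_compact)
  \<comment> \<open>The measure of the complement realizes the collapse: it is constant along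
    intervals of \<open>N\<close>, increases across every gap since gaps are open, and is
    1-Lipschitz, hence continuous.\<close>
  define g where "g x = measure lborel ({m..x} - N)" for x
  have fm: "{u..v} - N \<in> fmeasurable lborel" for u v :: real
  proof (rule fmeasurableI2)
    show "{u..v} \<in> fmeasurable lborel" by (simp add: fmeasurable_def emeasure_lborel_Icc_eq)
    show "{u..v} - N \<in> sets lborel" using mN by (intro sets.Diff) auto
  qed auto
  have fm': "{u<..v} - N \<in> fmeasurable lborel" for u v :: real
  proof (rule fmeasurableI2[OF fm[of u v]])
    show "{u<..v} - N \<in> sets lborel" using mN by (intro sets.Diff) auto
  qed auto
  have g_add: "g y = g x + measure lborel ({x<..y} - N)" if "m \<le> x" "x \<le> y" for x y
  proof -
    have "{m..y} - N = ({m..x} - N) \<union> ({x<..y} - N)" using that by auto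
    moreover have "({m..x} - N) \<inter> ({x<..y} - N) = {}" by auto
    ultimately show ?thesis
      unfolding g_def using measure_Un3[OF fm[of m x] fm'[of x y]] by simp
  qed
  have g_le: "g x \<le> g y" "g y - g x \<le> y - x" if "m \<le> x" "x \<le> y" for x y
  proof -
    show "g x \<le> g y" using g_add[OF that] by simp
    have "measure lborel ({x<..y} - N) \<le> measure lborel {x..y}"
      using fm' by (intro measure_mono_fmeasurable) (auto simp: fmeasurable_def emeasure_lborel_Icc_eq)
    then show "g y - g x \<le> y - x" using g_add[OF that] that by simp
  qed
  have g_const: "g x = g y" if "m \<le> x" "x \<le> y" "{x..y} \<subseteq> N" for x y
  proof -
    have "{x<..y} - N = {}" using that(3) by auto
    then show ?thesis using g_add[OF that(1,2)] by (simp only: measure_empty)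
  qed
  have g_eq: "{x..y} \<subseteq> N" if "x \<in> N" "y \<in> N" "x \<le> y" "g x = g y" for x y
  proof (rule ccontr)
    assume "\<not> {x..y} \<subseteq> N"
    then obtain z where z: "x \<le> z" "z \<le> y" "z \<notin> N" by (meson atLeastAtMost_iff subsetI)
    then have z': "x < z" "z < y" using that(1,2) by (metis order_le_less)+
    have "open ({x<..<y} - N)" using N(1) by (intro open_Diff compact_imp_closed) auto
    then obtain e where e: "e > 0" "ball z e \<subseteq> {x<..<y} - N" using z z' by (meson DiffI greaterThanLessThan_iff openE)
    have "{z - e/2..z + e/2} \<subseteq> ball z e" using e(1) by (auto simp: dist_real_def abs_less_iff)
    moreover have "{x<..<y} - N \<subseteq> {x<..y} - N" by auto
    ultimately have "{z - e/2..z + e/2} \<subseteq> {x<..y} - N" using e(2) by blast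
    then have "measure lborel {z - e/2..z + e/2} \<le> measure lborel ({x<..y} - N)"
      using fm' by (intro measure_mono_fmeasurable) auto
    then show False using g_add[OF m[OF that(1)] that(3)] that(4) e(1) by simp
  qed
  have dist_g: "\<bar>g y - g x\<bar> \<le> \<bar>y - x\<bar>" if "x \<in> N" "y \<in> N" for x y
    using g_le[of x y] g_le[of y x] m[OF that(1)] m[OF that(2)] by linarith
  have cg: "continuous_on N g"
    unfolding continuous_on_iff dist_real_def using dist_g by (metis order_le_less_trans)
  have cK: "compact (g ` N)" using compact_continuous_image[OF cg N(1)] .
  have "g ` N \<subseteq> g ` \<rat>"
  proof
    fix y assume "y \<in> g ` N"
    then obtain x where x: "x \<in> N" "y = g x" by blast
    then obtain a b where ab: "a < b" "x \<in> {a..b}" "{a..b} \<subseteq> N" using int by blast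
    obtain q where q: "q \<in> \<rat>" "a < q" "q < b" using Rats_dense_in_real[OF ab(1)] by blast
    have "a \<in> N" using ab(1,3) by auto
    then have ma: "m \<le> a" by (rule m)
    have "{a..x} \<subseteq> N" "{a..q} \<subseteq> N" using ab q by (auto simp: subset_iff)
    then have "g a = g x" "g a = g q" using ma ab(2) q(2) g_const by auto
    then have "y = g q" using x(2) by simp
    then show "y \<in> g ` \<rat>" using q(1) by (rule image_eqI)
  qed
  then have "countable (g ` N)" by (rule countable_subset[OF _ countable_image[OF countable_rat]])
  moreover have "g ` N \<noteq> {}" using N(2) by simp
  ultimately obtain y e where ye: "y \<in> g ` N" "e > 0" "g ` N \<inter> ball y e = {y}"
    by (rule countable_closed_isolated[OF compact_imp_closed[OF cK]])
  define S where "S = N \<inter> g -` {y}"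
  have closed_vimage: "closed (N \<inter> g -` T)" if "closed T" for T
    using continuous_on_closed_vimage[OF compact_imp_closed[OF N(1)], of g] cg that by (simp add: Int_commute)
  have compact_sub: "compact T" if "closed T" "T \<subseteq> N" for T
    using compact_Int_closed[OF N(1) that(1)] that(2) by (simp add: inf.absorb2)
  have cS: "compact S" unfolding S_def by (intro compact_sub closed_vimage) auto
  have "N - S = N \<inter> g -` (- ball y e)" using ye(2,3) unfolding S_def by auto
  moreover have "closed (N \<inter> g -` (- ball y e))" by (intro closed_vimage) auto
  ultimately have "compact (N - S)" by (intro compact_sub) auto
  then have clS: "clopen_in N S" unfolding clopen_in_def using cS S_def by auto
  obtain x where x: "x \<in> N" "g x = y" using ye(1) by blast
  then have neS: "S \<noteq> {}" unfolding S_def by blast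
  obtain a where a: "a \<in> S" "\<forall>s\<in>S. a \<le> s" using compact_attains_inf[OF cS neS] by blast
  obtain b where b: "b \<in> S" "\<forall>s\<in>S. s \<le> b" using compact_attains_sup[OF cS neS] by blast
  have S_eq: "S = {a..b}"
  proof
    show "S \<subseteq> {a..b}" using a b by auto
    have ab: "a \<in> N" "b \<in> N" "g a = y" "g b = y" "a \<le> b" using a b unfolding S_def by auto
    then have sub: "{a..b} \<subseteq> N" using g_eq by simp
    show "{a..b} \<subseteq> S"
    proof
      fix s assume s: "s \<in> {a..b}"
      then have "g a \<le> g s" "g s \<le> g b" using g_le(1)[of a s] g_le(1)[of s b] m[OF ab(1)] by auto
      then show "s \<in> S" using s sub ab unfolding S_def by auto
    qed
  qed
  \<comment> \<open>An interval of \<open>N\<close> through \<open>x\<close> stays in the fibre of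
    \<open>x\<close>, so the fibre is nondegenerate.\<close>
  obtain c d where cd: "c < d" "x \<in> {c..d}" "{c..d} \<subseteq> N" using int[OF x(1)] by blast
  then have cdN: "c \<in> N" "d \<in> N" by auto
  have "{c..x} \<subseteq> N" using cd by (auto simp: subset_iff)
  then have "g c = g x" "g c = g d" using g_const m[OF cdN(1)] cd by auto
  then have "c \<in> S" "d \<in> S" using cdN x(2) unfolding S_def by auto
  then have "a < b" using cd(1) S_eq by auto
  then show ?thesis using that clS S_eq by blast
qed

lemma zd_gap_right:
  assumes "compact A" "zd (A \<inter> {b..}) b" "e > 0" obtains g where "b < g" "g < b + e" "g \<notin> A"
proof -
  have tu: "topemb X uminus" for X :: "real set" using topemb_uminus[OF topemb_id] by simp
  have "compact (A \<inter> {b..})" using assms(1) by (auto intro: compact_Int_closed)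
  moreover have "uminus ` (A \<inter> {b..}) = uminus ` A \<inter> {..-b}" by auto
  ultimately have "zd (uminus ` A \<inter> {..-b}) (-b)" using zd_image[OF _ tu assms(2)] by simp
  then obtain g where g: "- b - e < g" "g < - b" "g \<notin> uminus ` A" using zd_gap_left assms(3) by blast
  have "- g \<notin> A" using g(3) by (metis image_eqI minus_minus)
  then show ?thesis using that[of "-g"] g(1,2) by auto
qed

text \<open>If neither interval of length \<open>e / 2\<close> beginning or ending at
  \<open>x\<close> lies in \<open>A\<close>, gaps on both sides cut out a clopen neighbourhood
  inside the ball of radius \<open>e\<close>.\<close>

lemma not_zd_interval:
  assumes A: "compact A" "x \<in> A" "\<not> zd A x"
  obtains a b where "a < b" "x \<in> {a..b}" "{a..b} \<subseteq> A"
proof -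
  obtain e where e: "e > 0" "\<And>U. clopen_in A U \<Longrightarrow> x \<in> U \<Longrightarrow> \<not> U \<subseteq> ball x e"
    using assms unfolding zd_def by blast
  consider "{x - e/2..x} \<subseteq> A" | "{x..x + e/2} \<subseteq> A"
    | g h where "x - e/2 \<le> g" "g \<le> x" "g \<notin> A" "x \<le> h" "h \<le> x + e/2" "h \<notin> A"
    by (meson atLeastAtMost_iff subsetI)
  then show ?thesis
  proof cases
    case 1
    then show ?thesis using that[of "x - e/2" x] e by auto
  next
    case 2
    then show ?thesis using that[of x "x + e/2"] e by auto
  next
    case 3
    have "A \<inter> {g..h} \<subseteq> ball x e" using 3 e(1) by (auto simp: dist_real_def)
    moreover have "x \<in> A \<inter> {g..h}" using 3 A(2) by simp
    ultimately show ?thesis using e(2) clopen_in_gap2[OF A(1) 3(3,6)] by blast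
  qed
qed

context base_class
begin

text \<open>The least point of a nonempty clopen set is extreme and has a base neighbourhood, whose
  trace on that set is again a base piece.\<close>

lemma base_near:
  assumes A: "compact X" "X \<subseteq> A"
    and ext: "\<And>p. p \<in> A \<Longrightarrow> extreme A p \<Longrightarrow> \<exists>W. clopen_in A W \<and> p \<in> W \<and> BB W"
    and B: "BB B"
    and ex: "\<And>e. e > 0 \<Longrightarrow> \<exists>C. clopen_in A C \<and> C \<noteq> {} \<and> C \<subseteq> X \<inter> ball a e - {a}"
  shows "near X a B"
  unfolding near_def
proof (intro allI impI)
  fix e :: real assume "e > 0"
  then obtain C where C: "clopen_in A C" "C \<noteq> {}" "C \<subseteq> X \<inter> ball a e - {a}" using ex by blast
  obtain p where p: "p \<in> C" "\<forall>s\<in>C. p \<le> s" using compact_attains_inf[OF clopen_in_compact[OF C(1)] C(2)] by blast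
  then have "extreme A p" "p \<in> A" using C(1) clopen_in_subset[OF C(1)] unfolding extreme_def by blast+
  then obtain W where W: "clopen_in A W" "p \<in> W" "BB W" using ext by blast
  have "clopen_in W (W \<inter> C)" "clopen_in A (W \<inter> C)"
    using clopen_in_restrict[OF C(1) clopen_in_compact[OF W(1)] clopen_in_subset[OF W(1)]]
      clopen_in_Int[OF W(1) C(1)] by auto
  moreover from this have "BB (W \<inter> C)" using BB_clopen[OF W(3)] W(2) p(1) by blast
  then have "B homeomorphic (W \<inter> C)" using BB_unique B by blast
  moreover have "W \<inter> C \<subseteq> X" "W \<inter> C \<subseteq> ball a e - {a}" using C(3) by auto
  ultimately show "\<exists>D. clopen_in X D \<and> D \<subseteq> ball a e - {a} \<and> B homeomorphic D"
    using clopen_in_mono[OF _ A] by blast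
qed

text \<open>A gap close to \<open>a\<close> cuts off a clopen neighbourhood of \<open>a\<close>. As
  \<open>a\<close> is not extreme, it is not the least point there, and a second gap separates a
  smaller point from \<open>a\<close>.\<close>

lemma clopen_near_left:
  assumes A: "compact A" and z: "zd (A \<inter> {..a}) a" and aA: "a \<in> A" "\<not> extreme A a" and e: "e > 0"
  shows "\<exists>C. clopen_in A C \<and> C \<noteq> {} \<and> C \<subseteq> (A \<inter> {..a}) \<inter> ball a e - {a}"
proof -
  obtain g where g: "a - e < g" "g < a" "g \<notin> A" using zd_gap_left[OF z e] by blast
  have "clopen_in A (A \<inter> {g..})" "a \<in> A \<inter> {g..}" using clopen_in_gap A g aA by auto
  then have "\<not> (\<forall>x\<in>A \<inter> {g..}. a \<le> x)" using aA(2) unfolding extreme_def by blast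
  then obtain x where x: "x \<in> A" "g \<le> x" "x < a" by (auto simp: not_le)
  obtain h where h: "x < h" "h < a" "h \<notin> A" using zd_gap_left[OF z, of "a - x"] x by auto
  show ?thesis
    using clopen_in_gap2[OF A g(3) h(3)] x h g
    by (intro exI[of _ "A \<inter> {g..h}"]) (auto simp: dist_real_def)
qed

lemma clopen_near_right:
  assumes A: "compact A" and z: "zd (A \<inter> {b..}) b" and bA: "b \<in> A" "\<not> extreme A b" and e: "e > 0"
  shows "\<exists>C. clopen_in A C \<and> C \<noteq> {} \<and> C \<subseteq> (A \<inter> {b..}) \<inter> ball b e - {b}"
proof -
  obtain g where g: "b < g" "g < b + e" "g \<notin> A" using zd_gap_right[OF A z e] by blast
  have "clopen_in A (A \<inter> {..g})" "b \<in> A \<inter> {..g}" using clopen_in_gap A g bA by auto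
  then have "\<not> (\<forall>x\<in>A \<inter> {..g}. x \<le> b)" using bA(2) unfolding extreme_def by blast
  then obtain x where x: "x \<in> A" "x \<le> g" "b < x" by (auto simp: not_le)
  obtain h where h: "b < h" "h < x" "h \<notin> A" using zd_gap_right[OF A z, of "x - b"] x by auto
  show ?thesis
    using clopen_in_gap2[OF A h(3) g(3)] x h g
    by (intro exI[of _ "A \<inter> {h..g}"]) (auto simp: dist_real_def)
qed

text \<open>A prime set with \<open>dbl\<close> embeds in the base piece, which is near both ends by
  hypothesis; for the others the rearrangement argument applies.\<close>

lemma t_set_near_symmetric:
  assumes "t_set A" "sided A a b" "prime_set C" "BB B" "near2 A a b B"
    and "near (A \<inter> {..a}) a C \<or> near (A \<inter> {b..}) b C"
  shows "near2 A a b C"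
proof (cases "dbl C")
  case True
  then have "embeds C B" using prime_set_dbl assms(3,4) by blast
  then show ?thesis using near2_mono assms(5) by blast
next
  case False
  then show ?thesis
    using assms(6) t_set_near_left[OF assms(1,2) _ False] t_set_near_right[OF assms(1,2) _ False]
      prime_set_compact[OF assms(3)] unfolding near2_def by blast
qed

text \<open>The set \<open>N\<close> of points without prime neighbourhood is compact and contains
  no extreme point, so it is made of intervals, one of them isolated in \<open>N\<close>. Other
  points close to this interval have prime neighbourhoods; once these are seen to be absorbed on
  both sides, the interval gets a prime neighbourhood itself, a contradiction.\<close>

lemma t_set_prime_neighbourhood:
  assumes tA: "t_set A"
    and ext: "\<And>p. p \<in> A \<Longrightarrow> extreme A p \<Longrightarrow> \<exists>W. clopen_in A W \<and> p \<in> W \<and> BB W"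
    and xA: "x \<in> A"
  shows "\<exists>Q. clopen_in A Q \<and> x \<in> Q \<and> prime_set Q"
proof (rule ccontr)
  assume no: "\<not> (\<exists>Q. clopen_in A Q \<and> x \<in> Q \<and> prime_set Q)"
  have cA: "compact A" using tA t_set_compact by blast
  define N where "N = A \<inter> \<Inter> ((\<lambda>Q. A - Q) ` {Q. clopen_in A Q \<and> prime_set Q})"
  have "closed (\<Inter> ((\<lambda>Q. A - Q) ` {Q. clopen_in A Q \<and> prime_set Q}))"
    by (intro closed_INT ballI) (auto simp: clopen_in_def intro: compact_imp_closed)
  then have cN: "compact N" unfolding N_def using cA by (rule compact_Int_closed[rotated])
  have N_iff: "y \<in> N \<longleftrightarrow> y \<in> A \<and> \<not> (\<exists>Q. clopen_in A Q \<and> y \<in> Q \<and> prime_set Q)" for y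
    unfolding N_def by blast
  have neN: "N \<noteq> {}" using N_iff no xA by blast
  have not_ext: "\<not> extreme A y" if "y \<in> N" for y
    using that ext N_iff prime_set.base by blast
  have int_N: "{a..b} \<subseteq> N" if ab: "{a..b} \<subseteq> A" "y \<in> {a..b}" "y \<in> N" for a b y
  proof
    fix w assume w: "w \<in> {a..b}"
    have "False" if "clopen_in A Q" "w \<in> Q" "prime_set Q" for Q
    proof -
      have "{a..b} \<subseteq> Q" using interval_clopen_in[OF that(1) ab(1)] w that(2) by blast
      then show False using ab(2,3) N_iff that by blast
    qed
    then show "w \<in> N" using N_iff w ab(1) by blast
  qed
  have "\<exists>a b. a < b \<and> y \<in> {a..b} \<and> {a..b} \<subseteq> N" if y: "y \<in> N" for y
  proof -
    have "y \<in> A" "\<not> zd A y" using N_iff y not_ext[OF y] unfolding extreme_def by auto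
    then obtain a b where "a < b" "y \<in> {a..b}" "{a..b} \<subseteq> A" using not_zd_interval cA by metis
    then show ?thesis using int_N y by blast
  qed
  then obtain a b where ab: "a < b" "clopen_in N {a..b}" using isolated_interval[OF cN neN] by blast
  have NA: "N \<subseteq> A" unfolding N_def by blast
  have "{a..b} \<subseteq> N" using clopen_in_subset[OF ab(2)] .
  then have abN: "{a..b} \<subseteq> N" "a \<in> N" "b \<in> N" using ab(1) by auto
  then have abA: "a \<in> A" "b \<in> A" "{a..b} \<subseteq> A" using NA by auto
  have mem: "a \<in> {a..b}" "b \<in> {a..b}" using ab(1) by auto
  obtain e1 where e1: "e1 > 0" "N \<inter> ball a e1 \<subseteq> {a..b}" by (rule clopen_in_ball[OF ab(2) mem(1)])
  obtain e2 where e2: "e2 > 0" "N \<inter> ball b e2 \<subseteq> {a..b}" by (rule clopen_in_ball[OF ab(2) mem(2)])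
  have cl: "compact (A \<inter> {..a})" "compact (A \<inter> {b..})" using cA by (auto intro: compact_Int_closed)
  have zl: "zd (A \<inter> {..a}) a"
  proof (rule ccontr)
    assume "\<not> zd (A \<inter> {..a}) a"
    then obtain c d where cd: "c < d" "a \<in> {c..d}" "{c..d} \<subseteq> A \<inter> {..a}"
      using not_zd_interval[OF cl(1)] abA by (metis IntI atMost_iff order_refl)
    then have "d \<in> {..a}" by auto
    then have da: "d = a" "c < a" using cd by auto
    have sub: "{c..d} \<subseteq> N" using int_N[of c d a] cd abN by blast
    define w where "w = max c (a - e1 / 2)"
    have "w \<in> N" using sub da e1(1) unfolding w_def by auto
    moreover have "w \<in> ball a e1" "w < a" using da e1(1) unfolding w_def by (auto simp: dist_real_def)
    ultimately show False using e1(2) by fastforce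
  qed
  have zr: "zd (A \<inter> {b..}) b"
  proof (rule ccontr)
    assume "\<not> zd (A \<inter> {b..}) b"
    then obtain c d where cd: "c < d" "b \<in> {c..d}" "{c..d} \<subseteq> A \<inter> {b..}"
      using not_zd_interval[OF cl(2)] abA by (metis IntI atLeast_iff order_refl)
    then have "c \<in> {b..}" by auto
    then have da: "c = b" "b < d" using cd by auto
    have sub: "{c..d} \<subseteq> N" using int_N[of c d b] cd abN by blast
    define w where "w = min d (b + e2 / 2)"
    have "w \<in> N" using sub da e2(1) unfolding w_def by auto
    moreover have "w \<in> ball b e2" "w > b" using da e2(1) unfolding w_def by (auto simp: dist_real_def)
    ultimately show False using e2(2) by fastforce
  qed
  have s: "sided A a b" unfolding sided_def using cA ab(1) abA zl zr by blast
  obtain p where p: "p \<in> A" "\<forall>s\<in>A. p \<le> s" using compact_attains_inf[OF cA] xA by blast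
  then have "extreme A p" using clopen_in_self[OF cA] unfolding extreme_def by blast
  then obtain B where B: "BB B" using ext p(1) by blast
  \<comment> \<open>The end points belong to \<open>N\<close> and so are not extreme; therefore
    clopen sets, and with them base pieces, accumulate there from outside.\<close>
  have nB: "near2 A a b B"
    unfolding near2_def
    using base_near[OF cl(1) Int_lower1 ext B clopen_near_left[OF cA zl abA(1) not_ext[OF abN(2)]]]
      base_near[OF cl(2) Int_lower1 ext B clopen_near_right[OF cA zr abA(2) not_ext[OF abN(3)]]] by blast
  define good where "good y \<longleftrightarrow> (\<exists>Q. clopen_in A Q \<and> y \<in> Q \<and> Q \<inter> {a..b} = {} \<and> prime_set Q \<and> near2 A a b Q)" for y
  \<comment> \<open>If this failed, bad points would come arbitrarily close to the interval, and so
    would prime sets that are not near both ends (\<open>small\<close>).\<close>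
  have "\<exists>e>0. \<forall>y\<in>A - {a..b}. a - e < y \<and> y < b + e \<longrightarrow> good y"
  proof (rule ccontr)
    assume "\<not> ?thesis"
    then have bad: "\<exists>y\<in>A - {a..b}. a - e < y \<and> y < b + e \<and> \<not> good y" if "e > 0" for e
      using that by blast
    have small: "\<exists>C. prime_set C \<and> clopen_in A C \<and> \<not> near2 A a b C \<and>
        (C \<subseteq> ball a e \<inter> {..<a} \<or> C \<subseteq> ball b e \<inter> {b<..})" if e: "e > 0" for e
    proof -
      define d where "d = min e (min e1 e2)"
      have d: "d > 0" "d \<le> e" "d \<le> e1" "d \<le> e2" unfolding d_def using e e1 e2 by auto
      obtain g where g: "a - d < g" "g < a" "g \<notin> A" using zd_gap_left[OF zl d(1)] by blast
      obtain h where h: "b < h" "h < b + d" "h \<notin> A" using zd_gap_right[OF cA zr d(1)] by blast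
      obtain y where y: "y \<in> A" "y \<notin> {a..b}" "g < y" "y < h" "\<not> good y"
        using bad[of "min (a - g) (h - b)"] g h by auto
      have "y \<notin> N"
      proof
        assume "y \<in> N"
        moreover have "y \<in> ball a e1 \<or> y \<in> ball b e2" using y g h d by (auto simp: dist_real_def)
        ultimately show False using e1(2) e2(2) y(2) by blast
      qed
      then obtain Q where Q: "clopen_in A Q" "y \<in> Q" "prime_set Q" using N_iff y(1) by blast
      obtain V where V: "clopen_in A V" "y \<in> V" "V \<subseteq> ball a e \<inter> {..<a} \<or> V \<subseteq> ball b e \<inter> {b<..}"
      proof (cases "y < a")
        case True
        then obtain k where k: "y < k" "k < a" "k \<notin> A" using zd_gap_left[OF zl, of "a - y"] by auto
        have "A \<inter> {g..k} \<subseteq> ball a e \<inter> {..<a}" using g k d by (auto simp: dist_real_def)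
        then show ?thesis using that[of "A \<inter> {g..k}"] clopen_in_gap2[OF cA g(3) k(3)] y k by auto
      next
        case False
        then have "b < y" using y(2) by auto
        then obtain k where k: "b < k" "k < y" "k \<notin> A" using zd_gap_right[OF cA zr, of "y - b"] by auto
        have "A \<inter> {k..h} \<subseteq> ball b e \<inter> {b<..}" using h k d by (auto simp: dist_real_def)
        then show ?thesis using that[of "A \<inter> {k..h}"] clopen_in_gap2[OF cA k(3) h(3)] y k by auto
      qed
      have "clopen_in Q (Q \<inter> V)"
        by (rule clopen_in_restrict[OF V(1) clopen_in_compact[OF Q(1)] clopen_in_subset[OF Q(1)]])
      then obtain C where C: "clopen_in Q C" "y \<in> C" "C \<subseteq> Q \<inter> V" "prime_set C"
        using prime_set_small[OF Q(3), of "Q \<inter> V" y] Q(2) V(2) by blast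
      have CA: "clopen_in A C" using clopen_in_trans[OF Q(1) C(1)] .
      have "V \<inter> {a..b} = {}" using V(3) by force
      then have "C \<inter> {a..b} = {}" using C(3) by blast
      then have "\<not> near2 A a b C" using y(5) CA C(2,4) unfolding good_def by blast
      moreover have "C \<subseteq> ball a e \<inter> {..<a} \<or> C \<subseteq> ball b e \<inter> {b<..}"
        using V(3) C(3) by blast
      ultimately show ?thesis using CA C(4) by blast
    qed
    \<comment> \<open>Well-founded induction. If \<open>C\<close> is not near both ends, symmetry
      makes it near neither, so small balls hold no copy of \<open>C\<close>. A bad prime set
      \<open>C'\<close> in such a ball is then strictly below \<open>C\<close> by totality, against
      the induction hypothesis.\<close>
    have near_all: "prime_set C \<longrightarrow> near2 A a b C" if "Wellfounded.accp strictly C" for C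
      using that
    proof (rule accp_induct, intro impI, rule_tac ccontr)
      fix C
      assume IH: "\<forall>C'. strictly C' C \<longrightarrow> prime_set C' \<longrightarrow> near2 A a b C'"
        and C: "prime_set C" "\<not> near2 A a b C"
      have "\<not> near (A \<inter> {..a}) a C" "\<not> near (A \<inter> {b..}) b C"
        using t_set_near_symmetric[OF tA s C(1) B nB] C(2) by blast+
      then obtain d1 d2 where d1: "d1 > 0"
        "\<And>D. clopen_in (A \<inter> {..a}) D \<Longrightarrow> D \<subseteq> ball a d1 - {a} \<Longrightarrow> \<not> C homeomorphic D"
        and d2: "d2 > 0"
        "\<And>D. clopen_in (A \<inter> {b..}) D \<Longrightarrow> D \<subseteq> ball b d2 - {b} \<Longrightarrow> \<not> C homeomorphic D"
        unfolding near_def by meson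
      have "min d1 d2 > 0" using d1 d2 by simp
      then obtain C' where C': "prime_set C'" "clopen_in A C'" "\<not> near2 A a b C'"
        "C' \<subseteq> ball a (min d1 d2) \<inter> {..<a} \<or> C' \<subseteq> ball b (min d1 d2) \<inter> {b<..}"
        using small by blast
      have "\<not> embeds C C'"
      proof
        assume "embeds C C'"
        then obtain D where D: "clopen_in C' D" "C homeomorphic D" unfolding embeds_def by blast
        have DA: "clopen_in A D" "D \<subseteq> C'" "D \<subseteq> A"
          using clopen_in_trans[OF C'(2) D(1)] clopen_in_subset D(1) by auto
        show False
          using C'(4)
        proof
          assume *: "C' \<subseteq> ball a (min d1 d2) \<inter> {..<a}"
          then have "D \<subseteq> A \<inter> {..a}" "D \<subseteq> ball a d1 - {a}" using DA by fastforce+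
          then show False using d1(2) clopen_in_mono[OF DA(1) cl(1)] D(2) by blast
        next
          assume *: "C' \<subseteq> ball b (min d1 d2) \<inter> {b<..}"
          then have "D \<subseteq> A \<inter> {b..}" "D \<subseteq> ball b d2 - {b}" using DA by fastforce+
          then show False using d2(2) clopen_in_mono[OF DA(1) cl(2)] D(2) by blast
        qed
      qed
      then have "strictly C' C" using prime_set_total[OF C'(1) C(1)] C'(1) unfolding strictly_def by blast
      then show False using IH C'(1,3) by blast
    qed
    obtain C where "prime_set C" "\<not> near2 A a b C" using small[OF zero_less_one] by blast
    then show False using near_all prime_set_accp by blast
  qed
  then obtain e where e: "e > 0" "\<And>y. y \<in> A \<Longrightarrow> y \<notin> {a..b} \<Longrightarrow> a - e < y \<Longrightarrow> y < b + e \<Longrightarrow> good y" by blast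
  obtain g where g: "a - e < g" "g < a" "g \<notin> A" using zd_gap_left[OF zl e(1)] by blast
  obtain h where h: "b < h" "h < b + e" "h \<notin> A" using zd_gap_right[OF cA zr e(1)] by blast
  \<comment> \<open>Between the gaps \<open>g\<close> and \<open>h\<close> all points off the
    interval are good, so \<open>U\<close> satisfies the clause \<open>step\<close>.\<close>
  define U where "U = A \<inter> {g..h}"
  have U: "clopen_in A U" "{a..b} \<subseteq> U"
    unfolding U_def using clopen_in_gap2[OF cA g(3) h(3)] abA g h by auto
  have "prime_set U"
  proof (rule prime_set.step)
    show "sided U a b" using sided_clopen[OF U s] .
    show "BB B" "near2 U a b B" using B near2_clopen[OF U nB ab(1)] by auto
    fix y assume y: "y \<in> U" "y \<notin> {a..b}"
    then have "good y" using e(2)[of y] g h unfolding U_def by auto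
    then obtain Q where Q: "clopen_in A Q" "y \<in> Q" "Q \<inter> {a..b} = {}" "prime_set Q" "near2 A a b Q"
      unfolding good_def by blast
    have "clopen_in Q (Q \<inter> U)"
      by (rule clopen_in_restrict[OF U(1) clopen_in_compact[OF Q(1)] clopen_in_subset[OF Q(1)]])
    then obtain C where C: "clopen_in Q C" "y \<in> C" "C \<subseteq> Q \<inter> U" "prime_set C"
      using prime_set_small[OF Q(4), of "Q \<inter> U" y] Q(2) y(1) by blast
    have "clopen_in U C"
      using clopen_in_mono[OF clopen_in_trans[OF Q(1) C(1)] clopen_in_compact[OF U(1)] clopen_in_subset[OF U(1)]] C(3)
      by blast
    moreover have "near2 U a b C"
      using near2_clopen[OF U near2_mono[OF Q(5) embeds_clopen_in[OF C(1)]] ab(1)] .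
    moreover have "C \<inter> {a..b} = {}" using C(3) Q(3) by blast
    ultimately show "\<exists>Q. clopen_in U Q \<and> y \<in> Q \<and> Q \<inter> {a..b} = {} \<and> prime_set Q \<and> near2 U a b Q"
      using C(2,4) by blast
  qed
  moreover have "a \<in> U" using U(2) ab(1) by auto
  ultimately show False using abN(2) N_iff U(1) by blast
qed

end

section \<open>Uniqueness of the dense patterns\<close>

text \<open>A countable order in which every colour of \<open>K\<close> is dense. Empty
  \<open>S\<close> or \<open>T\<close> covers the absence of end points, and finite sets instead of
  single bounds fit the finite stages of a back-and-forth argument.\<close>

definition dense_pattern :: "'c set \<Rightarrow> real set \<Rightarrow> (real \<Rightarrow> 'c) \<Rightarrow> bool" where
  "dense_pattern K X c \<longleftrightarrow> countable X \<and> X \<noteq> {} \<and> c ` X \<subseteq> K \<and>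
     (\<forall>S T k. finite S \<longrightarrow> finite T \<longrightarrow> S \<subseteq> X \<longrightarrow> T \<subseteq> X \<longrightarrow> (\<forall>s\<in>S. \<forall>t\<in>T. s < t) \<longrightarrow> k \<in> K \<longrightarrow>
        (\<exists>z\<in>X. c z = k \<and> (\<forall>s\<in>S. s < z) \<and> (\<forall>t\<in>T. z < t)))"

lemma dense_patternD:
  assumes "dense_pattern K X c" "finite S" "finite T" "S \<subseteq> X" "T \<subseteq> X" "\<forall>s\<in>S. \<forall>t\<in>T. s < t" "k \<in> K"
  shows "\<exists>z\<in>X. c z = k \<and> (\<forall>s\<in>S. s < z) \<and> (\<forall>t\<in>T. z < t)"
  using assms unfolding dense_pattern_def by simp

text \<open>The equivalence, applied in both orders of the two pairs, makes the relation
  single-valued and injective.\<close>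

definition partial_iso :: "real set \<Rightarrow> (real \<Rightarrow> 'c) \<Rightarrow> real set \<Rightarrow> (real \<Rightarrow> 'c) \<Rightarrow> (real \<times> real) set \<Rightarrow> bool" where
  "partial_iso X c Y d R \<longleftrightarrow> R \<subseteq> X \<times> Y \<and> (\<forall>(x, y)\<in>R. c x = d y) \<and>
     (\<forall>(x, y)\<in>R. \<forall>(x', y')\<in>R. x < x' \<longleftrightarrow> y < y')"

lemma partial_iso_converse: "partial_iso X c Y d R \<Longrightarrow> partial_iso Y d X c (R\<inverse>)"
  unfolding partial_iso_def by fastforce

text \<open>The partner of \<open>x\<close> must lie between the images of the smaller and of the
  larger points; \<open>dense_pattern\<close> supplies one in the right colour.\<close>

lemma partial_iso_extend:
  assumes "dense_pattern K X c" "dense_pattern K Y d" "partial_iso X c Y d R" "finite R" "x \<in> X"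
  shows "\<exists>y. partial_iso X c Y d (insert (x, y) R)"
proof (cases "x \<in> fst ` R")
  case True
  then obtain y where "(x, y) \<in> R" by auto
  then show ?thesis using assms(3) by (metis insert_absorb)
next
  case False
  define S where "S = snd ` {p \<in> R. fst p < x}"
  define T where "T = snd ` {p \<in> R. x < fst p}"
  have fin: "finite S" "finite T" "S \<subseteq> Y" "T \<subseteq> Y"
    using assms(3,4) unfolding S_def T_def partial_iso_def by auto
  have lt: "\<forall>s\<in>S. \<forall>t\<in>T. s < t"
    using assms(3) unfolding S_def T_def partial_iso_def by fastforce
  have "c x \<in> K" using assms(1,5) unfolding dense_pattern_def by blast
  from dense_patternD[OF assms(2) fin lt this]
  obtain y where y: "y \<in> Y" "d y = c x" "\<forall>s\<in>S. s < y" "\<forall>t\<in>T. y < t" by blast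
  have "(x < x' \<longleftrightarrow> y < y') \<and> (x' < x \<longleftrightarrow> y' < y)" if "(x', y') \<in> R" for x' y'
  proof -
    have "x' \<noteq> x" using False that by force
    then consider "x' < x" | "x < x'" by linarith
    then show ?thesis
    proof cases
      case 1
      then have "y' \<in> S" using that unfolding S_def by force
      then show ?thesis using y(3) 1 by auto
    next
      case 2
      then have "y' \<in> T" using that unfolding T_def by force
      then show ?thesis using y(4) 2 by auto
    qed
  qed
  then have "partial_iso X c Y d (insert (x, y) R)"
    using assms(3,5) y(1,2) unfolding partial_iso_def by auto
  then show ?thesis by blast
qed

text \<open>Cantor's back and forth for coloured orders: stage \<open>n\<close> adds the
  \<open>n\<close>-th elements of two enumerations, in which repetitions are harmless.\<close>

lemma dense_pattern_unique:
  assumes X: "dense_pattern K X c" and Y: "dense_pattern K Y d"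
  obtains \<sigma> where "bij_betw \<sigma> X Y" "\<And>x y. x \<in> X \<Longrightarrow> y \<in> X \<Longrightarrow> x < y \<Longrightarrow> \<sigma> x < \<sigma> y"
    "\<And>x. x \<in> X \<Longrightarrow> d (\<sigma> x) = c x"
proof -
  have cX: "countable X" "X \<noteq> {}" and cY: "countable Y" "Y \<noteq> {}"
    using X Y unfolding dense_pattern_def by auto
  let ?P = "\<lambda>(n::nat) R. finite R \<and> partial_iso X c Y d R"
  let ?Q = "\<lambda>(n::nat) R R'. R \<subseteq> R' \<and> from_nat_into X n \<in> fst ` R' \<and> from_nat_into Y n \<in> snd ` R'"
  have "\<exists>f. \<forall>n. ?P n (f n) \<and> ?Q n (f n) (f (Suc n))"
  proof (rule dependent_nat_choice)
    show "\<exists>R. ?P 0 R" by (intro exI[of _ "{}"]) (simp add: partial_iso_def)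
    fix R n assume R: "?P n R"
    have xX: "from_nat_into X n \<in> X" and yY: "from_nat_into Y n \<in> Y"
      by (rule from_nat_into[OF cX(2)], rule from_nat_into[OF cY(2)])
    obtain y where y: "partial_iso X c Y d (insert (from_nat_into X n, y) R)"
      using partial_iso_extend[OF X Y] R xX by blast
    let ?R = "insert (from_nat_into X n, y) R"
    have "finite (?R\<inverse>)" using R by simp
    then obtain x where "partial_iso Y d X c (insert (from_nat_into Y n, x) (?R\<inverse>))"
      using partial_iso_extend[OF Y X partial_iso_converse[OF y] _ yY] by blast
    then have "partial_iso X c Y d ((insert (from_nat_into Y n, x) (?R\<inverse>))\<inverse>)" by (rule partial_iso_converse)
    moreover have "(insert (from_nat_into Y n, x) (?R\<inverse>))\<inverse> = insert (x, from_nat_into Y n) ?R" by auto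
    ultimately show "\<exists>R'. ?P (Suc n) R' \<and> ?Q n R R'"
      using R by (intro exI[of _ "insert (x, from_nat_into Y n) ?R"]) auto
  qed
  then obtain f where f: "\<forall>n. ?P n (f n) \<and> ?Q n (f n) (f (Suc n))" by (rule exE)
  define R where "R = (\<Union>n. f n)"
  have mono: "f m \<subseteq> f n" if "m \<le> n" for m n using lift_Suc_mono_le[of f m n] f that by blast
  have iso: "p \<in> X \<times> Y \<and> q \<in> X \<times> Y \<and> c (fst p) = d (snd p) \<and> (fst p < fst q \<longleftrightarrow> snd p < snd q)"
    if pq: "p \<in> R" "q \<in> R" for p q
  proof -
    obtain m n where "p \<in> f m" "q \<in> f n" using pq unfolding R_def by blast
    then have "p \<in> f (max m n)" "q \<in> f (max m n)" using mono[of m "max m n"] mono[of n "max m n"] by auto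
    moreover have "partial_iso X c Y d (f (max m n))" using f by blast
    ultimately show ?thesis unfolding partial_iso_def by (cases p; cases q) fastforce
  qed
  have fstR: "fst ` R = X"
  proof
    show "fst ` R \<subseteq> X" using iso by fastforce
    show "X \<subseteq> fst ` R"
    proof
      fix x assume "x \<in> X"
      then obtain n where "x = from_nat_into X n" using from_nat_into_surj[OF cX(1)] by metis
      then have "x \<in> fst ` f (Suc n)" using f by blast
      then show "x \<in> fst ` R" unfolding R_def by blast
    qed
  qed
  have sndR: "snd ` R = Y"
  proof
    show "snd ` R \<subseteq> Y" using iso by fastforce
    show "Y \<subseteq> snd ` R"
    proof
      fix x assume "x \<in> Y"
      then obtain n where "x = from_nat_into Y n" using from_nat_into_surj[OF cY(1)] by metis
      then have "x \<in> snd ` f (Suc n)" using f by blast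
      then show "x \<in> snd ` R" unfolding R_def by blast
    qed
  qed
  define \<sigma> where "\<sigma> x = (SOME y. (x, y) \<in> R)" for x
  have s: "(x, \<sigma> x) \<in> R" if "x \<in> X" for x
  proof -
    have "\<exists>y. (x, y) \<in> R" using that fstR by force
    then show ?thesis unfolding \<sigma>_def by (rule someI_ex)
  qed
  have lt: "\<sigma> x < \<sigma> y" if "x \<in> X" "y \<in> X" "x < y" for x y
    using iso[OF s[OF that(1)] s[OF that(2)]] that(3) by simp
  have "inj_on \<sigma> X" by (rule inj_onI) (metis lt less_irrefl linorder_neqE)
  moreover have "\<sigma> ` X = Y"
  proof
    show "\<sigma> ` X \<subseteq> Y" using iso[OF s s] by auto
    show "Y \<subseteq> \<sigma> ` X"
    proof
      fix y assume "y \<in> Y"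
      then obtain x where x: "(x, y) \<in> R" using sndR by force
      then have "x \<in> X" using fstR by force
      then have "\<sigma> x = y" using iso[OF s x] iso[OF x s] by (metis fst_conv snd_conv less_irrefl linorder_neqE)
      then show "y \<in> \<sigma> ` X" using \<open>x \<in> X\<close> by blast
    qed
  qed
  ultimately show ?thesis using that[of \<sigma>] lt iso[OF s s] unfolding bij_betw_def by auto
qed

text \<open>Completion by suprema, as with Dedekind cuts. Density of \<open>W\<close> makes the
  extension injective, density of \<open>W'\<close> makes it surjective.\<close>

lemma dense_mono_extension:
  fixes m M m' M' :: real
  assumes m: "m < M" "m' < M'" and W: "W \<subseteq> {m..M}" "W' \<subseteq> {m'..M'}"
    and d: "\<And>x y. m \<le> x \<Longrightarrow> x < y \<Longrightarrow> y \<le> M \<Longrightarrow> \<exists>w\<in>W. x < w \<and> w < y"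
    and d': "\<And>x y. m' \<le> x \<Longrightarrow> x < y \<Longrightarrow> y \<le> M' \<Longrightarrow> \<exists>w\<in>W'. x < w \<and> w < y"
    and \<tau>: "\<tau> ` W = W'" "\<And>x y. x \<in> W \<Longrightarrow> y \<in> W \<Longrightarrow> x < y \<Longrightarrow> \<tau> x < \<tau> y"
  obtains h where "topemb {m..M} h" "h ` {m..M} = {m'..M'}" "\<And>w. w \<in> W \<Longrightarrow> h w = \<tau> w"
proof -
  \<comment> \<open>\<open>m'\<close> is inserted so that the set is nonempty even if no point of
    \<open>W\<close> lies below \<open>x\<close>.\<close>
  define V where "V x = insert m' (\<tau> ` {w \<in> W. w \<le> x})" for x
  define h where "h x = Sup (V x)" for x
  have tW: "m' \<le> \<tau> w" "\<tau> w \<le> M'" if "w \<in> W" for w using that \<tau>(1) W(2) by auto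
  have tle: "\<tau> v \<le> \<tau> w" if "v \<in> W" "w \<in> W" "v \<le> w" for v w using \<tau>(2)[of v w] that by (cases "v = w") auto
  have bdd: "bdd_above (V x)" and ne: "V x \<noteq> {}" for x
    unfolding V_def using tW m by (auto intro!: bdd_aboveI[of _ M'] simp: less_imp_le)
  have up: "\<tau> w \<le> h x" if "w \<in> W" "w \<le> x" for w x
    unfolding h_def using that by (intro cSup_upper[OF _ bdd]) (auto simp: V_def)
  have lo: "h x \<le> B" if "m' \<le> B" "\<And>w. w \<in> W \<Longrightarrow> w \<le> x \<Longrightarrow> \<tau> w \<le> B" for x B
    unfolding h_def using that by (intro cSup_least[OF ne]) (auto simp: V_def)
  have hm: "m' \<le> h x" for x unfolding h_def by (intro cSup_upper[OF _ bdd]) (auto simp: V_def)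
  have hM: "h x \<le> M'" for x using m tW by (intro lo) auto
  have hW: "h w = \<tau> w" if "w \<in> W" for w
  proof (rule antisym)
    show "h w \<le> \<tau> w" using tW[OF that] tle that by (intro lo) auto
  qed (use up that in auto)
  have mono: "h x < h y" if xy: "m \<le> x" "x < y" "y \<le> M" for x y
  proof -
    obtain w where w: "w \<in> W" "x < w" "w < y" using d[OF xy] by blast
    obtain w' where w': "w' \<in> W" "w < w'" "w' < y" using d[of w y] w xy by auto
    have "h x \<le> \<tau> w" using tW[OF w(1)] tle w by (intro lo) auto
    also have "\<dots> < \<tau> w'" using \<tau>(2) w w' by blast
    also have "\<dots> \<le> h y" using up w' by simp
    finally show ?thesis .
  qed
  have inj: "inj_on h {m..M}" 
    by (rule inj_onI) (metis atLeastAtMost_iff less_irrefl linorder_neqE mono)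
  have img: "h ` {m..M} = {m'..M'}"
  proof
    show "h ` {m..M} \<subseteq> {m'..M'}" using hm hM by auto
    show "{m'..M'} \<subseteq> h ` {m..M}"
    proof
      fix y assume y: "y \<in> {m'..M'}"
      \<comment> \<open>The preimage of \<open>y\<close> is a supremum as well, with
        \<open>m\<close> inserted for the same reason.\<close>
      define Z where "Z = insert m {w \<in> W. \<tau> w \<le> y}"
      have bZ: "bdd_above Z" unfolding Z_def using W(1) m by (auto intro!: bdd_aboveI[of _ M])
      define x where "x = Sup Z"
      have Zx: "z \<le> x" if "z \<in> Z" for z unfolding x_def using cSup_upper[OF that bZ] .
      have xZ: "x \<le> B" if "\<And>z. z \<in> Z \<Longrightarrow> z \<le> B" for B
        unfolding x_def using that by (intro cSup_least) (auto simp: Z_def)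
      have ZM: "z \<le> M" if "z \<in> Z" for z using that W(1) m unfolding Z_def by auto
      have x: "m \<le> x" "x \<le> M" using Zx[of m] xZ[OF ZM] unfolding Z_def by auto
      have "\<not> h x < y"
      proof
        assume "h x < y"
        then obtain w' where w': "w' \<in> W'" "h x < w'" "w' < y" using d'[of "h x" y] hm y by auto
        then obtain w where w: "w \<in> W" "\<tau> w = w'" using \<tau>(1) by blast
        then have "w \<le> x" using Zx w' unfolding Z_def by auto
        then show False using up[OF w(1)] w w' by fastforce
      qed
      moreover have "\<not> y < h x"
      proof
        assume "y < h x"
        then obtain w' where w': "w' \<in> W'" "y < w'" "w' < h x" using d'[of y "h x"] hM y by auto
        then obtain w where w: "w \<in> W" "\<tau> w = w'" using \<tau>(1) by blast
        have "x \<le> w"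
        proof (rule xZ)
          fix z assume "z \<in> Z"
          then consider "z = m" | "z \<in> W" "\<tau> z \<le> y" unfolding Z_def by blast
          then show "z \<le> w"
          proof cases
            case 1
            then show ?thesis using w(1) W(1) by auto
          next
            case 2
            then show ?thesis using tle[OF w(1) 2(1)] w w' by fastforce
          qed
        qed
        then have "h x \<le> \<tau> w" using tW[OF w(1)] tle w by (intro lo) auto
        then show False using w w' by simp
      qed
      ultimately have "h x = y" by simp
      then show "y \<in> h ` {m..M}" using x by auto
    qed
  qed
  have le: "h x \<le> h y" if "m \<le> x" "x \<le> y" "y \<le> M" for x y using mono[of x y] that by (cases "x = y") auto
  \<comment> \<open>Extension by translations makes the range the whole line, and a monotone map
    with open range is continuous.\<close>
  define H where "H x = (if x < m then x - m + m' else if x > M then x - M + M' else h x)" for x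
  have "H x \<le> H y" if "x \<le> y" for x y
    unfolding H_def using le[of x y] hm hM that m by (auto intro: order_trans[of _ m'] order_trans[of _ M'])
  moreover have "y \<in> range H" for y
  proof -
    consider "y < m'" | "y \<in> h ` {m..M}" | "y > M'" unfolding img by fastforce
    then show ?thesis
    proof cases
      case 1
      then show ?thesis by (intro image_eqI[of _ _ "y - m' + m"]) (auto simp: H_def)
    next
      case 2
      then show ?thesis by (auto simp: H_def image_iff not_less intro!: exI)
    next
      case 3
      then show ?thesis using m by (intro image_eqI[of _ _ "y - M' + M"]) (auto simp: H_def)
    qed
  qed
  then have "open (range H)" by (metis UNIV_eq_I open_UNIV)
  ultimately have "continuous_on UNIV H" by (intro continuous_onI_mono) auto
  then have "continuous_on {m..M} H" by (rule continuous_on_subset) simp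
  then have "continuous_on {m..M} h" by (rule continuous_on_eq) (simp add: H_def)
  then show ?thesis using that[of h] inj img hW unfolding topemb_def by blast
qed

lemma zd_no_interval:
  assumes "zd A p" "{a..b} \<subseteq> A" "p \<in> {a..b}" shows "a = b"
proof (rule ccontr)
  assume "a \<noteq> b"
  then have "(b - a) / 2 > 0" using assms(3) by auto
  then obtain U where U: "clopen_in A U" "p \<in> U" "U \<subseteq> ball p ((b - a) / 2)"
    using assms(1) unfolding zd_def by blast
  have "{a..b} \<subseteq> U" using interval_clopen_in[OF U(1) assms(2)] U(2) assms(3) by blast
  moreover have "a \<in> {a..b}" "b \<in> {a..b}" using assms(3) by auto
  ultimately have "a \<in> ball p ((b - a) / 2)" "b \<in> ball p ((b - a) / 2)" using U(3) by blast+
  then have "\<bar>p - a\<bar> < (b - a) / 2" "\<bar>p - b\<bar> < (b - a) / 2" by (simp_all only: mem_ball dist_real_def)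
  then have "p - a < (b - a) / 2" "- (p - b) < (b - a) / 2" unfolding abs_less_iff by blast+
  then show False by argo
qed

section \<open>Gaps and maximal intervals as cells of a compact set\<close>

definition gap_cell :: "real set \<Rightarrow> real \<Rightarrow> real \<Rightarrow> bool" where
  "gap_cell A l r \<longleftrightarrow> l < r \<and> l \<in> A \<and> r \<in> A \<and> {l<..<r} \<inter> A = {}"

definition interval_cell :: "real set \<Rightarrow> real \<Rightarrow> real \<Rightarrow> bool" where
  "interval_cell A l r \<longleftrightarrow> l < r \<and> {l..r} \<subseteq> A \<and> (\<forall>x<l. \<not> {x..l} \<subseteq> A) \<and> (\<forall>y>r. \<not> {r..y} \<subseteq> A)"

definition cell :: "real set \<Rightarrow> real \<Rightarrow> real \<Rightarrow> bool" where
  "cell A l r \<longleftrightarrow> gap_cell A l r \<or> interval_cell A l r"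

text \<open>A left end point determines its cell (\<open>cell_unique\<close>), so these points serve
  as an ordered index set for the cells.\<close>

definition ends :: "real set \<Rightarrow> real set" where
  "ends A = {l. \<exists>r. cell A l r}"

definition rt :: "real set \<Rightarrow> real \<Rightarrow> real" where
  "rt A l = (SOME r. cell A l r)"

definition filled :: "real set \<Rightarrow> real \<Rightarrow> bool" where
  "filled A l \<longleftrightarrow> interval_cell A l (rt A l)"

text \<open>The flag \<open>D\<close> tells whether nondegenerate intervals are dense or absent.\<close>

definition uniform :: "bool \<Rightarrow> real set \<Rightarrow> bool" where
  "uniform D A \<longleftrightarrow> compact A \<and> A \<noteq> {} \<and>
     (\<forall>p\<in>A. extreme A p \<longrightarrow> zd A p \<and> \<not> clopen_in A {p}) \<and>
     (if D then \<forall>C. clopen_in A C \<longrightarrow> C \<noteq> {} \<longrightarrow> (\<exists>u v. u < v \<and> {u..v} \<subseteq> C)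
      else \<forall>u v. u < v \<longrightarrow> \<not> {u..v} \<subseteq> A)"

lemma cell_less: "cell A l r \<Longrightarrow> l < r" and cell_mem: "cell A l r \<Longrightarrow> l \<in> A \<and> r \<in> A"
  unfolding cell_def gap_cell_def interval_cell_def by auto

lemma gap_not_interval: "gap_cell A l r \<Longrightarrow> l < r' \<Longrightarrow> \<not> {l..r'} \<subseteq> A"
proof
  assume a: "gap_cell A l r" "l < r'" "{l..r'} \<subseteq> A"
  define w where "w = (l + min r r') / 2"
  have "l < w" "w < r" "w \<le> r'" using a unfolding w_def gap_cell_def by auto
  then have "w \<in> {l<..<r}" "w \<in> A" using a(3) by auto
  then show False using a(1) unfolding gap_cell_def by blast
qed

lemma cell_unique:
  assumes "cell A l r" "cell A l r'" shows "r = r'"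
proof -
  have *: "\<not> r < r'" if "cell A l r" "cell A l r'" for r r'
  proof
    assume lt: "r < r'"
    have lr: "l < r" "l < r'" "r \<in> A" using cell_less cell_mem that by blast+
    show False
    proof (cases "gap_cell A l r'")
      case True
      then show False using lr lt unfolding gap_cell_def by auto
    next
      case False
      then have i': "interval_cell A l r'" using that unfolding cell_def by blast
      then have "{l..r'} \<subseteq> A" unfolding interval_cell_def by blast
      then have "\<not> gap_cell A l r" using gap_not_interval lr by blast
      then have "\<not> {r..r'} \<subseteq> A" using that lt unfolding cell_def interval_cell_def by blast
      then show False using \<open>{l..r'} \<subseteq> A\<close> lr by auto
    qed
  qed
  show ?thesis using *[OF assms] *[OF assms(2,1)] by simp
qed

lemma rt_eq: "cell A l r \<Longrightarrow> rt A l = r"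
  unfolding rt_def using cell_unique by (metis someI)

lemma rt_cell: "l \<in> ends A \<Longrightarrow> cell A l (rt A l)"
  unfolding ends_def using rt_eq by auto

lemma filled_iff: "cell A l r \<Longrightarrow> filled A l \<longleftrightarrow> interval_cell A l r"
  unfolding filled_def using rt_eq by simp

text \<open>Cutting at the midpoint of the gap gives a clopen part with least point
  \<open>r\<close>.\<close>

lemma extreme_after_gap:
  assumes "compact A" "r \<in> A" "l < r" "{l<..<r} \<inter> A = {}" shows "extreme A r"
proof -
  define g where "g = (l + r) / 2"
  have g: "l < g" "g < r" using assms(3) unfolding g_def by auto
  then have "g \<notin> A" using assms(4) by auto
  moreover have "\<forall>x\<in>A \<inter> {g..}. r \<le> x"
  proof
    fix x assume "x \<in> A \<inter> {g..}"
    then show "r \<le> x" using assms(4) g by (metis IntD1 IntD2 IntI atLeast_iff empty_iff greaterThanLessThan_iff linorder_not_le order_less_le_trans)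
  qed
  moreover have "r \<in> A \<inter> {g..}" using assms(2) g by simp
  ultimately show ?thesis using clopen_in_gap(1)[OF assms(1)] unfolding extreme_def by blast
qed

lemma extreme_before_gap:
  assumes "compact A" "l \<in> A" "l < r" "{l<..<r} \<inter> A = {}" shows "extreme A l"
proof -
  define g where "g = (l + r) / 2"
  have g: "l < g" "g < r" using assms(3) unfolding g_def by auto
  then have "g \<notin> A" using assms(4) by auto
  moreover have "\<forall>x\<in>A \<inter> {..g}. x \<le> l"
  proof
    fix x assume "x \<in> A \<inter> {..g}"
    then show "x \<le> l" using assms(4) g by (metis IntD1 IntD2 IntI atMost_iff empty_iff greaterThanLessThan_iff linorder_not_le order_le_less_trans)
  qed
  moreover have "l \<in> A \<inter> {..g}" using assms(2) g by simp
  ultimately show ?thesis using clopen_in_gap(2)[OF assms(1)] unfolding extreme_def by blast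
qed

lemma isolated_between_gaps:
  assumes "compact A" "p \<in> A" "l < p" "p < r" "{l<..<p} \<inter> A = {}" "{p<..<r} \<inter> A = {}"
  shows "clopen_in A {p}"
proof -
  define g where "g = (l + p) / 2"
  define h where "h = (p + r) / 2"
  have gh: "l < g" "g < p" "p < h" "h < r" using assms unfolding g_def h_def by auto
  then have "g \<notin> A" "h \<notin> A" using assms by auto
  moreover have "A \<inter> {g..h} = {p}"
  proof
    show "A \<inter> {g..h} \<subseteq> {p}"
    proof
      fix x assume x: "x \<in> A \<inter> {g..h}"
      then have "x \<notin> {l<..<p}" "x \<notin> {p<..<r}" using assms by auto
      then show "x \<in> {p}" using x gh by auto
    qed
  qed (use gh assms in auto)
  ultimately show ?thesis using clopen_in_gap2[OF assms(1), of g h] by simp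
qed

text \<open>No cell begins at such a point. Between it and a later \<open>open_left\<close> point of
  a uniform set, cells of every available kind are found (\<open>cell_between\<close>).\<close>

definition open_right :: "real set \<Rightarrow> real \<Rightarrow> bool" where
  "open_right A u \<longleftrightarrow> u \<in> A \<and> (\<forall>w>u. {u<..<w} \<inter> A \<noteq> {} \<and> \<not> {u..w} \<subseteq> A)"

definition open_left :: "real set \<Rightarrow> real \<Rightarrow> bool" where
  "open_left A u \<longleftrightarrow> u \<in> A \<and> (\<forall>w<u. {w<..<u} \<inter> A \<noteq> {} \<and> \<not> {w..u} \<subseteq> A)"

lemma uniform_extreme:
  assumes "uniform D A" "p \<in> A" "extreme A p"
  shows "zd A p" "\<not> clopen_in A {p}" "\<And>a b. {a..b} \<subseteq> A \<Longrightarrow> p \<in> {a..b} \<Longrightarrow> a = b"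
  using assms zd_no_interval unfolding uniform_def by blast+

text \<open>Two adjacent gaps would isolate \<open>r\<close>, and a gap next to an interval would
  put the extreme point \<open>r\<close> on an interval; \<open>uniform\<close> excludes both. Two
  adjacent intervals contradict maximality.\<close>

lemma open_right_rt:
  assumes u: "uniform D A" and c: "cell A l r" shows "open_right A r"
  unfolding open_right_def
proof (intro conjI allI impI)
  have cA: "compact A" using u unfolding uniform_def by blast
  have lr: "l < r" "l \<in> A" "r \<in> A" using cell_less[OF c] cell_mem[OF c] by auto
  then show "r \<in> A" by simp
  fix w assume w: "r < w"
  show "{r<..<w} \<inter> A \<noteq> {}"
  proof
    assume e: "{r<..<w} \<inter> A = {}"
    then have ex: "extreme A r" using extreme_before_gap[OF cA lr(3) w] by blast
    have "\<not> {l..r} \<subseteq> A" using uniform_extreme(3)[OF u lr(3) ex, of l r] lr by auto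
    then have "{l<..<r} \<inter> A = {}" using c unfolding cell_def gap_cell_def interval_cell_def by blast
    then show False using isolated_between_gaps[OF cA lr(3,1) w _ e] uniform_extreme(2)[OF u lr(3) ex] by blast
  qed
  show "\<not> {r..w} \<subseteq> A"
  proof
    assume i: "{r..w} \<subseteq> A"
    then have g: "gap_cell A l r" using c w unfolding cell_def interval_cell_def by blast
    then have "extreme A r" using extreme_after_gap[OF cA lr(3,1)] unfolding gap_cell_def by blast
    then show False using uniform_extreme(3)[OF u lr(3) _ i] w by auto
  qed
qed

lemma open_left_end:
  assumes u: "uniform D A" and c: "cell A l r" shows "open_left A l"
  unfolding open_left_def
proof (intro conjI allI impI)
  have cA: "compact A" using u unfolding uniform_def by blast
  have lr: "l < r" "l \<in> A" "r \<in> A" using cell_less[OF c] cell_mem[OF c] by auto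
  then show "l \<in> A" by simp
  fix w assume w: "w < l"
  show "{w<..<l} \<inter> A \<noteq> {}"
  proof
    assume e: "{w<..<l} \<inter> A = {}"
    then have ex: "extreme A l" using extreme_after_gap[OF cA lr(2) w] by blast
    have "\<not> {l..r} \<subseteq> A" using uniform_extreme(3)[OF u lr(2) ex, of l r] lr by auto
    then have "{l<..<r} \<inter> A = {}" using c unfolding cell_def gap_cell_def interval_cell_def by blast
    then show False using isolated_between_gaps[OF cA lr(2) w lr(1) e] uniform_extreme(2)[OF u lr(2) ex] by blast
  qed
  show "\<not> {w..l} \<subseteq> A"
  proof
    assume i: "{w..l} \<subseteq> A"
    then have g: "gap_cell A l r" using c w unfolding cell_def interval_cell_def by blast
    then have "extreme A l" using extreme_before_gap[OF cA lr(2,1)] unfolding gap_cell_def by blast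
    then show False using uniform_extreme(3)[OF u lr(2) _ i] w by auto
  qed
qed

lemma open_right_Min:
  assumes u: "uniform D A" and m: "m \<in> A" "\<And>x. x \<in> A \<Longrightarrow> m \<le> x" shows "open_right A m"
  unfolding open_right_def
proof (intro conjI allI impI)
  have cA: "compact A" using u unfolding uniform_def by blast
  have ex: "extreme A m" using clopen_in_self[OF cA] m unfolding extreme_def by blast
  fix w assume w: "m < w"
  have "{m - 1<..<m} \<inter> A = {}" using m(2) by fastforce
  then show "{m<..<w} \<inter> A \<noteq> {}"
    using isolated_between_gaps[OF cA m(1) _ w] uniform_extreme(2)[OF u m(1) ex] by force
  show "\<not> {m..w} \<subseteq> A" using uniform_extreme(3)[OF u m(1) ex, of m w] w by auto
qed (rule m)

lemma open_left_Max:
  assumes u: "uniform D A" and m: "m \<in> A" "\<And>x. x \<in> A \<Longrightarrow> x \<le> m" shows "open_left A m"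
  unfolding open_left_def
proof (intro conjI allI impI)
  have cA: "compact A" using u unfolding uniform_def by blast
  have ex: "extreme A m" using clopen_in_self[OF cA] m unfolding extreme_def by blast
  fix w assume w: "w < m"
  have "{m<..<m + 1} \<inter> A = {}" using m(2) by fastforce
  then show "{w<..<m} \<inter> A \<noteq> {}"
    using isolated_between_gaps[OF cA m(1) w, of "m + 1"] uniform_extreme(2)[OF u m(1) ex] by force
  show "\<not> {w..m} \<subseteq> A" using uniform_extreme(3)[OF u m(1) ex, of w m] w by auto
qed (rule m)

lemma gap_cell_around:
  assumes "compact A" "g \<notin> A" "x \<in> A" "x < g" "y \<in> A" "g < y"
  obtains l r where "gap_cell A l r" "x \<le> l" "l < g" "g < r" "r \<le> y"
proof -
  have "compact (A \<inter> {..g})" "A \<inter> {..g} \<noteq> {}" using assms by (auto intro: compact_Int_closed)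
  then obtain l where l: "l \<in> A \<inter> {..g}" "\<forall>z\<in>A \<inter> {..g}. z \<le> l" using compact_attains_sup by blast
  have "compact (A \<inter> {g..})" "A \<inter> {g..} \<noteq> {}" using assms by (auto intro: compact_Int_closed)
  then obtain r where r: "r \<in> A \<inter> {g..}" "\<forall>z\<in>A \<inter> {g..}. r \<le> z" using compact_attains_inf by blast
  have lt: "l < g" "g < r" using l(1) r(1) assms(2) by (auto simp: le_less)
  have "z \<notin> A" if "z \<in> {l<..<r}" for z
  proof
    assume "z \<in> A"
    then have "z \<le> l \<or> r \<le> z" using l(2) r(2) by (cases "z \<le> g") auto
    then show False using that by auto
  qed
  then have "gap_cell A l r" unfolding gap_cell_def using l(1) r(1) lt by auto
  moreover have "x \<le> l" "r \<le> y" using l(2) r(2) assms by auto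
  ultimately show ?thesis using that lt by blast
qed

lemma gap_cell_between:
  assumes "compact A" "open_right A u" "open_left A v" "u < v"
  obtains l r where "gap_cell A l r" "u < l" "r < v"
proof -
  have "\<not> {u..v} \<subseteq> A" using assms unfolding open_right_def by blast
  then obtain g where "u \<le> g" "g \<le> v" "g \<notin> A" by (meson atLeastAtMost_iff subsetI)
  moreover then have "u < g" "g < v" using assms unfolding open_right_def open_left_def by (metis order_le_less)+
  ultimately have g: "u < g" "g < v" "g \<notin> A" by auto
  then have "{u<..<g} \<inter> A \<noteq> {}" "{g<..<v} \<inter> A \<noteq> {}" using assms(2,3) unfolding open_right_def open_left_def by auto
  then obtain x y where xy: "x \<in> A" "u < x" "x < g" "y \<in> A" "g < y" "y < v" by auto
  from gap_cell_around[OF assms(1) g(3) xy(1,3,4,5)]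
  obtain l r where lr: "gap_cell A l r" "x \<le> l" "r \<le> y" by blast
  show ?thesis using that[OF lr(1)] lr(2,3) xy(2,6) by simp
qed

lemma interval_cell_around:
  assumes "compact A" "a < b" "{a..b} \<subseteq> A"
  obtains l r where "interval_cell A l r" "l \<le> a" "b \<le> r"
proof -
  define S where "S = connected_component_set A a"
  have aA: "a \<in> A" using assms by auto
  have "closed S" unfolding S_def using assms(1) by (intro closed_connected_component compact_imp_closed)
  moreover have SA: "S \<subseteq> A" unfolding S_def by (rule connected_component_subset)
  ultimately have "compact S" using compact_Int_closed[OF assms(1)] by (metis inf.absorb2)
  moreover have "connected S" unfolding S_def by simp
  ultimately obtain l r where S: "S = {l..r}" using connected_compact_interval_1 by blast
  have mx: "T \<subseteq> S" if T: "connected T" "T \<subseteq> A" "T \<inter> S \<noteq> {}" for T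
  proof -
    obtain t where t: "t \<in> T" "t \<in> S" using T(3) by blast
    then have "connected_component_set A t = S" unfolding S_def using connected_component_eq by metis
    then show ?thesis using connected_component_maximal[OF t(1) T(1,2)] by simp
  qed
  have "a \<in> S" unfolding S_def using aA by simp
  moreover have "a \<in> {a..b}" using assms(2) by simp
  ultimately have "{a..b} \<subseteq> S" using mx[OF connected_Icc assms(3)] by blast
  moreover have "b \<in> {a..b}" using assms(2) by simp
  ultimately have ab: "l \<le> a" "b \<le> r" using S \<open>a \<in> S\<close> by auto
  have "interval_cell A l r"
    unfolding interval_cell_def
  proof (intro conjI allI impI)
    show "l < r" using ab assms(2) by simp
    show "{l..r} \<subseteq> A" using S SA by simp
    have lS: "l \<in> S" "r \<in> S" using S ab assms(2) by auto
    show "\<not> {x..l} \<subseteq> A" if "x < l" for x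
    proof
      assume "{x..l} \<subseteq> A"
      moreover have "l \<in> {x..l}" "x \<in> {x..l}" using that by auto
      ultimately have "x \<in> S" using mx[OF connected_Icc, of x l] lS by blast
      then show False using S that by simp
    qed
    show "\<not> {r..y} \<subseteq> A" if "r < y" for y
    proof
      assume "{r..y} \<subseteq> A"
      moreover have "r \<in> {r..y}" "y \<in> {r..y}" using that by auto
      ultimately have "y \<in> S" using mx[OF connected_Icc, of r y] lS by blast
      then show False using S that by simp
    qed
  qed
  then show ?thesis using that ab by blast
qed

text \<open>A gap is found first. Its right end is zero-dimensional, so a small clopen set just
  above the gap contains an interval, and the maximal interval around it stays inside that clopen
  set.\<close>

lemma interval_cell_between:
  assumes u: "uniform True A" and "open_right A u" "open_left A v" "u < v"
  obtains l r where "interval_cell A l r" "u < l" "r < v"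
proof -
  have cA: "compact A" using u unfolding uniform_def by blast
  obtain l r where lr: "gap_cell A l r" "u < l" "r < v" using gap_cell_between[OF cA assms(2-4)] by blast
  have lr': "l < r" "r \<in> A" "{l<..<r} \<inter> A = {}" using lr(1) unfolding gap_cell_def by auto
  then have "extreme A r" using extreme_after_gap[OF cA] by blast
  then have "zd A r" using uniform_extreme(1)[OF u lr'(2)] by blast
  moreover have "v - r > 0" using lr by simp
  ultimately obtain W where W: "clopen_in A W" "r \<in> W" "W \<subseteq> ball r (v - r)" unfolding zd_def by blast
  define g where "g = (l + r) / 2"
  have g: "l < g" "g < r" using lr'(1) unfolding g_def by auto
  then have "g \<notin> A" using lr'(3) by auto
  then have C: "clopen_in A (W \<inter> (A \<inter> {g..}))" using clopen_in_Int[OF W(1)] clopen_in_gap(1)[OF cA] by blast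
  moreover have "r \<in> W \<inter> (A \<inter> {g..})" using W(2) lr'(2) g by simp
  ultimately obtain a b where ab: "a < b" "{a..b} \<subseteq> W \<inter> (A \<inter> {g..})" using u unfolding uniform_def by (metis empty_iff)
  then have "{a..b} \<subseteq> A" by blast
  then obtain c d where cd: "interval_cell A c d" "c \<le> a" "b \<le> d" using interval_cell_around[OF cA ab(1)] by blast
  have "{c..d} \<inter> (W \<inter> (A \<inter> {g..})) \<noteq> {}"
  proof -
    have "a \<in> {a..b}" "a \<in> {c..d}" using ab(1) cd by auto
    then show ?thesis using ab(2) by blast
  qed
  then have sub: "{c..d} \<subseteq> W \<inter> (A \<inter> {g..})"
    using interval_clopen_in[OF C] cd(1) unfolding interval_cell_def by blast
  have "c < d" using cd ab by simp
  then have "c \<in> {c..d}" "d \<in> {c..d}" by auto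
  then have "c \<in> {g..}" "d \<in> ball r (v - r)" using sub W(3) by blast+
  then have "u < c" "d < v" using lr(2) g by (auto simp: dist_real_def)
  then show ?thesis using that cd(1) by blast
qed

lemma cell_between:
  assumes u: "uniform D A" and "open_right A a" "open_left A b" "a < b" "k \<in> {False, D}"
  obtains l where "l \<in> ends A" "filled A l = k" "a < l" "rt A l < b"
proof (cases k)
  case True
  then have "uniform True A" using assms by auto
  from interval_cell_between[OF this assms(2-4)]
  obtain l r where lr: "interval_cell A l r" "a < l" "r < b" by blast
  then have c: "cell A l r" unfolding cell_def by blast
  then show ?thesis using that[of l] lr True rt_eq[OF c] filled_iff[OF c] unfolding ends_def by auto
next
  case False
  have "compact A" using u unfolding uniform_def by blast
  from gap_cell_between[OF this assms(2-4)]
  obtain l r where lr: "gap_cell A l r" "a < l" "r < b" by blast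
  then have c: "cell A l r" unfolding cell_def by blast
  have "\<not> interval_cell A l r"
    using gap_not_interval[OF lr(1), of r] lr(1) unfolding gap_cell_def interval_cell_def by blast
  then show ?thesis using that[of l] lr False rt_eq[OF c] filled_iff[OF c] c unfolding ends_def by auto
qed

text \<open>Cells do not overlap, and they do not touch either, because no cell begins at the right
  end of another one.\<close>

lemma cells_ordered:
  assumes u: "uniform D A" and c: "cell A l r" "cell A l' r'" "l < l'" shows "r < l'"
proof (rule ccontr)
  assume "\<not> r < l'"
  then have le: "l' \<le> r" by simp
  have l': "l' \<in> A" "l' < r'" using cell_mem[OF c(2)] cell_less[OF c(2)] by auto
  show False
  proof (cases "l' = r")
    case True
    show False
      using open_right_rt[OF u c(1)] c(2) l' True unfolding open_right_def cell_def gap_cell_def interval_cell_def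
      by blast
  next
    case False
    then have lt: "l' < r" using le by simp
    show False
    proof (cases "gap_cell A l r")
      case True
      then show False using lt c(3) l' unfolding gap_cell_def by auto
    next
      case False
      then have "{l..r} \<subseteq> A" using c(1) unfolding cell_def interval_cell_def by blast
      then have "{l..l'} \<subseteq> A" using lt by auto
      then show False using open_left_end[OF u c(2)] c(3) unfolding open_left_def by blast
    qed
  qed
qed

text \<open>There is room for a cell of each kind between the right end of one cell and the left end
  of a later one. The least and greatest points of \<open>A\<close> take over when one of the finite
  sets is empty.\<close>

lemma uniform_dense_pattern:
  assumes u: "uniform D A" shows "dense_pattern {False, D} (ends A) (filled A)"
proof -
  have cA: "compact A" "A \<noteq> {}" using u unfolding uniform_def by auto
  obtain m where m: "m \<in> A" "\<forall>x\<in>A. m \<le> x" using compact_attains_inf[OF cA] by blast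
  obtain M where M: "M \<in> A" "\<forall>x\<in>A. x \<le> M" using compact_attains_sup[OF cA] by blast
  have om: "open_right A m" using open_right_Min[OF u m(1)] m(2) by blast
  have oM: "open_left A M" using open_left_Max[OF u M(1)] M(2) by blast
  have "{m<..<m + 1} \<inter> A \<noteq> {}" using om unfolding open_right_def by (meson less_add_one)
  then have mM: "m < M" using M(2) by force
  have eta: "\<exists>z\<in>ends A. filled A z = k \<and> (\<forall>s\<in>S. s < z) \<and> (\<forall>t\<in>T. z < t)"
    if ST: "finite S" "finite T" "S \<subseteq> ends A" "T \<subseteq> ends A" "\<forall>s\<in>S. \<forall>t\<in>T. s < t" and k: "k \<in> {False, D}"
    for S T k
  proof -
    define a where "a = (if S = {} then m else rt A (Max S))"
    define b where "b = (if T = {} then M else Min T)"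
    have S: "Max S \<in> ends A" "\<And>s. s \<in> S \<Longrightarrow> s \<le> Max S" if "S \<noteq> {}"
      using Max_in[OF ST(1) that] Max_ge[OF ST(1)] ST(3) by blast+
    have T: "Min T \<in> ends A" "\<And>s. s \<in> T \<Longrightarrow> Min T \<le> s" if "T \<noteq> {}"
      using Min_in[OF ST(2) that] Min_le[OF ST(2)] ST(4) by blast+
    have oa: "open_right A a" unfolding a_def using om open_right_rt[OF u rt_cell] S by auto
    have ob: "open_left A b" unfolding b_def using oM open_left_end[OF u rt_cell] T by auto
    have "a < b"
    proof (cases "S = {} \<or> T = {}")
      case True
      have 1: "m \<le> b" "a \<le> M" using oa ob m M unfolding open_right_def open_left_def by auto
      have "m < b" if "T \<noteq> {}"
      proof -
        \<comment> \<open>No cell begins at \<open>m\<close>, which is \<open>open_right\<close>,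
          whereas \<open>b\<close> is the left end of a cell.\<close>
        have "m \<noteq> b" using rt_cell[OF T(1)[OF that]] om ob that mM unfolding b_def
          using cell_less[OF rt_cell[OF T(1)[OF that]]] open_left_def open_right_def
          by (metis (no_types, lifting) atLeastAtMost_iff cell_def gap_cell_def interval_cell_def)
        then show ?thesis using 1 by simp
      qed
      moreover have "a < M" if "S \<noteq> {}"
      proof -
        have "{a<..<a + 1} \<inter> A \<noteq> {}" using oa unfolding open_right_def by (meson less_add_one)
        then show ?thesis using M(2) by force
      qed
      ultimately show ?thesis using True mM unfolding a_def b_def by auto
    next
      case False
      then have "Max S < Min T" using ST by auto
      then show ?thesis
        using cells_ordered[OF u rt_cell[OF S(1)] rt_cell[OF T(1)]] False unfolding a_def b_def by simp
    qed
    then obtain l where l: "l \<in> ends A" "filled A l = k" "a < l" "rt A l < b"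
      using cell_between[OF u oa ob _ k] by blast
    have "s < l" if "s \<in> S" for s
    proof -
      have ne: "S \<noteq> {}" using that by blast
      then have "s \<le> Max S" "Max S < rt A (Max S)" "rt A (Max S) < l"
        using S(2)[OF ne that] cell_less[OF rt_cell[OF S(1)[OF ne]]] l(3) unfolding a_def by auto
      then show ?thesis by linarith
    qed
    moreover have "l < t" if "t \<in> T" for t
    proof -
      have ne: "T \<noteq> {}" using that by blast
      then have "Min T \<le> t" "l < rt A l" "rt A l < Min T"
        using T(2)[OF ne that] cell_less[OF rt_cell[OF l(1)]] l(4) unfolding b_def by auto
      then show ?thesis by linarith
    qed
    ultimately show ?thesis using l by blast
  qed
  have "ends A \<noteq> {}" using eta[of "{}" "{}" False] by auto
  moreover have "filled A ` ends A \<subseteq> {False, D}"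
  proof
    fix k assume "k \<in> filled A ` ends A"
    then obtain l where l: "l \<in> ends A" "k = filled A l" by blast
    have "D" if "interval_cell A l (rt A l)"
      using that u unfolding uniform_def interval_cell_def by metis
    then show "k \<in> {False, D}" using l unfolding filled_def by auto
  qed
  moreover have "countable (ends A)"
  proof -
    \<comment> \<open>Cells are disjoint, so a rational inside a cell determines it.\<close>
    have "ends A \<subseteq> (\<lambda>q. THE l. l \<in> ends A \<and> l < q \<and> q < rt A l) ` \<rat>"
    proof
      fix l assume l: "l \<in> ends A"
      obtain q where q: "q \<in> \<rat>" "l < q" "q < rt A l" using Rats_dense_in_real[OF cell_less[OF rt_cell[OF l]]] by blast
      have "(THE l. l \<in> ends A \<and> l < q \<and> q < rt A l) = l"
      proof (rule the_equality)
        fix l' assume l': "l' \<in> ends A \<and> l' < q \<and> q < rt A l'"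
        show "l' = l"
          using cells_ordered[OF u rt_cell rt_cell, of l l'] cells_ordered[OF u rt_cell rt_cell, of l' l] l l' q
          by (metis less_asym linorder_neqE less_trans)
      qed (use l q in blast)
      then show "l \<in> (\<lambda>q. THE l. l \<in> ends A \<and> l < q \<and> q < rt A l) ` \<rat>" using q(1) by (intro image_eqI[of _ _ q]) simp_all
    qed
    then show ?thesis by (rule countable_subset[OF _ countable_image[OF countable_rat]])
  qed
  ultimately show ?thesis unfolding dense_pattern_def using eta by simp
qed

text \<open>Dense in the hull of \<open>A\<close> (\<open>uniform_hull\<close>), so a monotone map
  given on the open cells determines the homeomorphism of the hulls.\<close>

definition cell_union :: "real set \<Rightarrow> real set" where
  "cell_union A = (\<Union>l\<in>ends A. {l<..<rt A l})"

lemma uniform_hull: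
  assumes u: "uniform D A"
  obtains m M where "m < M" "cell_union A \<subseteq> {m..M}"
    "A = {m..M} - (\<Union>l\<in>{l\<in>ends A. \<not> filled A l}. {l<..<rt A l})"
    "\<forall>x y. m \<le> x \<and> x < y \<and> y \<le> M \<longrightarrow> (\<exists>w\<in>cell_union A. x < w \<and> w < y)"
proof -
  have cA: "compact A" "A \<noteq> {}" using u unfolding uniform_def by auto
  obtain m where m: "m \<in> A" "\<forall>x\<in>A. m \<le> x" using compact_attains_inf[OF cA] by blast
  obtain M where M: "M \<in> A" "\<forall>x\<in>A. x \<le> M" using compact_attains_sup[OF cA] by blast
  have om: "open_right A m" using open_right_Min[OF u m(1)] m(2) by blast
  have "{m<..<m + 1} \<inter> A \<noteq> {}" using om unfolding open_right_def by (meson less_add_one)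
  then have mM: "m < M" using M(2) by force
  have sub: "cell_union A \<subseteq> {m..M}"
  proof
    fix x assume "x \<in> cell_union A"
    then obtain l where l: "l \<in> ends A" "l < x" "x < rt A l" unfolding cell_union_def by auto
    then have "m \<le> l" "rt A l \<le> M" using cell_mem[OF rt_cell[OF l(1)]] m M by auto
    then show "x \<in> {m..M}" using l by simp
  qed
  have gap: "\<exists>l\<in>ends A. \<not> filled A l \<and> l < x \<and> x < rt A l" if x: "x \<notin> A" "m \<le> x" "x \<le> M" for x
  proof -
    have "m < x" "x < M" using x m(1) M(1) by (auto simp: le_less)
    then obtain l r where lr: "gap_cell A l r" "l < x" "x < r"
      using gap_cell_around[OF cA(1) x(1) m(1) _ M(1)] by blast
    then have c: "cell A l r" unfolding cell_def by blast
    have "\<not> interval_cell A l r"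
      using gap_not_interval[OF lr(1), of r] lr(1) unfolding gap_cell_def interval_cell_def by blast
    then show ?thesis
      using c lr rt_eq[OF c] filled_iff[OF c] unfolding ends_def by auto
  qed
  have notA: "x \<notin> A" if l: "l \<in> ends A" "\<not> filled A l" "l < x" "x < rt A l" for l x
  proof -
    have "gap_cell A l (rt A l)" using rt_cell[OF l(1)] l(2) unfolding cell_def filled_def by blast
    then show ?thesis using l unfolding gap_cell_def by auto
  qed
  have A_eq: "A = {m..M} - (\<Union>l\<in>{l\<in>ends A. \<not> filled A l}. {l<..<rt A l})"
  proof
    show "A \<subseteq> {m..M} - (\<Union>l\<in>{l\<in>ends A. \<not> filled A l}. {l<..<rt A l})"
      using m(2) M(2) notA by auto
    show "{m..M} - (\<Union>l\<in>{l\<in>ends A. \<not> filled A l}. {l<..<rt A l}) \<subseteq> A"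
      using gap by fastforce
  qed
  have "\<exists>w\<in>cell_union A. x < w \<and> w < y" if xy: "m \<le> x" "x < y" "y \<le> M" for x y
  proof (cases "{x<..<y} \<subseteq> A")
    case False
    then obtain z where z: "x < z" "z < y" "z \<notin> A" by (meson greaterThanLessThan_iff subsetI)
    then obtain l where "l \<in> ends A" "l < z" "z < rt A l" using gap[of z] xy by auto
    then have "z \<in> cell_union A" unfolding cell_union_def by auto
    then show ?thesis using z by blast
  next
    case True
    define a where "a = (2 * x + y) / 3"
    define b where "b = (x + 2 * y) / 3"
    have ab: "x < a" "a < b" "b < y" using xy unfolding a_def b_def by auto
    then have "{a..b} \<subseteq> A" using True by auto
    then obtain l r where lr: "interval_cell A l r" "l \<le> a" "b \<le> r" using interval_cell_around[OF cA(1) ab(2)] by blast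
    then have c: "cell A l r" unfolding cell_def by blast
    then have "(a + b) / 2 \<in> {l<..<rt A l}" using lr ab rt_eq[OF c] by auto
    then have "(a + b) / 2 \<in> cell_union A" using c unfolding cell_union_def ends_def by auto
    then show ?thesis using ab by (intro bexI[of _ "(a + b) / 2"]) auto
  qed
  then show ?thesis using that[OF mM sub A_eq] by blast
qed

text \<open>The isomorphism of coloured orders matches the cells, each cell is mapped affinely, and
  density extends the map to the hulls. Unfilled cells go to unfilled cells, and removing these from
  the hull leaves the set.\<close>

lemma uniform_homeomorphic:
  assumes A: "uniform D A" and B: "uniform D B" shows "A homeomorphic B"
proof -
  from uniform_hull[OF A]
  obtain m M where mM: "m < M" "cell_union A \<subseteq> {m..M}"
    "A = {m..M} - (\<Union>l\<in>{l\<in>ends A. \<not> filled A l}. {l<..<rt A l})"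
    "\<forall>x y. m \<le> x \<and> x < y \<and> y \<le> M \<longrightarrow> (\<exists>w\<in>cell_union A. x < w \<and> w < y)" .
  have dA: "\<exists>w\<in>cell_union A. x < w \<and> w < y" if "m \<le> x" "x < y" "y \<le> M" for x y using mM(4) that by blast
  from uniform_hull[OF B]
  obtain m' M' where mM': "m' < M'" "cell_union B \<subseteq> {m'..M'}"
    "B = {m'..M'} - (\<Union>l\<in>{l\<in>ends B. \<not> filled B l}. {l<..<rt B l})"
    "\<forall>x y. m' \<le> x \<and> x < y \<and> y \<le> M' \<longrightarrow> (\<exists>w\<in>cell_union B. x < w \<and> w < y)" .
  have dB: "\<exists>w\<in>cell_union B. x < w \<and> w < y" if "m' \<le> x" "x < y" "y \<le> M'" for x y using mM'(4) that by blast
  obtain \<sigma> where s: "bij_betw \<sigma> (ends A) (ends B)"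
    "\<And>x y. x \<in> ends A \<Longrightarrow> y \<in> ends A \<Longrightarrow> x < y \<Longrightarrow> \<sigma> x < \<sigma> y"
    "\<And>x. x \<in> ends A \<Longrightarrow> filled B (\<sigma> x) = filled A x"
    using dense_pattern_unique[OF uniform_dense_pattern[OF A] uniform_dense_pattern[OF B]] by metis
  have sB: "\<sigma> l \<in> ends B" if "l \<in> ends A" for l using s(1) that unfolding bij_betw_def by blast
  have ltA: "l < rt A l" if "l \<in> ends A" for l using cell_less[OF rt_cell[OF that]] .
  have ltB: "l < rt B l" if "l \<in> ends B" for l using cell_less[OF rt_cell[OF that]] .
  define lin where "lin l w = \<sigma> l + (w - l) * ((rt B (\<sigma> l) - \<sigma> l) / (rt A l - l))" for l w
  have lin_mono: "lin l v < lin l w" if "l \<in> ends A" "v < w" for l v w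
  proof -
    have "(rt B (\<sigma> l) - \<sigma> l) / (rt A l - l) > 0" using ltA[OF that(1)] ltB[OF sB[OF that(1)]] by simp
    then show ?thesis
      unfolding lin_def add_less_cancel_left using that(2) by (intro mult_strict_right_mono) auto
  qed
  have lin_ends: "lin l l = \<sigma> l" "lin l (rt A l) = rt B (\<sigma> l)" if "l \<in> ends A" for l
    using ltA[OF that] unfolding lin_def by auto
  have lin_cont: "continuous_on S (lin l)" for S l unfolding lin_def by (intro continuous_intros)
  have lin_img: "lin l ` {l<..<rt A l} = {\<sigma> l<..<rt B (\<sigma> l)}" if l: "l \<in> ends A" for l
  proof
    show "lin l ` {l<..<rt A l} \<subseteq> {\<sigma> l<..<rt B (\<sigma> l)}"
      using lin_mono[OF l] lin_ends[OF l] by (metis (no_types, lifting) greaterThanLessThan_iff image_subsetI)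
    show "{\<sigma> l<..<rt B (\<sigma> l)} \<subseteq> lin l ` {l<..<rt A l}"
    proof
      fix y assume y: "y \<in> {\<sigma> l<..<rt B (\<sigma> l)}"
      then obtain x where x: "l \<le> x" "x \<le> rt A l" "lin l x = y"
        using IVT'[of "lin l" l y "rt A l"] lin_ends[OF l] ltA[OF l] lin_cont by auto
      then have "x \<noteq> l" "x \<noteq> rt A l" using y lin_ends[OF l] by auto
      then show "y \<in> lin l ` {l<..<rt A l}" using x by auto
    qed
  qed
  have uniq: "l = l'" if "l \<in> ends A" "l < w" "w < rt A l" "l' \<in> ends A" "l' < w" "w < rt A l'" for l l' w
    using cells_ordered[OF A rt_cell rt_cell, of l l'] cells_ordered[OF A rt_cell rt_cell, of l' l] that
    by (metis less_asym linorder_neqE less_trans)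
  \<comment> \<open>The definite description is sound on open cells since they are disjoint
    (\<open>uniq\<close>).\<close>
  define \<tau> where "\<tau> w = lin (THE l. l \<in> ends A \<and> l < w \<and> w < rt A l) w" for w
  have t_eq: "\<tau> w = lin l w" if "l \<in> ends A" "w \<in> {l<..<rt A l}" for l w
  proof -
    have "(THE l. l \<in> ends A \<and> l < w \<and> w < rt A l) = l"
      by (rule the_equality) (use that uniq in auto)
    then show ?thesis unfolding \<tau>_def by simp
  qed
  have t_img: "\<tau> ` {l<..<rt A l} = {\<sigma> l<..<rt B (\<sigma> l)}" if "l \<in> ends A" for l
    using lin_img[OF that] t_eq[OF that] by (metis (no_types, lifting) image_cong)
  have t_Un: "\<tau> ` (\<Union>l\<in>{l\<in>ends A. P l}. {l<..<rt A l}) = (\<Union>l\<in>{l\<in>ends B. Q l}. {l<..<rt B l})"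
    if PQ: "\<And>l. l \<in> ends A \<Longrightarrow> Q (\<sigma> l) = P l" for P Q
  proof -
    have "ends B = \<sigma> ` ends A" using s(1) unfolding bij_betw_def by simp
    then have "{l\<in>ends B. Q l} = \<sigma> ` {l\<in>ends A. P l}" using PQ by auto
    then have "(\<Union>l\<in>{l\<in>ends B. Q l}. {l<..<rt B l}) = (\<Union>l\<in>{l\<in>ends A. P l}. {\<sigma> l<..<rt B (\<sigma> l)})"
      by simp
    also have "\<dots> = (\<Union>l\<in>{l\<in>ends A. P l}. \<tau> ` {l<..<rt A l})" using t_img by simp
    finally show ?thesis by (simp add: image_UN)
  qed
  have t_mono: "\<tau> v < \<tau> w" if "v \<in> cell_union A" "w \<in> cell_union A" "v < w" for v w
  proof -
    obtain l where l: "l \<in> ends A" "v \<in> {l<..<rt A l}" using \<open>v \<in> cell_union A\<close> unfolding cell_union_def by blast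
    obtain k where k: "k \<in> ends A" "w \<in> {k<..<rt A k}" using \<open>w \<in> cell_union A\<close> unfolding cell_union_def by blast
    show ?thesis
    proof (cases "l = k")
      case True
      then show ?thesis using t_eq[OF l] t_eq[OF k] lin_mono[OF l(1) that(3)] by simp
    next
      case False
      then have "l < k" using cells_ordered[OF A rt_cell[OF k(1)] rt_cell[OF l(1)]] l k that(3) by fastforce
      then have "rt B (\<sigma> l) < \<sigma> k" using cells_ordered[OF B rt_cell[OF sB[OF l(1)]] rt_cell[OF sB[OF k(1)]]] s(2) l k by blast
      moreover have "\<tau> v \<in> {\<sigma> l<..<rt B (\<sigma> l)}" using t_img[OF l(1)] l(2) by blast
      moreover have "\<tau> w \<in> {\<sigma> k<..<rt B (\<sigma> k)}" using t_img[OF k(1)] k(2) by blast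
      ultimately show ?thesis by auto
    qed
  qed
  have tU: "\<tau> ` cell_union A = cell_union B"
    using t_Un[of "\<lambda>_. True" "\<lambda>_. True"] unfolding cell_union_def by simp
  obtain h where h: "topemb {m..M} h" "h ` {m..M} = {m'..M'}" "\<And>w. w \<in> cell_union A \<Longrightarrow> h w = \<tau> w"
  proof (rule dense_mono_extension[of m M m' M' "cell_union A" "cell_union B" \<tau>])
    show "\<exists>w\<in>cell_union A. x < w \<and> w < y" if "m \<le> x" "x < y" "y \<le> M" for x y using dA that .
    show "\<exists>w\<in>cell_union B. x < w \<and> w < y" if "m' \<le> x" "x < y" "y \<le> M'" for x y using dB that .
    show "\<tau> v < \<tau> w" if "v \<in> cell_union A" "w \<in> cell_union A" "v < w" for v w using t_mono that .
  qed (use mM(1,2) mM'(1,2) tU in auto)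
  let ?G = "\<Union>l\<in>{l\<in>ends A. \<not> filled A l}. {l<..<rt A l}"
  have G: "?G \<subseteq> cell_union A" unfolding cell_union_def by blast
  have "h ` ?G = \<tau> ` ?G" using h(3) G by (intro image_cong) blast+
  also have "\<dots> = (\<Union>l\<in>{l\<in>ends B. \<not> filled B l}. {l<..<rt B l})"
    by (rule t_Un) (simp add: s(3))
  finally have hG: "h ` ?G = (\<Union>l\<in>{l\<in>ends B. \<not> filled B l}. {l<..<rt B l})" .
  have "h ` ({m..M} - ?G) = h ` {m..M} - h ` ?G"
    using h(1) G mM(2) unfolding topemb_def by (intro inj_on_image_set_diff[of h "{m..M}"]) blast+
  then have "h ` A = B" unfolding hG h(2) mM(3)[symmetric] mM'(3)[symmetric] .
  moreover have "A \<subseteq> {m..M}" by (subst mM(3)) (rule Diff_subset)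
  then have "topemb A h" by (rule topemb_subset[OF h(1)])
  moreover have "compact A" using A unfolding uniform_def by blast
  ultimately show ?thesis using homeomorphic_topemb by metis
qed

section \<open>Counting homeomorphism types\<close>

definition locally_in :: "real set \<Rightarrow> real set \<Rightarrow> bool" where
  "locally_in A B \<longleftrightarrow> (\<forall>x\<in>A. \<exists>Q. clopen_in A Q \<and> x \<in> Q \<and> embeds Q B)"

text \<open>The list acts as a finite code for the homeomorphism type of \<open>A\<close>
  (\<open>built_from_homeomorphic\<close>).\<close>

fun built_from :: "real set list \<Rightarrow> real set \<Rightarrow> bool" where
  "built_from [] A \<longleftrightarrow> A = {}"
| "built_from (D # Ds) A \<longleftrightarrow> (\<exists>U. clopen_in A U \<and> U homeomorphic D \<and> built_from Ds (A - U))"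

lemma built_from_homeomorphic: "built_from Ds A \<Longrightarrow> built_from Ds B \<Longrightarrow> A homeomorphic B"
proof (induction Ds arbitrary: A B)
  case Nil
  then show ?case by simp
next
  case (Cons D Ds)
  obtain U where U: "clopen_in A U" "U homeomorphic D" "built_from Ds (A - U)" using Cons.prems by auto
  obtain V where V: "clopen_in B V" "V homeomorphic D" "built_from Ds (B - V)" using Cons.prems by auto
  have "(U \<union> (A - U)) homeomorphic (V \<union> (B - V))"
  proof (rule homeomorphic_Un)
    show "compact U" "compact (A - U)" using U(1) unfolding clopen_in_def by auto
    show "U homeomorphic V" using U(2) V(2) homeomorphic_sym homeomorphic_trans by blast
    show "(A - U) homeomorphic (B - V)" using Cons.IH U(3) V(3) by blast
  qed auto
  moreover have "U \<union> (A - U) = A" "V \<union> (B - V) = B"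
    using clopen_in_subset[OF U(1)] clopen_in_subset[OF V(1)] by auto
  ultimately show ?case by simp
qed

lemma homeomorphic_clopen:
  assumes "U homeomorphic D" "compact U" "clopen_in U V"
  obtains E where "clopen_in D E" "V homeomorphic E"
proof -
  obtain f where f: "topemb U f" "f ` U = D" using assms(1) by (rule homeomorphic_topembE)
  have "V homeomorphic (f ` V)"
    using homeomorphic_topemb[OF clopen_in_compact[OF assms(3)] topemb_subset[OF f(1) clopen_in_subset[OF assms(3)]]] .
  then show ?thesis using that clopen_in_image[OF f(1) assms(3)] f(2) by blast
qed

text \<open>Every piece is intersected with \<open>V\<close>; this supplies the hereditary clause of
  \<open>clopen_induct\<close>.\<close>

lemma built_from_clopen:
  assumes "built_from Ds U" "clopen_in U V" "Ds \<in> lists {D. clopen_in B D}"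
  shows "\<exists>Es\<in>lists {D. clopen_in B D}. built_from Es V"
  using assms
proof (induction Ds arbitrary: U V)
  case Nil
  then have "V = {}" using clopen_in_subset by fastforce
  then show ?case by (intro bexI[of _ "[]"]) auto
next
  case (Cons D Ds)
  obtain W where W: "clopen_in U W" "W homeomorphic D" "built_from Ds (U - W)" using Cons.prems by auto
  have cV: "compact V" "V \<subseteq> U" and cW: "compact W" "W \<subseteq> U"
    using clopen_in_compact[OF Cons.prems(2)] clopen_in_subset[OF Cons.prems(2)]
      clopen_in_compact[OF W(1)] clopen_in_subset[OF W(1)] by auto
  have "clopen_in W (W \<inter> V)" using clopen_in_restrict[OF Cons.prems(2) cW] .
  then obtain E where E: "clopen_in D E" "(W \<inter> V) homeomorphic E" using homeomorphic_clopen[OF W(2) cW(1)] by blast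
  have "clopen_in (U - W) ((U - W) \<inter> V)"
    using clopen_in_restrict[OF Cons.prems(2), of "U - W"] W(1) unfolding clopen_in_def by auto
  moreover have "(U - W) \<inter> V = V - W \<inter> V" using cV by auto
  ultimately have "clopen_in (U - W) (V - W \<inter> V)" by simp
  moreover have "Ds \<in> lists {D. clopen_in B D}" using Cons.prems(3) by simp
  ultimately obtain Es where Es: "Es \<in> lists {D. clopen_in B D}" "built_from Es (V - W \<inter> V)"
    using Cons.IH[OF W(3)] by blast
  have "clopen_in B E" using Cons.prems(3) E(1) clopen_in_trans by auto
  moreover have "clopen_in V (W \<inter> V)" using clopen_in_restrict[OF W(1) cV] by (simp add: Int_commute)
  ultimately show ?case using E Es by (intro bexI[of _ "E # Es"]) auto
qed

lemma built_from_append: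
  assumes "built_from Ds U" "built_from Es V" "compact U" "compact V" "U \<inter> V = {}"
  shows "built_from (Ds @ Es) (U \<union> V)"
  using assms
proof (induction Ds arbitrary: U)
  case (Cons D Ds)
  obtain W where W: "clopen_in U W" "W homeomorphic D" "built_from Ds (U - W)" using Cons.prems by auto
  have c: "compact W" "compact (U - W)" "W \<subseteq> U" using W(1) unfolding clopen_in_def by auto
  have "(U \<union> V) - W = (U - W) \<union> V" using Cons.prems(5) c(3) by auto
  moreover have "built_from (Ds @ Es) ((U - W) \<union> V)"
    using Cons.IH[OF W(3) Cons.prems(2) c(2) Cons.prems(4)] Cons.prems(5) by auto
  moreover have "clopen_in (U \<union> V) W"
    unfolding clopen_in_def \<open>(U \<union> V) - W = (U - W) \<union> V\<close> using c Cons.prems(4) by (auto intro: compact_Un)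
  ultimately show ?case using W(2) by auto
qed simp

lemma locally_in_built_from:
  assumes "compact A" "locally_in A B" "compact B"
  shows "\<exists>Ds\<in>lists {D. clopen_in B D}. built_from Ds A"
proof (rule clopen_induct[OF assms(1)])
  fix x assume "x \<in> A"
  then obtain Q where Q: "clopen_in A Q" "x \<in> Q" "embeds Q B" using assms(2) unfolding locally_in_def by blast
  then obtain D where D: "clopen_in B D" "Q homeomorphic D" unfolding embeds_def by blast
  have "built_from [D] Q" using D(2) clopen_in_self[OF clopen_in_compact[OF Q(1)]] by auto
  then show "\<exists>U. clopen_in A U \<and> x \<in> U \<and> (\<exists>Ds\<in>lists {D. clopen_in B D}. built_from Ds U)"
    using Q D(1) by (intro exI[of _ Q] conjI bexI[of _ "[D]"]) auto
next
  show "\<exists>Ds\<in>lists {D. clopen_in B D}. built_from Ds {}" by (intro bexI[of _ "[]"]) auto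
next
  fix U V assume "\<exists>Ds\<in>lists {D. clopen_in B D}. built_from Ds U" "clopen_in U V"
  then show "\<exists>Ds\<in>lists {D. clopen_in B D}. built_from Ds V" using built_from_clopen by blast
next
  fix U V :: "real set"
  assume "\<exists>Ds\<in>lists {D. clopen_in B D}. built_from Ds U" "\<exists>Ds\<in>lists {D. clopen_in B D}. built_from Ds V"
    and UV: "compact U" "compact V" "U \<inter> V = {}"
  then obtain Ds Es where "Ds \<in> lists {D. clopen_in B D}" "built_from Ds U"
    "Es \<in> lists {D. clopen_in B D}" "built_from Es V" by blast
  then show "\<exists>Ds\<in>lists {D. clopen_in B D}. built_from Ds (U \<union> V)"
    using built_from_append[of Ds U Es V] UV by (intro bexI[of _ "Ds @ Es"]) auto
qed

text \<open>By compactness a clopen set is the trace of finitely many open intervals with rational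
  ends.\<close>

lemma countable_clopen: "compact B \<Longrightarrow> countable {D. clopen_in B D}"
proof -
  assume B: "compact B"
  let ?F = "\<lambda>I. B \<inter> (\<Union>(p, q)\<in>I. {p<..<q})"
  have "{D. clopen_in B D} \<subseteq> ?F ` {I. finite I \<and> I \<subseteq> \<rat> \<times> \<rat>}"
  proof
    fix D assume "D \<in> {D. clopen_in B D}"
    then have D: "clopen_in B D" by simp
    have "\<exists>p q. p \<in> \<rat> \<and> q \<in> \<rat> \<and> p < x \<and> x < q \<and> B \<inter> {p<..<q} \<subseteq> D" if x: "x \<in> D" for x
    proof -
      obtain d where d: "d > 0" "B \<inter> ball x d \<subseteq> D" using clopen_in_ball[OF D x] by blast
      obtain p where p: "p \<in> \<rat>" "x - d < p" "p < x" using Rats_dense_in_real[of "x - d" x] d by auto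
      obtain q where q: "q \<in> \<rat>" "x < q" "q < x + d" using Rats_dense_in_real[of x "x + d"] d by auto
      have "{p<..<q} \<subseteq> ball x d" using p q by (auto simp: dist_real_def)
      then show ?thesis using p q d(2) by blast
    qed
    then obtain p q where pq: "\<And>x. x \<in> D \<Longrightarrow> p x \<in> \<rat> \<and> q x \<in> \<rat> \<and> p x < x \<and> x < q x \<and> B \<inter> {p x<..<q x} \<subseteq> D"
      by metis
    have "D \<subseteq> (\<Union>x\<in>D. {p x<..<q x})" using pq by fastforce
    then obtain G where G: "G \<subseteq> D" "finite G" "D \<subseteq> (\<Union>x\<in>G. {p x<..<q x})"
      using compactE_image[OF clopen_in_compact[OF D], of D "\<lambda>x. {p x<..<q x}"] by auto
    have sub: "B \<inter> {p x<..<q x} \<subseteq> D" if "x \<in> G" for x using pq G(1) that by blast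
    have "?F ((\<lambda>x. (p x, q x)) ` G) = B \<inter> (\<Union>x\<in>G. {p x<..<q x})" by auto
    also have "\<dots> = D" using sub G(3) clopen_in_subset[OF D] by blast
    finally have "D = ?F ((\<lambda>x. (p x, q x)) ` G)" by simp
    moreover have "finite ((\<lambda>x. (p x, q x)) ` G)" "(\<lambda>x. (p x, q x)) ` G \<subseteq> \<rat> \<times> \<rat>"
      using G(1,2) pq by auto
    ultimately show "D \<in> ?F ` {I. finite I \<and> I \<subseteq> \<rat> \<times> \<rat>}" by blast
  qed
  moreover have "countable {I. finite I \<and> I \<subseteq> (\<rat> \<times> \<rat> :: (real \<times> real) set)}"
    by (intro countable_Collect_finite_subset countable_SIGMA countable_rat)
  ultimately show ?thesis using countable_subset countable_image by meson
qed

text \<open>Each such type is coded by a finite list taken from the countable family of clopen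
  subsets of \<open>B\<close>.\<close>

lemma countable_locally_in:
  assumes F: "\<And>A. A \<in> F \<Longrightarrow> compact A" "pairwise (\<lambda>A B. \<not> A homeomorphic B) F" and B: "compact B"
  shows "countable {A \<in> F. locally_in A B}"
proof -
  let ?L = "lists {D. clopen_in B D}"
  have "\<exists>Ds. Ds \<in> ?L \<and> built_from Ds A" if "A \<in> {A \<in> F. locally_in A B}" for A
    using locally_in_built_from[OF F(1) _ B] that by blast
  then obtain w where w: "\<And>A. A \<in> {A \<in> F. locally_in A B} \<Longrightarrow> w A \<in> ?L \<and> built_from (w A) A" by metis
  have "inj_on w {A \<in> F. locally_in A B}"
  proof (rule inj_onI)
    fix A A' assume A: "A \<in> {A \<in> F. locally_in A B}" "A' \<in> {A \<in> F. locally_in A B}" "w A = w A'"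
    then have "A homeomorphic A'" using w[OF A(1)] w[OF A(2)] built_from_homeomorphic by metis
    then show "A = A'" using F(2) A(1,2) unfolding pairwise_def by blast
  qed
  moreover have "countable (w ` {A \<in> F. locally_in A B})"
    using w countable_lists[OF countable_clopen[OF B]] by (metis (no_types, lifting) countable_subset image_subsetI)
  ultimately show ?thesis using countable_image_inj_on by blast
qed

lemma countable_iff_ordLeq: "countable A \<longleftrightarrow> |A| \<le>o natLeq"
proof -
  have "countable A \<longleftrightarrow> |A| \<le>o |UNIV :: nat set|"
    unfolding countable_def card_of_ordLeq[symmetric] by simp
  also have "\<dots> \<longleftrightarrow> |A| \<le>o natLeq"
    using card_of_nat ordIso_symmetric ordLeq_ordIso_trans by blast
  finally show ?thesis .
qed

lemma infinite_cardSuc_natLeq: "infinite (Field (cardSuc natLeq))"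
  using cardSuc_finite[OF natLeq_Card_order] by (simp add: Field_natLeq)

lemma countable_imp_ordLeq_cardSuc: "countable A \<Longrightarrow> |A| \<le>o cardSuc natLeq"
  using countable_iff_ordLeq cardSuc_ordLeq[OF natLeq_Card_order] ordLeq_transitive by blast

text \<open>If a total relation has countable initial segments, then every uncountable set is cofinal.\<close>

lemma total_countable_segments:
  assumes total: "\<And>A B. A \<in> F \<Longrightarrow> B \<in> F \<Longrightarrow> R A B \<or> R B A"
    and seg: "\<And>B. B \<in> F \<Longrightarrow> countable {A \<in> F. R A B}"
  shows "|F| \<le>o cardSuc natLeq"
proof (rule ccontr)
  let ?k = "cardSuc natLeq"
  have k: "Card_order ?k" using cardSuc_Card_order[OF natLeq_Card_order] .
  assume "\<not> |F| \<le>o ?k"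
  then have "?k \<le>o |F|"
    using not_ordLeq_iff_ordLess[of "|F|" ?k] card_of_Well_order k ordLess_imp_ordLeq
    by (metis card_order_on_well_order_on)
  then have "|Field ?k| \<le>o |F|" using card_of_Field_ordIso[OF k] ordIso_ordLeq_trans by blast
  then obtain f where f: "inj_on f (Field ?k)" "f ` Field ?k \<subseteq> F" using card_of_ordLeq by metis
  \<comment> \<open>If \<open>F\<close> were too large it would contain a set \<open>G\<close> of
    size \<open>\<omega>\<^sub>1\<close>; being cofinal, \<open>G\<close> covers \<open>F\<close> by
    that many countable segments.\<close>
  define G where "G = f ` Field ?k"
  have G: "|G| \<le>o ?k" unfolding G_def
    using card_of_image ordLeq_ordIso_trans[OF _ card_of_Field_ordIso[OF k]] by blast
  have unc: "\<not> countable G"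
  proof
    assume "countable G"
    then have "countable (Field ?k)" unfolding G_def using f(1) countable_image_inj_on by blast
    then have "|Field ?k| \<le>o natLeq" using countable_iff_ordLeq by blast
    then have "?k \<le>o natLeq" using ordIso_symmetric[OF card_of_Field_ordIso[OF k]] ordIso_ordLeq_trans by blast
    then show False using cardSuc_greater[OF natLeq_Card_order] not_ordLess_ordLeq by blast
  qed
  have "F \<subseteq> (\<Union>A\<in>G. {B \<in> F. R B A})"
  proof
    fix B assume B: "B \<in> F"
    have "\<not> G \<subseteq> {A \<in> F. R A B}" using unc seg[OF B] countable_subset by blast
    then obtain A where "A \<in> G" "A \<in> F" "\<not> R A B" using f(2) unfolding G_def by blast
    then show "B \<in> (\<Union>A\<in>G. {B \<in> F. R B A})" using total B by blast
  qed
  moreover have "|\<Union>A\<in>G. {B \<in> F. R B A}| \<le>o ?k"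
  proof (rule card_of_UNION_ordLeq_infinite_Field[OF infinite_cardSuc_natLeq k G])
    show "\<forall>A\<in>G. |{B \<in> F. R B A}| \<le>o ?k"
      using seg f(2) countable_imp_ordLeq_cardSuc unfolding G_def by blast
  qed
  ultimately have "|F| \<le>o ?k" using card_of_mono1 ordLeq_transitive by blast
  then show False using \<open>\<not> |F| \<le>o ?k\<close> by blast
qed

section \<open>The classes of t-sets\<close>

context base_class
begin

text \<open>Only extreme points need a base neighbourhood; in a t-set the remaining points then get
  prime neighbourhoods from \<open>t_set_prime_neighbourhood\<close>.\<close>

definition based :: "real set \<Rightarrow> bool" where
  "based A \<longleftrightarrow> (\<forall>p\<in>A. extreme A p \<longrightarrow> (\<exists>W. clopen_in A W \<and> p \<in> W \<and> BB W))"

text \<open>Points witnessing the two failures have prime neighbourhoods, and comparing these by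
  \<open>prime_set_total\<close> refutes one of the failures.\<close>

lemma based_total:
  assumes "t_set A" "t_set B" "based A" "based B" shows "locally_in A B \<or> locally_in B A"
proof (rule ccontr)
  assume no: "\<not> (locally_in A B \<or> locally_in B A)"
  obtain x where x: "x \<in> A" "\<And>Q. clopen_in A Q \<Longrightarrow> x \<in> Q \<Longrightarrow> \<not> embeds Q B" using no unfolding locally_in_def by blast
  obtain y where y: "y \<in> B" "\<And>Q. clopen_in B Q \<Longrightarrow> y \<in> Q \<Longrightarrow> \<not> embeds Q A" using no unfolding locally_in_def by blast
  obtain P where P: "clopen_in A P" "x \<in> P" "prime_set P"
    using t_set_prime_neighbourhood[OF assms(1) _ x(1)] assms(3) unfolding based_def by blast
  obtain Q where Q: "clopen_in B Q" "y \<in> Q" "prime_set Q"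
    using t_set_prime_neighbourhood[OF assms(2) _ y(1)] assms(4) unfolding based_def by blast
  have "embeds P Q \<or> embeds Q P" using prime_set_total P(3) Q(3) by blast
  then show False
    using x(2)[OF P(1,2)] y(2)[OF Q(1,2)] embeds_trans embeds_clopen_in[OF P(1)] embeds_clopen_in[OF Q(1)] by blast
qed

lemma card_based:
  assumes "\<And>A. A \<in> F \<Longrightarrow> t_set A" "pairwise (\<lambda>A B. \<not> A homeomorphic B) F"
  shows "|{A \<in> F. based A}| \<le>o cardSuc natLeq"
proof (rule total_countable_segments[of _ locally_in])
  show "locally_in A B \<or> locally_in B A" if "A \<in> {A \<in> F. based A}" "B \<in> {A \<in> F. based A}" for A B
    using that assms(1) based_total by blast
  show "countable {A \<in> {A \<in> F. based A}. locally_in A B}" if "B \<in> {A \<in> F. based A}" for B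
  proof -
    have "countable {A \<in> F. locally_in A B}"
      using countable_locally_in[of F B] assms that t_set_compact by blast
    then show ?thesis by (rule countable_subset[rotated]) auto
  qed
qed

end

lemma image_interval:
  fixes f :: "real \<Rightarrow> real"
  assumes "topemb X f" "{u..v} \<subseteq> X" "u < v"
  obtains c d where "c < d" "f ` {u..v} = {c..d}"
proof -
  have c: "continuous_on {u..v} f" using assms(1,2) continuous_on_subset unfolding topemb_def by blast
  have "compact (f ` {u..v})" "connected (f ` {u..v})"
    using compact_continuous_image[OF c] connected_continuous_image[OF c] by auto
  then obtain c d where cd: "f ` {u..v} = {c..d}" using connected_compact_interval_1 by blast
  have uv: "u \<in> {u..v}" "v \<in> {u..v}" using assms(3) by auto
  then have "f u \<in> {c..d}" "f v \<in> {c..d}" using cd by blast+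
  moreover have "f u \<noteq> f v"
    using inj_onD[of f X u v] uv assms unfolding topemb_def by blast
  ultimately have "c < d" by auto
  then show ?thesis using that cd by blast
qed

lemma homeomorphic_intervals:
  fixes a b c d :: real
  assumes "a < b" "c < d" shows "{a..b} homeomorphic {c..d}"
proof -
  define m where "m = (d - c) / (b - a)"
  have "m * (b - a) = d - c" using assms unfolding m_def by simp
  then have m: "m > 0" "m * b - m * a = d - c" using assms unfolding m_def by (simp_all add: right_diff_distrib)
  have "(\<lambda>x. m * x + (c - m * a)) ` {a..b} = {m * a + (c - m * a)..m * b + (c - m * a)}"
    using assms m(1) by (simp add: image_affinity_atLeastAtMost)
  also have "\<dots> = {c..d}" using m(2) by simp
  finally show ?thesis using homeomorphic_affine_image[of "{a..b}" m "c - m * a"] m(1) by simp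
qed

lemma homeomorphic_singletons: "{x} homeomorphic {y}" for x y :: real
  using homeomorphic_affine_image[of "{x}" 1 "y - x"] by simp

interpretation point_class: base_class "\<lambda>P. \<exists>x. P = {x}"
proof
  fix P C :: "real set" assume "\<exists>x. P = {x}" "clopen_in P C" "C \<noteq> {}"
  then show "\<exists>x. C = {x}" using clopen_in_subset by (metis subset_singletonD)
qed (use homeomorphic_singletons in auto)

interpretation interval_class: base_class "\<lambda>P. \<exists>a b. a < b \<and> P = {a..b}"
proof
  fix P C :: "real set" assume P: "\<exists>a b. a < b \<and> P = {a..b}" "clopen_in P C" "C \<noteq> {}"
  then obtain a b where ab: "a < b" "P = {a..b}" by blast
  have "C \<subseteq> {a..b}" using clopen_in_subset[OF P(2)] ab(2) by blast
  then have "{a..b} \<inter> C \<noteq> {}" using P(3) by blast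
  then have "{a..b} \<subseteq> C" using interval_clopen_in[of P C a b] P(2) ab(2) by simp
  then show "\<exists>a b. a < b \<and> C = {a..b}" using ab \<open>C \<subseteq> {a..b}\<close> by blast
qed (use homeomorphic_intervals in auto)

lemma extreme_clopen: "clopen_in A W \<Longrightarrow> extreme W p \<Longrightarrow> extreme A p"
  unfolding extreme_def using zd_clopen clopen_in_trans by blast

lemma uniform_clopen:
  assumes A: "compact A" "\<And>p. p \<in> A \<Longrightarrow> extreme A p \<Longrightarrow> zd A p \<and> \<not> clopen_in A {p}"
    and W: "clopen_in A W" "W \<noteq> {}" "\<And>u v. u < v \<Longrightarrow> \<not> {u..v} \<subseteq> W"
  shows "uniform False W"
  unfolding uniform_def
proof (intro conjI ballI impI)
  show "compact W" using clopen_in_compact[OF W(1)] .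
  fix p assume p: "p \<in> W" "extreme W p"
  then have "zd A p" "\<not> clopen_in A {p}" using A(2) extreme_clopen[OF W(1)] clopen_in_subset[OF W(1)] by blast+
  then show "zd W p" "\<not> clopen_in W {p}"
    using zd_subset clopen_in_compact[OF W(1)] clopen_in_subset[OF W(1)] p(1) clopen_in_trans[OF W(1)] by blast+
qed (use W in auto)

text \<open>Without intervals every point of a compact set is zero-dimensional and hence extreme, so
  \<open>uniform False\<close> describes the nonempty compact perfect sets without intervals, that
  is, the Cantor sets.\<close>

interpretation cantor_class: base_class "uniform False"
proof
  fix P C :: "real set" assume P: "uniform False P" "clopen_in P C" "C \<noteq> {}"
  have no: "\<not> {u..v} \<subseteq> P" if "u < v" for u v using P(1) that unfolding uniform_def by simp
  show "uniform False C"
  proof (rule uniform_clopen[OF _ _ P(2,3)])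
    show "\<not> {u..v} \<subseteq> C" if "u < v" for u v using no[OF that] clopen_in_subset[OF P(2)] by blast
  qed (use P(1) in \<open>auto simp: uniform_def\<close>)
next
  show "P homeomorphic Q" if "uniform False P" "uniform False Q" for P Q
    using uniform_homeomorphic that .
qed (auto simp: uniform_def)

text \<open>Two points meet every nonempty clopen set, so three disjoint ones cannot exist. Hence
  each point has a connected clopen neighbourhood, a point or an interval, and
  \<open>{0} \<union> {1..2}\<close> contains one of each.\<close>

lemma not_wide_locally_in:
  assumes A: "compact A" "\<not> wide A" shows "locally_in A ({0} \<union> {1..2})"
  unfolding locally_in_def
proof
  fix x assume x: "x \<in> A"
  obtain q r where qr: "\<And>C. clopen_in A C \<Longrightarrow> C \<noteq> {} \<Longrightarrow> q \<in> C \<or> r \<in> C" using A(2) unfolding wide_def by blast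
  have split: "\<exists>D. clopen_in C D \<and> D \<noteq> {} \<and> D \<noteq> C" if C: "compact C" "\<not> connected C" for C :: "real set"
  proof -
    obtain S T where ST: "closed S" "closed T" "S \<noteq> {}" "T \<noteq> {}" "S \<union> T = C" "S \<inter> T = {}"
      using C connected_closed_set[OF compact_imp_closed[OF C(1)]] by blast
    have "C - S = T" "S = C \<inter> S" "T = C \<inter> T" using ST by auto
    then have "clopen_in C S" unfolding clopen_in_def using C(1) ST(1,2) by (metis compact_Int_closed inf_le1)
    then show ?thesis using ST by (intro exI[of _ S]) auto
  qed
  have "\<exists>Q. clopen_in A Q \<and> x \<in> Q \<and> connected Q"
  proof (cases "connected A")
    case True
    then show ?thesis using clopen_in_self[OF A(1)] x by blast
  next
    case False
    then obtain D where D: "clopen_in A D" "D \<noteq> {}" "D \<noteq> A" using split A(1) by blast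
    define C where "C = (if x \<in> D then D else A - D)"
    have C: "clopen_in A C" "x \<in> C" "C \<noteq> A" "C \<subseteq> A"
      using D x clopen_in_compl[OF D(1)] clopen_in_subset[OF D(1)] unfolding C_def by auto
    have "connected C"
    proof (rule ccontr)
      assume "\<not> connected C"
      then obtain E where E: "clopen_in C E" "E \<noteq> {}" "E \<noteq> C" using split[OF clopen_in_compact[OF C(1)]] by blast
      have EC: "E \<subseteq> C" using clopen_in_subset[OF E(1)] .
      have "clopen_in A E" "clopen_in A (C - E)" "clopen_in A (A - C)"
        using clopen_in_trans[OF C(1)] E(1) clopen_in_compl[OF E(1)] clopen_in_compl[OF C(1)] by auto
      moreover have "C - E \<noteq> {}" "A - C \<noteq> {}" using EC E(3) C(3,4) by auto
      ultimately have "q \<in> E \<or> r \<in> E" "q \<in> C - E \<or> r \<in> C - E" "q \<in> A - C \<or> r \<in> A - C"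
        using qr E(2) by blast+
      then show False using EC by blast
    qed
    then show ?thesis using C by blast
  qed
  then obtain Q where Q: "clopen_in A Q" "x \<in> Q" "connected Q" by blast
  obtain a b where ab: "Q = {a..b}" using connected_compact_interval_1 Q(3) clopen_in_compact[OF Q(1)] by blast
  have "a \<le> b" using Q(2) ab by simp
  have eq: "{0} \<union> {1..2} - {0} = {1..2::real}" "{0} \<union> {1..2} - {1..2} = {0::real}" by auto
  have "clopen_in ({0} \<union> {1..2}) {0::real}" "clopen_in ({0} \<union> {1..2}) {1..2::real}"
    unfolding clopen_in_def eq by auto
  moreover have "Q homeomorphic {0::real} \<or> Q homeomorphic {1..2::real}"
    using homeomorphic_singletons[of a 0] homeomorphic_intervals[of a b 1 2] \<open>a \<le> b\<close> ab by (cases "a = b") auto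
  ultimately have "embeds Q ({0} \<union> {1..2})" unfolding embeds_def by blast
  then show "\<exists>Q. clopen_in A Q \<and> x \<in> Q \<and> embeds Q ({0} \<union> {1..2})" using Q by blast
qed

text \<open>By \<open>extreme_orbit\<close> all extreme points look alike, so the least point
  \<open>q\<close> decides the kind: not zero-dimensional, isolated, or neither.\<close>

lemma t_set_cases:
  assumes tA: "t_set A" and w: "wide A"
  shows "uniform True A \<or> point_class.based A \<or> interval_class.based A \<or> cantor_class.based A"
proof (cases "A = {}")
  case True
  then show ?thesis unfolding point_class.based_def by blast
next
  case False
  have cA: "compact A" using t_set_compact[OF tA] .
  obtain q where q: "q \<in> A" "\<forall>x\<in>A. q \<le> x" using compact_attains_inf[OF cA False] by blast
  then have eq: "extreme A q" using clopen_in_self[OF cA] unfolding extreme_def by blast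
  have orbit: "\<exists>h. topemb A h \<and> h ` A = A \<and> h s = p" if "s \<in> A" "extreme A s" "p \<in> A" "extreme A p" for s p
    using extreme_orbit[OF tA w that(2,4,1,3)] by blast
  have clopen_h: "clopen_in A (h ` W)" if "topemb A h" "h ` A = A" "clopen_in A W" for h W
    using clopen_in_image[OF that(1,3)] that(2) by simp
  show ?thesis
  proof (cases "zd A q")
    case False
    \<comment> \<open>A zero-dimensional point would be extreme and could be moved to
      \<open>q\<close>. So every point lies on an interval, and some interval is clopen.\<close>
    have nz: "\<not> zd A p" if p: "p \<in> A" for p
    proof
      assume z: "zd A p"
      then have "extreme A p" unfolding extreme_def by blast
      then obtain h where h: "topemb A h" "h ` A = A" "h p = q" using orbit[OF p _ q(1) eq] by blast
      then show False using zd_image[OF cA h(1) z] False by simp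
    qed
    have "\<exists>a b. a < b \<and> x \<in> {a..b} \<and> {a..b} \<subseteq> A" if "x \<in> A" for x
      using not_zd_interval[OF cA that nz[OF that]] by blast
    then obtain a b where ab: "a < b" "clopen_in A {a..b}" using isolated_interval[OF cA \<open>A \<noteq> {}\<close>] by blast
    have "a \<in> {a..b}" using ab(1) by simp
    then have a: "extreme A a" "a \<in> A" using ab(2) clopen_in_subset[OF ab(2)] unfolding extreme_def by auto
    have "\<exists>W. clopen_in A W \<and> p \<in> W \<and> (\<exists>c d. c < d \<and> W = {c..d})" if p: "p \<in> A" "extreme A p" for p
    proof -
      obtain h where h: "topemb A h" "h ` A = A" "h a = p" using orbit[OF a(2,1) p] by blast
      obtain c d where "c < d" "h ` {a..b} = {c..d}" using image_interval[OF h(1) clopen_in_subset[OF ab(2)] ab(1)] by blast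
      then show ?thesis using clopen_h[OF h(1,2) ab(2)] h(3) \<open>a \<in> {a..b}\<close> by blast
    qed
    then have "interval_class.based A" unfolding interval_class.based_def by blast
    then show ?thesis by blast
  next
    case zq: True
    show ?thesis
    proof (cases "clopen_in A {q}")
      case True
      have "\<exists>W. clopen_in A W \<and> p \<in> W \<and> (\<exists>x. W = {x})" if p: "p \<in> A" "extreme A p" for p
      proof -
        obtain h where h: "topemb A h" "h ` A = A" "h q = p" using orbit[OF q(1) eq p] by blast
        then show ?thesis using clopen_h[OF h(1,2) True] by auto
      qed
      then have "point_class.based A" unfolding point_class.based_def by blast
      then show ?thesis by blast
    next
      case False
      have ext: "zd A p \<and> \<not> clopen_in A {p}" if p: "p \<in> A" "extreme A p" for p
      proof
        obtain h where h: "topemb A h" "h ` A = A" "h q = p" using orbit[OF q(1) eq p] by blast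
        then show "zd A p" using zd_image[OF cA h(1) zq] by simp
        obtain k where k: "topemb A k" "k ` A = A" "k p = q" using orbit[OF p q(1) eq] by blast
        then show "\<not> clopen_in A {p}" using clopen_h[OF k(1,2), of "{p}"] False by auto
      qed
      show ?thesis
      proof (cases "\<forall>C. clopen_in A C \<longrightarrow> C \<noteq> {} \<longrightarrow> (\<exists>u v. u < v \<and> {u..v} \<subseteq> C)")
        case True
        then have "uniform True A" unfolding uniform_def using cA \<open>A \<noteq> {}\<close> ext by simp
        then show ?thesis by blast
      next
        case False
        \<comment> \<open>A clopen set without intervals is carried to every extreme point along the
          orbit of its least point; the images are Cantor sets.\<close>
        then obtain C where C: "clopen_in A C" "C \<noteq> {}" "\<And>u v. u < v \<Longrightarrow> \<not> {u..v} \<subseteq> C" by blast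
        obtain s where s: "s \<in> C" "\<forall>x\<in>C. s \<le> x" using compact_attains_inf[OF clopen_in_compact[OF C(1)] C(2)] by blast
        then have es: "extreme A s" "s \<in> A" using C(1) clopen_in_subset[OF C(1)] unfolding extreme_def by blast+
        have "\<exists>W. clopen_in A W \<and> p \<in> W \<and> uniform False W" if p: "p \<in> A" "extreme A p" for p
        proof -
          obtain h where h: "topemb A h" "h ` A = A" "h s = p" using orbit[OF es(2,1) p] by blast
          have W: "clopen_in A (h ` C)" "p \<in> h ` C" using clopen_h[OF h(1,2) C(1)] h(3) s(1) by auto
          obtain g where g: "topemb (h ` C) g" "g ` h ` C = C"
            using topemb_inverse[OF clopen_in_compact[OF C(1)] topemb_subset[OF h(1) clopen_in_subset[OF C(1)]]] by metis
          have "\<not> {u..v} \<subseteq> h ` C" if uv: "u < v" for u v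
          proof
            assume sub: "{u..v} \<subseteq> h ` C"
            obtain c d where "c < d" "g ` {u..v} = {c..d}" using image_interval[OF g(1) sub uv] by blast
            then show False using C(3)[of c d] image_mono[OF sub, of g] g(2) by simp
          qed
          then have "uniform False (h ` C)" using uniform_clopen[OF cA ext W(1)] C(2) by simp
          then show ?thesis using W by blast
        qed
        then have "cantor_class.based A" unfolding cantor_class.based_def by blast
        then show ?thesis by blast
      qed
    qed
  qed
qed

theorem theorem28:
  fixes \<F> :: "real set set"
  assumes "\<And>A. A \<in> \<F> \<Longrightarrow> t_set A"
    and "pairwise (\<lambda>A B. \<not> A homeomorphic B) \<F>"
  shows "|\<F>| \<le>o cardSuc natLeq"
proof -
  let ?k = "cardSuc natLeq"
  have k: "Card_order ?k" using cardSuc_Card_order[OF natLeq_Card_order] .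
  have Un: "|S \<union> T| \<le>o ?k" if "|S| \<le>o ?k" "|T| \<le>o ?k" for S T :: "real set set"
    using card_of_Un_ordLeq_infinite_Field[OF infinite_cardSuc_natLeq that k] .
  have cA: "compact A" if "A \<in> \<F>" for A using t_set_compact assms(1) that by blast
  have cB: "compact ({0} \<union> {1..2::real})" by (intro compact_Un) auto
  have "countable {A \<in> \<F>. \<not> wide A}"
  proof (rule countable_subset)
    show "{A \<in> \<F>. \<not> wide A} \<subseteq> {A \<in> \<F>. locally_in A ({0} \<union> {1..2})}" using not_wide_locally_in cA by blast
    show "countable {A \<in> \<F>. locally_in A ({0} \<union> {1..2})}" using countable_locally_in[OF cA assms(2) cB] by blast
  qed
  then have 1: "|{A \<in> \<F>. \<not> wide A}| \<le>o ?k" by (rule countable_imp_ordLeq_cardSuc)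
  have "A = B" if "A \<in> {A \<in> \<F>. uniform True A}" "B \<in> {A \<in> \<F>. uniform True A}" for A B
    using uniform_homeomorphic[of True A B] pairwiseD[OF assms(2), of A B] that by blast
  then have "{A \<in> \<F>. uniform True A} = {} \<or> (\<exists>B. {A \<in> \<F>. uniform True A} = {B})" by blast
  then have "countable {A \<in> \<F>. uniform True A}" by (elim disjE exE) (simp_all only: countable_empty countable_insert)
  then have 2: "|{A \<in> \<F>. uniform True A}| \<le>o ?k" by (rule countable_imp_ordLeq_cardSuc)
  have "\<F> \<subseteq> {A \<in> \<F>. \<not> wide A} \<union> ({A \<in> \<F>. uniform True A} \<union> ({A \<in> \<F>. point_class.based A} \<union>
      ({A \<in> \<F>. interval_class.based A} \<union> {A \<in> \<F>. cantor_class.based A})))"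
    using t_set_cases assms(1) by blast
  moreover have "|\<dots>| \<le>o ?k"
    by (intro Un 1 2 point_class.card_based interval_class.card_based cantor_class.card_based assms)
  ultimately show ?thesis using card_of_mono1 ordLeq_transitive by blast
qed

end
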